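(* Let $\mathbb{X}$ be a Banach space with a basis and let $1<p<\infty$. Assume that at least one of the spaces $B_{\infty,p}=(\bigoplus_{n=1}^\infty\ell_\infty^n)_p$ and $B_{1,p}=(\bigoplus_{n=1}^\infty\ell_1^n)_p$ is isomorphic to a complemented subspace of $\mathbb{X}$. Then $\mathbb{X}$ has a quasi-greedy basis $\mathcal{B}$ such that $L_m[\mathcal{B}]\approx\log m$ for $m\ge2$.
   Context: Banach spaces are real or complex and bases are Schauder bases. Let $\mathcal{B}=(\mathbf{x}_n)_{n=1}^\infty$ be a basis of $\mathbb{X}$ with coordinate functionals $(\mathbf{x}_n^* )_{n=1}^\infty$. For $A\subseteq\mathbb{N}$, the coordinate projection is $S_A[\mathcal{B}](f)=\sum_{n\in A}\mathbf{x}_n^*(f)\,\mathbf{x}_n$ (when well defined), and $\operatorname{supp}(f)=\{n:\mathbf{x}_n^*(f)\neq0\}$. The basis is quasi-greedy if $0<\inf_j\|\mathbf{x}_j\|\le\sup_j\|\mathbf{x}_j\|<\infty$ and there is a constant $C$ such that $\|f-S_A[\mathcal{B}](f)\|\le C\|f\|$ whenever $f\in\mathbb{X}$ and $A\subseteq\mathbb{N}$ satisfy $|\mathbf{x}_j^*(f)|\le|\mathbf{x}_k^*(f)|$ for all $j\in\mathbb{N}\setminus A$ and $k\in A$. The w-conditionality constants are $$L_m[\mathcal{B}]=\sup\left\{\frac{\|S_A[\mathcal{B}](f)\|}{\|f\|}: f\ne0,\ \max(\operatorname{supp}(f))\le m,\ A\subseteq\mathbb{N}\right\}.$$ $\ell_r^n$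 is $\mathbb{F}^n$ ($\mathbb{F}$ the scalar field) with the $\ell_r$-norm, and $(\bigoplus_n\mathbb{X}_n)_p$ is the direct sum in the $\ell_p$-sense. For families of nonnegative reals, $\alpha_i\lesssim\beta_i$ means there is a constant $C$ with $\alpha_i\le C\beta_i$ for all $i$, and $\alpha_i\approx\beta_i$ means $\alpha_i\lesssim\beta_i$ and $\beta_i\lesssim\alpha_i$. *)

theory Defs
  imports "HOL-Analysis.Analysis"
begin

text \<open>
  The scalar field is \<open>\<real>\<close> or \<open>\<complex>\<close>. The class says so up to isometric field isomorphism, so that
  both cases are covered by one type variable.
\<close>

class real_or_complex = real_normed_field +
  assumes real_or_complex:
    "(\<exists>\<phi> :: 'a \<Rightarrow> real. bij \<phi> \<and> (\<forall>a b. \<phi> (a + b) = \<phi> a + \<phi> b) \<and>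
        (\<forall>a b. \<phi> (a * b) = \<phi> a * \<phi> b) \<and> (\<forall>a. norm (\<phi> a) = norm a)) \<or>
     (\<exists>\<phi> :: 'a \<Rightarrow> complex. bij \<phi> \<and> (\<forall>a b. \<phi> (a + b) = \<phi> a + \<phi> b) \<and>
        (\<forall>a b. \<phi> (a * b) = \<phi> a * \<phi> b) \<and> (\<forall>a. norm (\<phi> a) = norm a))"

instance real :: real_or_complex
  by standard (rule disjI1, rule exI[of _ "\<lambda>z. z"], simp add: bij_def)

instance complex :: real_or_complex
  by standard (rule disjI2, rule exI[of _ "\<lambda>z. z"], simp add: bij_def)

text \<open>
  A Banach space over the field \<open>'k\<close> is a (real) Banach space, given by the type \<open>'a\<close>, together with
  a multiplication by scalars from \<open>'k\<close> that extends the real one and is compatible with the norm.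
\<close>

locale banach_space_over = vector_space smul
  for smul :: "'k::real_or_complex \<Rightarrow> 'a::banach \<Rightarrow> 'a" +
  assumes scale_of_real: "smul (of_real r) x = r *\<^sub>R x"
    and norm_scale: "norm (smul c x) = norm c * norm x"

lemma banach_space_over_scaleR: "banach_space_over (scaleR :: real \<Rightarrow> 'a::banach \<Rightarrow> 'a)"
  by unfold_locales (simp_all add: algebra_simps)

lemma banach_space_over_mult: 
  "banach_space_over ((*) :: 'k::{real_or_complex,banach} \<Rightarrow> 'k \<Rightarrow> 'k)"
  by unfold_locales (simp_all add: algebra_simps norm_mult scaleR_conv_of_real)


text \<open>
  Sequences are indexed from 0, so that \<open>x n\<close> stands for the basis vector usually numbered \<open>n + 1\<close>.
\<close>

definition schauder_basis :: "('k \<Rightarrow> 'a::real_normed_vector \<Rightarrow> 'a) \<Rightarrow> (nat \<Rightarrow> 'a) \<Rightarrow> bool" where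
  "schauder_basis smul x \<longleftrightarrow> (\<forall>f. \<exists>!c. (\<lambda>n. smul (c n) (x n)) sums f)"

definition coord ::
    "('k \<Rightarrow> 'a::real_normed_vector \<Rightarrow> 'a) \<Rightarrow> (nat \<Rightarrow> 'a) \<Rightarrow> nat \<Rightarrow> 'a \<Rightarrow> 'k" where
  "coord smul x n f = (THE c. (\<lambda>k. smul (c k) (x k)) sums f) n"

definition supp ::
    "('k::zero \<Rightarrow> 'a::real_normed_vector \<Rightarrow> 'a) \<Rightarrow> (nat \<Rightarrow> 'a) \<Rightarrow> 'a \<Rightarrow> nat set" where
  "supp smul x f = {n. coord smul x n f \<noteq> 0}"

text \<open>
  The sum over \<open>A\<close> is taken in the order of the basis. It is well defined (convergent) wherever it is
  used below: in \<open>w_cond_const\<close> only finitely many terms are nonzero; in \<open>quasi_greedy\<close>, if \<open>A\<close> is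
  infinite then, the coefficients of \<open>f\<close> tending to 0, those outside \<open>A\<close> all vanish, and the sum is
  the expansion of \<open>f\<close> itself.
\<close>

definition coord_proj ::
    "('k \<Rightarrow> 'a::real_normed_vector \<Rightarrow> 'a) \<Rightarrow> (nat \<Rightarrow> 'a) \<Rightarrow> nat set \<Rightarrow> 'a \<Rightarrow> 'a" where
  "coord_proj smul x A f = (\<Sum>n. if n \<in> A then smul (coord smul x n f) (x n) else 0)"

definition quasi_greedy ::
    "('k::real_normed_field \<Rightarrow> 'a::real_normed_vector \<Rightarrow> 'a) \<Rightarrow> (nat \<Rightarrow> 'a) \<Rightarrow> bool" where
  "quasi_greedy smul x \<longleftrightarrow>
     schauder_basis smul x \<and>
     0 < (INF j. norm (x j)) \<and> bdd_above (range (\<lambda>j. norm (x j))) \<and>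
     (\<exists>C. \<forall>f A. (\<forall>j\<in>-A. \<forall>k\<in>A. norm (coord smul x j f) \<le> norm (coord smul x k f)) \<longrightarrow>
        norm (f - coord_proj smul x A f) \<le> C * norm f)"

text \<open>
  With indices starting at 0, the condition \<open>max (supp f) \<le> m\<close> reads \<open>supp f \<subseteq> {..<m}\<close>. For a Schauder
  basis of a Banach space and \<open>m \<ge> 1\<close> the set below is nonempty and bounded, because \<open>f\<close> ranges over
  an \<open>m\<close>-dimensional space on which there are only finitely many distinct coordinate projections.
\<close>

definition w_cond_const ::
    "('k::zero \<Rightarrow> 'a::real_normed_vector \<Rightarrow> 'a) \<Rightarrow> (nat \<Rightarrow> 'a) \<Rightarrow> nat \<Rightarrow> real" where
  "w_cond_const smul x m =
     Sup {norm (coord_proj smul x A f) / norm f | f A. f \<noteq> 0 \<and> supp smul x f \<subseteq> {..<m}}"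


text \<open>
  \<open>\<ell>\<^sub>r\<^sup>n\<close> consists of the scalar sequences vanishing from index \<open>n\<close> on; \<open>r\<close> may be \<open>\<infinity>\<close>.
\<close>

definition fin_seqs :: "nat \<Rightarrow> (nat \<Rightarrow> 'k::zero) set" where
  "fin_seqs n = {u. \<forall>i\<ge>n. u i = 0}"

definition l_norm :: "ereal \<Rightarrow> nat \<Rightarrow> (nat \<Rightarrow> 'k::real_normed_vector) \<Rightarrow> real" where
  "l_norm r n u =
     (if r = \<infinity> then Max ((\<lambda>i. norm (u i)) ` {..<n})
      else (\<Sum>i<n. norm (u i) powr real_of_ereal r) powr (1 / real_of_ereal r))"

definition lp_sum :: "real \<Rightarrow> (nat \<Rightarrow> 'v set) \<Rightarrow> (nat \<Rightarrow> 'v \<Rightarrow> real) \<Rightarrow> (nat \<Rightarrow> 'v) set" where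
  "lp_sum p X N = {v. (\<forall>n. v n \<in> X n) \<and> summable (\<lambda>n. N n (v n) powr p)}"

definition lp_sum_norm :: "real \<Rightarrow> (nat \<Rightarrow> 'v \<Rightarrow> real) \<Rightarrow> (nat \<Rightarrow> 'v) \<Rightarrow> real" where
  "lp_sum_norm p N v = (\<Sum>n. N n (v n) powr p) powr (1 / p)"

text \<open>
  The space \<open>B\<^sub>r\<^sub>,\<^sub>p\<close>: the block with index \<open>n\<close> is \<open>\<ell>\<^sub>r\<close> of dimension \<open>n + 1\<close>, so that the dimensions are
  \<open>1, 2, 3, \<dots>\<close>. Its linear structure is the pointwise one.
\<close>

definition B_space :: "ereal \<Rightarrow> real \<Rightarrow> (nat \<Rightarrow> nat \<Rightarrow> 'k::real_normed_vector) set" where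
  "B_space r p = lp_sum p (\<lambda>n. fin_seqs (Suc n)) (\<lambda>n. l_norm r (Suc n))"

definition B_norm :: "ereal \<Rightarrow> real \<Rightarrow> (nat \<Rightarrow> nat \<Rightarrow> 'k::real_normed_vector) \<Rightarrow> real" where
  "B_norm r p = lp_sum_norm p (\<lambda>n. l_norm r (Suc n))"


definition complemented_subspace ::
    "('k \<Rightarrow> 'a::real_normed_vector \<Rightarrow> 'a) \<Rightarrow> 'a set \<Rightarrow> bool" where
  "complemented_subspace smul Y \<longleftrightarrow>
     (\<exists>P. bounded_linear P \<and> (\<forall>c x. P (smul c x) = smul c (P x)) \<and>
          (\<forall>x. P (P x) = P x) \<and> range P = Y)"

text \<open>
  \<open>V\<close> is a linear space of doubly indexed scalar families with norm \<open>N\<close>, \<open>Y\<close> a subspace of \<open>'a\<close>.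
\<close>

definition isomorphic_to ::
    "('k \<Rightarrow> 'a \<Rightarrow> 'a) \<Rightarrow> (nat \<Rightarrow> nat \<Rightarrow> 'k::real_normed_field) set \<Rightarrow> ((nat \<Rightarrow> nat \<Rightarrow> 'k) \<Rightarrow> real)
      \<Rightarrow> 'a::real_normed_vector set \<Rightarrow> bool" where
  "isomorphic_to smul V N Y \<longleftrightarrow>
     (\<exists>T. bij_betw T V Y \<and>
          (\<forall>u\<in>V. \<forall>v\<in>V. T (\<lambda>n i. u n i + v n i) = T u + T v) \<and>
          (\<forall>c. \<forall>v\<in>V. T (\<lambda>n i. c * v n i) = smul c (T v)) \<and>
          (\<exists>a>0. \<exists>b. \<forall>v\<in>V. a * N v \<le> norm (T v) \<and> norm (T v) \<le> b * N v))"


definition lesssim_on :: "'i set \<Rightarrow> ('i \<Rightarrow> real) \<Rightarrow> ('i \<Rightarrow> real) \<Rightarrow> bool" where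
  "lesssim_on I \<alpha> \<beta> \<longleftrightarrow> (\<exists>C. \<forall>i\<in>I. \<alpha> i \<le> C * \<beta> i)"

definition approx_on :: "'i set \<Rightarrow> ('i \<Rightarrow> real) \<Rightarrow> ('i \<Rightarrow> real) \<Rightarrow> bool" where
  "approx_on I \<alpha> \<beta> \<longleftrightarrow> lesssim_on I \<alpha> \<beta> \<and> lesssim_on I \<beta> \<alpha>"

end

theory Submission
  imports Defs "HOL-Library.Discrete_Functions"
begin

text \<open>
  Since \<open>B\<close> is isomorphic to the direct sum of itself, of \<open>\<ell>\<^sub>p\<close> and of blocks of dimension \<open>2\<^sup>k\<close>,
  the space \<open>X\<close> is isomorphic to \<open>X \<oplus> \<ell>\<^sub>p\<close>, and the first summand has a basis \<open>u\<close> made of the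
  given one and of the summing bases (differences of unit vectors, for \<open>r = 1\<close>) of these blocks, so
  that its unconditionality constants grow linearly. Let the vectors of \<open>u\<close>, which also absorb the
  block averages of \<open>\<ell>\<^sub>p\<close>, take the place of those averages in blocks of length \<open>2\<^sup>n\<close> of the unit vectors of
  \<open>\<ell>\<^sub>p\<close>. The coefficients that stem from the \<open>n\<close>-th vector of \<open>u\<close> decay geometrically in \<open>n\<close>, so a
  greedy projection is, up to the \<open>\<ell>\<^sub>p\<close> part, a partial sum projection of \<open>u\<close>: the resulting
  basis is quasi-greedy. As \<open>n\<close> vectors of \<open>u\<close> need about \<open>2\<^sup>n\<close> vectors of the new basis, linear
  growth becomes logarithmic, and it cannot be faster since each block contributes a bounded amount.
\<close>

subsection \<open>Boundedness of the partial sum projections\<close>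

text \<open>The obstacle is that a greedy set ignores the order of \<open>u\<close>, while
  \<open>u\<close> is controlled only along initial segments. The size of a coefficient therefore
  has to reveal its position. Given a threshold t, the levels n with \<open>2 ^ n\<close> of order
  \<open>(norm f / t) powr p\<close> separate two regimes: below them there are so few indices that
  coefficients of size at most t are harmless in \<open>\<ell>\<^sub>p\<close>, and above them the
  share of \<open>u\<close> in a coefficient is at most t / 2. The weight
  \<open>(2 ^ n) powr (1 / p - 1)\<close> is critical: it is just small enough for Hoelder's
  inequality to bound the weighted sum over one block by the \<open>\<ell>\<^sub>p\<close> norm.

  All direct sums are realised inside X by splitting coordinates. Coordinate 0 of all blocks of B
  forms \<open>\<ell>\<^sub>p\<close>, the upper halves of the blocks whose index is a power of two
  carry the conditional vectors, and the rest is reassembled to a copy of B. The given basis enters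
  through uniformly bounded partial sums, that is, through Banach's theorem on basis
  projections.\<close>

lemma real_or_complex_convergent:
  fixes c :: "nat \<Rightarrow> 'k::real_or_complex"
  assumes "Cauchy c"
  shows "convergent c"
proof -
  \<comment> \<open>The class asserts no completeness; it is inherited along an isometry. An
    arbitrary Banach target lets one argument serve both alternatives of the class axiom.\<close>
  have *: "convergent c"
    if  "bij \<phi>" "\<And>a b. \<phi> (a + b) = \<phi> a + \<phi> b" "\<And>a. norm (\<phi> a) = norm a"
    for \<phi> :: "'k \<Rightarrow> 'b::banach"
  proof -
    interpret additive \<phi> by unfold_locales (rule that)
    have dist: "dist (\<phi> a) (\<phi> b) = dist a b" for a b
      by (simp add: dist_norm that(3) flip: diff)
    have "Cauchy (\<lambda>n. \<phi> (c n))"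
      using assms by (simp add: Cauchy_def dist)
    then obtain l where l: "(\<lambda>n. \<phi> (c n)) \<longlonglongrightarrow> l"
      by (auto simp: Cauchy_convergent_iff convergent_def)
    obtain l' where "l = \<phi> l'" using \<open>bij \<phi>\<close> by (metis bij_pointE)
    with l have "c \<longlonglongrightarrow> l'" by (simp add: lim_sequentially dist)
    then show ?thesis by (rule convergentI)
  qed
  from real_or_complex[where 'a='k] show ?thesis by (elim disjE exE conjE) (rule *; blast)+
qed

context banach_space_over
begin

lemma smul_scaleR: "smul c (r *\<^sub>R y) = r *\<^sub>R smul c y"
  by (metis scale_left_commute scale_of_real)

lemma bounded_linear_smul_left: "bounded_linear (\<lambda>c. smul c y)"
  by (rule bounded_linear_intro[where K = "norm y"])
     (auto simp: scale_left_distrib norm_scale scaleR_conv_of_real scale_of_real simp flip: scale_scale)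

lemma bounded_linear_smul_right: "bounded_linear (smul c)"
  by (rule bounded_linear_intro[where K = "norm c"])
     (auto simp: scale_right_distrib norm_scale smul_scaleR mult.commute)

lemma coord_sums:
  assumes "schauder_basis smul x"
  shows "(\<lambda>n. smul (coord smul x n f) (x n)) sums f"
  unfolding coord_def using assms theI'[of "\<lambda>c. (\<lambda>k. smul (c k) (x k)) sums f"]
  by (auto simp: schauder_basis_def)

lemma coord_eqI:
  assumes "schauder_basis smul x" "(\<lambda>n. smul (c n) (x n)) sums f"
  shows "coord smul x n f = c n"
proof -
  have "\<exists>!c. (\<lambda>n. smul (c n) (x n)) sums f" using assms(1) by (simp add: schauder_basis_def)
  then have "(THE c. (\<lambda>n. smul (c n) (x n)) sums f) = c" using assms(2) by (intro the1_equality[where P = "\<lambda>c. (\<lambda>n. smul (c n) (x n)) sums f"])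
  then show ?thesis by (simp add: coord_def)
qed

lemma coord_linear:
  assumes "schauder_basis smul x"
  shows coord_add: "coord smul x n (f + g) = coord smul x n f + coord smul x n g"
    and coord_diff: "coord smul x n (f - g) = coord smul x n f - coord smul x n g"
    and coord_scale: "coord smul x n (smul a f) = a * coord smul x n f"
    and coord_zero: "coord smul x n 0 = 0"
proof -
  note s = coord_sums[OF assms]
  show "coord smul x n (f + g) = coord smul x n f + coord smul x n g"
    by (rule coord_eqI[OF assms]) (use sums_add[OF s s] in \<open>simp add: scale_left_distrib\<close>)
  show "coord smul x n (f - g) = coord smul x n f - coord smul x n g"
    by (rule coord_eqI[OF assms]) (use sums_diff[OF s s] in \<open>simp add: scale_left_diff_distrib\<close>)
  show "coord smul x n (smul a f) = a * coord smul x n f"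
    by (rule coord_eqI[OF assms])
       (use bounded_linear.sums[OF bounded_linear_smul_right s] in simp)
  show "coord smul x n 0 = 0"
    by (rule coord_eqI[OF assms]) simp
qed

lemma coord_basis:
  assumes "schauder_basis smul x"
  shows "coord smul x n (x m) = (if n = m then 1 else 0)"
proof (rule coord_eqI[OF assms])
  have "(\<lambda>n. if n = m then x n else 0) sums x m" by (rule sums_single)
  also have "(\<lambda>n. if n = m then x n else 0) = (\<lambda>n. smul (if n = m then 1 else 0) (x n))" by auto
  finally show "(\<lambda>n. smul (if n = m then 1 else 0) (x n)) sums x m" .
qed

lemma basis_nonzero:
  assumes "schauder_basis smul x"
  shows "x n \<noteq> 0"
  using coord_basis[OF assms, of n n] coord_zero[OF assms, of n] by auto

definition partial_sum :: "(nat \<Rightarrow> 'a) \<Rightarrow> nat \<Rightarrow> 'a \<Rightarrow> 'a" where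
  "partial_sum x n f = (\<Sum>i<n. smul (coord smul x i f) (x i))"

lemma partial_sum_linear:
  assumes "schauder_basis smul x"
  shows partial_sum_diff: "partial_sum x n (f - g) = partial_sum x n f - partial_sum x n g"
    and partial_sum_scale: "partial_sum x n (smul a f) = smul a (partial_sum x n f)"
    and partial_sum_zero: "partial_sum x n 0 = 0"
  unfolding partial_sum_def coord_linear[OF assms] scale_left_diff_distrib
  by (simp_all add: sum_subtractf scale_sum_right)

lemma partial_sum_scaleR:
  assumes "schauder_basis smul x"
  shows "partial_sum x n (r *\<^sub>R f) = r *\<^sub>R partial_sum x n f"
  using partial_sum_scale[OF assms, of n "of_real r" f] by (simp add: scale_of_real)

lemma partial_sum_tendsto:
  assumes "schauder_basis smul x"
  shows "(\<lambda>n. partial_sum x n f) \<longlonglongrightarrow> f"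
  using coord_sums[OF assms, of f] by (simp add: partial_sum_def sums_def)

text \<open>Baire category for the sets on which all partial sums are bounded by \<open>M\<close>.
  Continuity of the partial sums is not yet available, so only the closures of these sets are used,
  and the bound is obtained for approximations \<open>g\<close> instead of \<open>f\<close>
  itself.\<close>

lemma partial_sum_approx:
  assumes "schauder_basis smul x"
  shows "\<exists>L\<ge>0. \<forall>f. \<forall>e>0. \<exists>g. norm (f - g) < e \<and> (\<forall>n. norm (partial_sum x n g) \<le> L * norm f)"
proof -
  define F where "F M = {f. \<forall>n. norm (partial_sum x n f) \<le> real M}" for M :: nat
  have "\<exists>M. f \<in> F M" for f
  proof -
    have "Bseq (\<lambda>n. partial_sum x n f)"
      using partial_sum_tendsto[OF assms] convergent_imp_Bseq convergentI by blast
    then obtain K where K: "\<And>n. norm (partial_sum x n f) \<le> K" by (auto simp: Bseq_def)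
    obtain M :: nat where "K \<le> M" using real_arch_simple by blast
    then have "f \<in> F M" using order_trans[OF K] unfolding F_def by simp
    then show ?thesis ..
  qed
  then have cover: "(\<Union>M. closure (F M)) = UNIV" using closure_subset by fastforce
  have "\<exists>M. interior (closure (F M)) \<noteq> {}"
  proof (rule ccontr)
    assume *: "\<nexists>M. interior (closure (F M)) \<noteq> {}"
    have "Met_TC.mtopology interior_of \<Union>(range (\<lambda>M. closure (F M))) = {}"
      by (rule Met_TC.metric_Baire_category_alt) (use * in \<open>auto simp: complete_UNIV\<close>)
    then show False using cover by simp
  qed
  then obtain M f0 where f0: "f0 \<in> interior (closure (F M))" by blast
  then obtain \<delta> where \<delta>: "\<delta> > 0" "ball f0 \<delta> \<subseteq> closure (F M)"
    by (auto simp: mem_interior)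
  \<comment> \<open>Subtracting a point of \<open>F M\<close> near \<open>f0\<close> from one near
    \<open>f0 + f\<close> moves the bound to the ball about 0 and doubles it.\<close>
  have small: "\<exists>g. norm (f - g) < e \<and> (\<forall>n. norm (partial_sum x n g) \<le> 2 * real M)"
    if "norm f < \<delta>" "e > 0" for f e
  proof -
    have "f0 + f \<in> closure (F M)" "f0 \<in> closure (F M)"
      using that \<delta> by (auto simp: dist_norm subset_iff)
    then obtain g1 g2 where g: "g1 \<in> F M" "dist g1 (f0 + f) < e / 2" "g2 \<in> F M" "dist g2 f0 < e / 2"
      using \<open>e > 0\<close> unfolding closure_approachable by (meson half_gt_zero)
    have "norm (f - (g1 - g2)) \<le> norm (f0 + f - g1) + norm (f0 - g2)"
      using norm_triangle_ineq4[of "f0 + f - g1" "f0 - g2"] by (simp add: algebra_simps)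
    also have "\<dots> < e" using g by (simp add: dist_norm norm_minus_commute)
    finally have "norm (f - (g1 - g2)) < e" .
    moreover have "norm (partial_sum x n (g1 - g2)) \<le> 2 * real M" for n
    proof -
      have "norm (partial_sum x n g1) \<le> real M" "norm (partial_sum x n g2) \<le> real M"
        using g by (auto simp: F_def)
      then show ?thesis
        using norm_triangle_ineq4[of "partial_sum x n g1" "partial_sum x n g2"]
        by (simp add: partial_sum_diff[OF assms])
    qed
    ultimately show ?thesis by blast
  qed
  \<comment> \<open>A nonzero vector is rescaled to norm \<open>\<delta> / 2\<close>; undoing this
    turns the bound \<open>2 * M\<close> into \<open>4 * M / \<delta>\<close> times the
    norm.\<close>
  define L where "L = 4 * real M / \<delta>"
  have "\<exists>g. norm (f - g) < e \<and> (\<forall>n. norm (partial_sum x n g) \<le> L * norm f)" if e: "e > 0" for f e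
  proof (cases "f = 0")
    case True
    then show ?thesis using e by (intro exI[of _ 0]) (simp add: partial_sum_zero[OF assms])
  next
    case False
    define r where "r = \<delta> / (2 * norm f)"
    have r: "r > 0" using False \<delta> by (simp add: r_def)
    have "norm (r *\<^sub>R f) < \<delta>" using False \<delta> by (simp add: r_def)
    from small[OF this, of "r * e"] obtain g where g: "norm (r *\<^sub>R f - g) < r * e"
      "\<And>n. norm (partial_sum x n g) \<le> 2 * real M" using r e by auto
    have "r *\<^sub>R f - g = r *\<^sub>R (f - (1 / r) *\<^sub>R g)" using r by (simp add: scaleR_diff_right)
    then have "norm (f - (1 / r) *\<^sub>R g) < e" using g(1) r by simp
    moreover have "norm (partial_sum x n ((1 / r) *\<^sub>R g)) \<le> L * norm f" for n
    proof -
      have "norm (partial_sum x n ((1 / r) *\<^sub>R g)) \<le> (1 / r) * (2 * real M)"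
        using g(2)[of n] r by (simp add: partial_sum_scaleR[OF assms] divide_right_mono)
      also have "\<dots> = L * norm f" using \<delta> by (simp add: r_def L_def)
      finally show ?thesis .
    qed
    ultimately show ?thesis by blast
  qed
  moreover have "L \<ge> 0" using \<delta> by (simp add: L_def)
  ultimately show ?thesis by blast
qed

text \<open>Successive approximation as in the open mapping theorem: \<open>f\<close> is a series of
  approximants \<open>g k\<close> whose partial sums decay geometrically in \<open>k\<close>,
  uniformly in \<open>n\<close>. Adding up their coefficients gives an expansion with bounded
  partial sums, and uniqueness of expansions identifies it with that of \<open>f\<close>.\<close>

theorem partial_sum_bounded:
  assumes "schauder_basis smul x"
  shows "\<exists>K. \<forall>f n. norm (partial_sum x n f) \<le> K * norm f"
proof -
  obtain L where L: "L \<ge> 0"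
    "\<And>f e. e > 0 \<Longrightarrow> \<exists>g. norm (f - g) < e \<and> (\<forall>n. norm (partial_sum x n g) \<le> L * norm f)"
    using partial_sum_approx[OF assms] by blast
  have "norm (partial_sum x n f) \<le> 2 * L * norm f" for n f
  proof (cases "f = 0")
    case False
    define G where "G h e = (SOME g. norm (h - g) < e \<and> (\<forall>n. norm (partial_sum x n g) \<le> L * norm h))"
      for h and e :: real
    have G: "norm (h - G h e) < e" "norm (partial_sum x n (G h e)) \<le> L * norm h" if "e > 0" for h e n
      using someI_ex[OF L(2)[OF that, of h]] unfolding G_def by blast+
    define r where "r = rec_nat f (\<lambda>k h. h - G h (norm f / 2 ^ Suc k))"
    define g where "g k = G (r k) (norm f / 2 ^ Suc k)" for k
    have r_Suc: "r (Suc k) = r k - g k" and r_0: "r 0 = f" for k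
      by (simp_all add: r_def g_def)
    have pos: "norm f / 2 ^ Suc k > 0" for k using False by simp
    have r_le: "norm (r k) \<le> norm f / 2 ^ k" for k
    proof (cases k)
      case (Suc l)
      then show ?thesis using G(1)[OF pos[of l], of "r l"] by (simp add: r_Suc g_def)
    qed (simp add: r_0)
    have Sg: "norm (partial_sum x n (g k)) \<le> L * norm f * (1 / 2) ^ k" for n k
    proof -
      have "norm (partial_sum x n (g k)) \<le> L * norm (r k)" using G(2)[OF pos] by (simp add: g_def)
      also have "\<dots> \<le> L * (norm f / 2 ^ k)" by (intro mult_left_mono r_le L)
      finally show ?thesis by (simp add: power_one_over)
    qed
    have sum_g: "(\<Sum>k<m. g k) = f - r m" for m
      by (induction m) (simp_all add: r_0 r_Suc)
    have geo: "summable (\<lambda>k. C * (1 / 2 :: real) ^ k)" for C by (intro summable_mult summable_geometric) simp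
    have r_tendsto: "r \<longlonglongrightarrow> 0"
    proof (rule Lim_null_comparison)
      show "\<forall>\<^sub>F k in sequentially. norm (r k) \<le> norm f * (1 / 2) ^ k"
        using r_le by (simp add: power_one_over)
      show "(\<lambda>k. norm f * (1 / 2) ^ k) \<longlonglongrightarrow> 0" using summable_LIMSEQ_zero[OF geo] .
    qed
    define c where "c i k = coord smul x i (g k)" for i k
    have c_le: "norm (c i k) \<le> (2 * L * norm f / norm (x i)) * (1 / 2) ^ k" for i k
    proof -
      have "smul (c i k) (x i) = partial_sum x (Suc i) (g k) - partial_sum x i (g k)"
        by (simp add: partial_sum_def c_def)
      then have "norm (smul (c i k) (x i)) \<le> L * norm f * (1 / 2) ^ k + L * norm f * (1 / 2) ^ k"
        by (simp only: order_trans[OF norm_triangle_ineq4 add_mono[OF Sg Sg]])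
      then show ?thesis
        using basis_nonzero[OF assms, of i] by (simp add: norm_scale field_simps)
    qed
    have "summable (c i)" for i
    proof -
      have sn: "summable (\<lambda>k. norm (c i k))"
        by (rule summable_comparison_test'[OF geo[of "2 * L * norm f / norm (x i)"], of 0])
           (simp only: norm_ge_zero abs_of_nonneg real_norm_def c_le)
      have "Cauchy (\<lambda>n. \<Sum>k<n. c i k)"
        unfolding Cauchy_altdef2
      proof (intro allI impI)
        fix e :: real assume "e > 0"
        then obtain N where N: "\<And>m n. m \<ge> N \<Longrightarrow> norm (\<Sum>k=m..<n. norm (c i k)) < e"
          using sn[unfolded summable_Cauchy] by blast
        have "dist (\<Sum>k<n. c i k) (\<Sum>k<N. c i k) < e" if "n \<ge> N" for n
        proof -
          have "dist (\<Sum>k<n. c i k) (\<Sum>k<N. c i k) = norm (\<Sum>k=N..<n. c i k)"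
            using that sum_diff_nat_ivl[of 0 N n "c i"] by (simp add: dist_norm atLeast0LessThan)
          also have "\<dots> \<le> (\<Sum>k=N..<n. norm (c i k))" by (rule norm_sum)
          also have "\<dots> < e" using N[of N n] by simp
          finally show ?thesis .
        qed
        then show "\<exists>N. \<forall>n\<ge>N. dist (\<Sum>k<n. c i k) (\<Sum>k<N. c i k) < e" by blast
      qed
      from real_or_complex_convergent[OF this] show ?thesis by (simp add: summable_iff_convergent)
    qed
    then have d: "(\<lambda>k. c i k) sums suminf (c i)" for i by (simp add: summable_sums)
    define D where "D n = (\<Sum>i<n. smul (suminf (c i)) (x i))" for n
    have D_sums: "(\<lambda>k. partial_sum x n (g k)) sums D n" for n
      unfolding D_def partial_sum_def c_def[symmetric]
      by (intro sums_sum bounded_linear.sums[OF bounded_linear_smul_left d])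
    have D_le: "norm (D n) \<le> 2 * L * norm f" for n
    proof -
      have "norm (\<Sum>k. partial_sum x n (g k)) \<le> (\<Sum>k. L * norm f * (1 / 2) ^ k)"
        by (rule norm_suminf_le[OF Sg geo])
      also have "\<dots> = 2 * L * norm f" by (simp add: suminf_mult suminf_geometric)
      finally show ?thesis using D_sums[of n] by (simp add: sums_iff)
    qed
    \<comment> \<open>The limits in \<open>n\<close> and in \<open>m\<close> may be exchanged,
      because the geometric majorant makes the convergence in \<open>m\<close> uniform in
      \<open>n\<close>.\<close>
    have "D \<longlonglongrightarrow> f"
    proof (rule swap_uniform_limit')
      show "\<forall>\<^sub>F m in sequentially. (\<lambda>n. \<Sum>k<m. partial_sum x n (g k)) \<longlonglongrightarrow> (\<Sum>k<m. g k)"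
        by (intro always_eventually allI tendsto_sum partial_sum_tendsto[OF assms])
      show "(\<lambda>m. \<Sum>k<m. g k) \<longlonglongrightarrow> f"
        using tendsto_diff[OF tendsto_const[of f] r_tendsto] by (simp add: sum_g)
      have "uniform_limit UNIV (\<lambda>m n. \<Sum>k<m. partial_sum x n (g k)) (\<lambda>n. \<Sum>k. partial_sum x n (g k)) sequentially"
        by (rule Weierstrass_m_test[OF _ geo]) (use Sg in auto)
      then show "uniform_limit UNIV (\<lambda>m n. \<Sum>k<m. partial_sum x n (g k)) D sequentially"
        using D_sums by (simp add: sums_iff)
    qed auto
    then have "(\<lambda>i. smul (suminf (c i)) (x i)) sums f" unfolding sums_def D_def .
    from coord_eqI[OF assms this] have "partial_sum x n f = D n" by (simp add: partial_sum_def D_def)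
    then show ?thesis using D_le by simp
  qed (simp add: partial_sum_zero[OF assms])
  then show ?thesis by blast
qed

end

subsection \<open>Biorthogonal systems\<close>

context banach_space_over
begin

lemma bounded_linear_functional:
  fixes a :: "'a \<Rightarrow> 'k"
  assumes "\<And>f g. a (f + g) = a f + a g" "\<And>c f. a (smul c f) = c * a f" "\<And>f. norm (a f) \<le> C * norm f"
  shows "bounded_linear a"
proof (rule bounded_linear_intro[where K = C])
  show "a (r *\<^sub>R f) = r *\<^sub>R a f" for r f
    using assms(2)[of "of_real r" f] by (simp add: scale_of_real scaleR_conv_of_real)
qed (use assms in \<open>auto simp: mult.commute\<close>)

text \<open>A continuous functional may be applied termwise to any expansion, and biorthogonality
  then reads off the coefficient; this gives uniqueness.\<close>

lemma biorthogonal_schauder_basis: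
  fixes a :: "nat \<Rightarrow> 'a \<Rightarrow> 'k"
  assumes bounded: "\<And>m. bounded_linear (a m)"
    and scale: "\<And>m c f. a m (smul c f) = c * a m f"
    and biorth: "\<And>m l. a m (x l) = (if m = l then 1 else 0)"
    and sums: "\<And>f. (\<lambda>m. smul (a m f) (x m)) sums f"
  shows "schauder_basis smul x" and "coord smul x m f = a m f"
proof -
  have uniq: "c = (\<lambda>m. a m f)" if "(\<lambda>m. smul (c m) (x m)) sums f" for c f
  proof
    fix m
    have "(\<lambda>l. a m (smul (c l) (x l))) sums a m f"
      by (rule bounded_linear.sums[OF bounded that])
    moreover have "(\<lambda>l. a m (smul (c l) (x l))) = (\<lambda>l. if l = m then c l else 0)"
      by (auto simp: scale biorth)
    ultimately show "c m = a m f" using sums_single[of m c] sums_unique2 by metis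
  qed
  show *: "schauder_basis smul x" unfolding schauder_basis_def
  proof (intro allI ex1I)
    show "(\<lambda>n. smul (a n f) (x n)) sums f" for f by (rule sums)
  qed (use uniq in blast)
  show "coord smul x m f = a m f" by (rule coord_eqI[OF * sums])
qed

lemma coord_proj_finite:
  assumes "finite A"
  shows "coord_proj smul x A f = (\<Sum>n\<in>A. smul (coord smul x n f) (x n))"
proof -
  have "coord_proj smul x A f = (\<Sum>n\<in>A. if n \<in> A then smul (coord smul x n f) (x n) else 0)"
    unfolding coord_proj_def by (rule suminf_finite) (use assms in auto)
  then show ?thesis by simp
qed

end

subsection \<open>Dyadic levels\<close>

text \<open>The shift by one makes the blocks tile the indices from 0 on, the first \<open>n\<close>
  of them filling \<open>{..<2 ^ n - 1}\<close>.\<close>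

definition level :: "nat \<Rightarrow> nat" where "level m = floor_log (Suc m)"

definition block :: "nat \<Rightarrow> nat set" where "block n = {2 ^ n - 1..<2 ^ Suc n - 1}"

lemma mem_block_iff: "m \<in> block n \<longleftrightarrow> level m = n"
proof
  assume "m \<in> block n"
  then have "2 ^ n \<le> Suc m" "Suc m < 2 * 2 ^ n" by (auto simp: block_def)
  then show "level m = n" unfolding level_def by (rule floor_log_eqI[rotated]) simp
next
  assume "level m = n"
  then have "2 ^ n \<le> Suc m" "Suc m < 2 * 2 ^ n"
    using floor_log_exp2_le[of "Suc m"] floor_log_exp2_gt[of "Suc m"] by (auto simp: level_def)
  then show "m \<in> block n" by (auto simp: block_def)
qed

lemma card_block: "card (block n) = 2 ^ n"
  by (simp add: block_def)

lemma finite_block: "finite (block n)"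
  by (simp add: block_def)

lemma lessThan_Suc_blocks: "{..<2 ^ Suc n - 1} = {..<2 ^ n - 1} \<union> block n"
  by (auto simp: block_def)

lemma level_less_iff: "level m < n \<longleftrightarrow> m < 2 ^ n - 1"
proof -
  have *: "m < 2 ^ level m * 2 - 1" "2 ^ level m - 1 \<le> m"
    using mem_block_iff[of m "level m"] by (auto simp: block_def)
  have "(2::nat) ^ Suc (level m) \<le> 2 ^ n" if "level m < n"
    using that by (intro power_increasing) auto
  moreover have "(2::nat) ^ n \<le> 2 ^ level m" if "\<not> level m < n"
    using that by (intro power_increasing) auto
  ultimately show ?thesis using * by fastforce
qed

lemma filterlim_level: "filterlim level at_top at_top"
  unfolding filterlim_at_top eventually_sequentially
  by (meson level_less_iff not_le)

lemma sum_blocks: "(\<Sum>m<2 ^ n - 1. g m) = (\<Sum>i<n. \<Sum>m\<in>block i. g m)"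
  for g :: "nat \<Rightarrow> 'b::comm_monoid_add"
proof (induction n)
  case (Suc n)
  have "(\<Sum>m<2 ^ Suc n - 1. g m) = (\<Sum>m<2 ^ n - 1. g m) + (\<Sum>m\<in>block n. g m)"
    unfolding lessThan_Suc_blocks by (rule sum.union_disjoint) (auto simp: block_def)
  then show ?case using Suc by simp
qed simp

text \<open>Since \<open>2 ^ level m \<le> m + 1 \<le> m * m\<close>, the level is at most twice the
  binary logarithm of \<open>m\<close>; the additional 1 costs a third one.\<close>

lemma level_bound:
  assumes "m \<ge> 2"
  shows "real (Suc (level m)) \<le> 3 / ln 2 * ln (real m)"
proof -
  have "2 ^ level m \<le> Suc m" unfolding level_def by (rule floor_log_exp2_le) simp
  also have "\<dots> \<le> m * m" using assms mult_le_mono1[OF assms, of m] by linarith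
  finally have "real (2 ^ level m) \<le> real (m * m)" by (simp only: of_nat_le_iff)
  then have "ln (2 ^ level m) \<le> ln (real m * real m)" by (intro ln_mono) simp_all
  also have "\<dots> = 2 * ln (real m)" using assms by (subst ln_mult) auto
  finally have "real (level m) * ln 2 \<le> 2 * ln (real m)" by (simp add: ln_realpow)
  moreover have "ln 2 \<le> ln (real m)" using assms by simp
  ultimately show ?thesis by (simp add: field_simps)
qed

subsection \<open>Elementary \<open>\<ell>\<^sub>p\<close> estimates\<close>

lemma add_powr_le:
  fixes x y p :: real
  assumes "x \<ge> 0" "y \<ge> 0" "p > 0"
  shows "(x + y) powr p \<le> 2 powr p * (x powr p + y powr p)"
proof -
  have "(x + y) powr p \<le> (2 * max x y) powr p" using assms by (intro powr_mono2) auto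
  also have "\<dots> = 2 powr p * max x y powr p" by (rule powr_mult)
  also have "\<dots> \<le> 2 powr p * (x powr p + y powr p)" by (intro mult_left_mono) (auto simp: max_def)
  finally show ?thesis .
qed

lemma powr_inverse_le: "x powr (1 / p) \<le> y" if "x \<le> y powr p" "x \<ge> 0" "y \<ge> 0" "p > 0" for x y p :: real
  using powr_mono2[of "1 / p" x "y powr p"] that by (simp add: powr_powr)

text \<open>This is Hoelder's inequality with an additional factor 2, which makes the proof a mere splitting at the value \<open>s\<close>.\<close>

lemma sum_le_lp:
  fixes x :: "'i \<Rightarrow> real" and p N :: real
  assumes "p > 1" "finite F" "N > 0" "card F \<le> N" "\<And>i. i \<in> F \<Longrightarrow> x i \<ge> 0"
  shows "N powr (1 / p - 1) * (\<Sum>i\<in>F. x i) \<le> 2 * (\<Sum>i\<in>F. x i powr p) powr (1 / p)"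
proof -
  define S where "S = (\<Sum>i\<in>F. x i powr p) powr (1 / p)"
  have Sp: "(\<Sum>i\<in>F. x i powr p) = S powr p"
    unfolding S_def using assms by (simp add: powr_powr sum_nonneg)
  show ?thesis
  proof (cases "S = 0")
    case True
    then have "\<forall>i\<in>F. x i powr p = 0"
      using Sp assms sum_nonneg_eq_0_iff[of F "\<lambda>i. x i powr p"] by simp
    then have "(\<Sum>i\<in>F. x i) = 0" by simp
    then show ?thesis by simp
  next
    case False
    \<comment> \<open>This value balances the two contributions: terms up to \<open>s\<close> add at
      most \<open>N * s\<close>, larger ones at most \<open>S powr p * s powr (1 - p)\<close>, and
      both equal \<open>N powr (1 - 1 / p) * S\<close>.\<close>
    define s where "s = N powr (- 1 / p) * S"
    have S: "S > 0" using False by (simp add: S_def)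
    have s: "s > 0" using S assms by (simp add: s_def)
    have "x i \<le> s + x i powr p * s powr (1 - p)" if "i \<in> F" for i
    proof (cases "x i \<le> s")
      case False
      then have "x i = x i powr p * x i powr (1 - p)"
        using s by (simp flip: powr_add)
      also have "\<dots> \<le> x i powr p * s powr (1 - p)"
        using False s assms(1) by (intro mult_left_mono powr_mono2') auto
      also have "\<dots> \<le> s + x i powr p * s powr (1 - p)" using s by simp
      finally show ?thesis .
    qed (use s in \<open>simp add: add_increasing2\<close>)
    then have "(\<Sum>i\<in>F. x i) \<le> (\<Sum>i\<in>F. s + x i powr p * s powr (1 - p))" by (rule sum_mono)
    also have "\<dots> = card F * s + S powr p * s powr (1 - p)"
      by (simp add: sum.distrib Sp flip: sum_distrib_right)
    also have "\<dots> \<le> N * s + S powr p * s powr (1 - p)" using assms s by simp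
    finally have "N powr (1 / p - 1) * (\<Sum>i\<in>F. x i)
        \<le> N powr (1 / p - 1) * (N * s) + N powr (1 / p - 1) * (S powr p * s powr (1 - p))"
      by (metis distrib_left mult_left_mono powr_ge_zero)
    also have "N powr (1 / p - 1) * (N * s) = S"
    proof -
      have "N powr (1 / p - 1) * (N * s) = (N powr (1 / p - 1) * N powr 1 * N powr (- 1 / p)) * S"
        using assms by (simp add: s_def mult_ac)
      also have "N powr (1 / p - 1) * N powr 1 * N powr (- 1 / p) = N powr 0"
        unfolding powr_add[symmetric] by simp
      finally show ?thesis using assms by simp
    qed
    also have "N powr (1 / p - 1) * (S powr p * s powr (1 - p)) = S"
    proof -
      have "s powr (1 - p) = N powr (- 1 / p * (1 - p)) * S powr (1 - p)"
        unfolding s_def powr_mult powr_powr by simp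
      then have "N powr (1 / p - 1) * (S powr p * s powr (1 - p))
         = (N powr (1 / p - 1) * N powr (- 1 / p * (1 - p))) * (S powr p * S powr (1 - p))"
        by (simp only: mult_ac)
      also have "\<dots> = N powr (1 / p - 1 + (- 1 / p * (1 - p))) * S powr 1"
        unfolding powr_add[symmetric] by simp
      also have "1 / p - 1 + (- 1 / p * (1 - p)) = 0" using assms by (simp add: field_simps)
      finally show ?thesis using assms S by simp
    qed
    finally show ?thesis by (simp add: S_def)
  qed
qed

subsection \<open>The Dilworth--Kalton--Kutzarova construction\<close>

text \<open>The space is the sum of one with basis \<open>u\<close> and of the mean-zero part of
  \<open>\<ell>\<^sub>p\<close>. The \<open>h m\<close> are projected unit vectors, hence linearly
  dependent within each block, and \<open>\<beta>_h\<close> is the matrix of the identity minus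
  block averaging. The expansion runs over whole blocks, in step with \<open>u\<close>.\<close>

locale dkk_system = banach_space_over smul
  for smul :: "'k::real_or_complex \<Rightarrow> 'a::banach \<Rightarrow> 'a" +
  fixes p K :: real
    and u h :: "nat \<Rightarrow> 'a"
    and \<alpha> \<beta> :: "nat \<Rightarrow> 'a \<Rightarrow> 'k"
  assumes p: "1 < p" and K: "1 \<le> K"
    and \<alpha>_add: "\<alpha> n (f + g) = \<alpha> n f + \<alpha> n g" and \<alpha>_scale: "\<alpha> n (smul c f) = c * \<alpha> n f"
    and \<beta>_add: "\<beta> n (f + g) = \<beta> n f + \<beta> n g" and \<beta>_scale: "\<beta> n (smul c f) = c * \<beta> n f"
    and \<alpha>_u: "\<alpha> n (u l) = (if n = l then 1 else 0)" and \<alpha>_h: "\<alpha> n (h m) = 0"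
    and \<beta>_u: "\<beta> m (u n) = 0"
    and \<beta>_h: "\<beta> m (h l) = (if m = l then 1 else 0) - (if level m = level l then 1 / 2 ^ level m else 0)"
    and sum_h: "(\<Sum>m\<in>block n. h m) = 0" and sum_\<beta>: "(\<Sum>m\<in>block n. \<beta> m f) = 0"
    and u_le: "norm (u n) \<le> K"
    and \<alpha>_partial_le: "norm (\<Sum>i<n. smul (\<alpha> i f) (u i)) \<le> K * norm f"
    and \<alpha>_le: "norm (\<alpha> n f) \<le> K * norm f"
    and \<beta>_le: "finite F \<Longrightarrow> (\<Sum>m\<in>F. norm (\<beta> m f) powr p) \<le> (K * norm f) powr p"
    and h_le: "finite F \<Longrightarrow>
      norm (\<Sum>m\<in>F. smul (b m) (h m)) \<le> K * (\<Sum>m\<in>F. norm (b m) powr p) powr (1 / p)"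
    and expansion: "(\<lambda>n. (\<Sum>i<n. smul (\<alpha> i f) (u i)) + (\<Sum>m<2 ^ n - 1. smul (\<beta> m f) (h m)))
      \<longlonglongrightarrow> f"
begin

text \<open>
  Here \<open>h m\<close> is the unit vector of \<open>\<ell>\<^sub>p\<close> minus its average over the block. That average has norm
  \<open>qu n = N powr (1 / p - 1)\<close>, where \<open>N = 2 ^ n\<close>, and is replaced by a multiple of \<open>u n\<close> of this size.
\<close>

definition qu :: "nat \<Rightarrow> real" where "qu n = (2 ^ n) powr (1 / p - 1)"

text \<open>Dual to \<open>qu\<close>: the product \<open>qa n * qu n = 1 / 2 ^ n\<close> is exactly
  what \<open>\<beta>_h\<close> lacks for biorthogonality, and \<open>2 ^ n\<close> entries
  \<open>qa n\<close> have \<open>\<ell>\<^sub>p\<close> norm 1.\<close>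

definition qa :: "nat \<Rightarrow> real" where "qa n = (2 ^ n) powr (- 1 / p)"

definition v :: "nat \<Rightarrow> 'a" where
  "v m = h m + smul (of_real (qu (level m))) (u (level m))"

definition a :: "nat \<Rightarrow> 'a \<Rightarrow> 'k" where
  "a m f = \<beta> m f + of_real (qa (level m)) * \<alpha> (level m) f"

lemma qu_pos: "qu n > 0" and qa_pos: "qa n > 0"
  by (simp_all add: qu_def qa_def)

lemma qa_qu: "qa n * qu n = 1 / 2 ^ n"
  unfolding qu_def qa_def powr_add[symmetric] by (simp add: powr_minus field_simps)

lemma qa_powr: "qa n powr p = 1 / 2 ^ n"
proof -
  have "- 1 / p * p = -1" using p by simp
  then show ?thesis unfolding qa_def powr_powr by (simp only: powr_minus powr_one) (simp add: field_simps)
qed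

lemma qa_qu_of_real: "of_real (qa n) * of_real (qu n) = (1 / 2 ^ n :: 'k)"
  unfolding of_real_mult[symmetric] qa_qu by simp

lemma qa_le_1: "qa n \<le> 1"
  using p by (simp add: qa_def powr_minus inverse_le_1_iff ge_one_powr_ge_zero)

lemma qu_le_1: "qu n \<le> 1"
  using p powr_mono[of "1 / p - 1" 0 "2 ^ n"] by (simp add: qu_def)

lemma \<alpha>_sum: "\<alpha> n (\<Sum>i\<in>F. g i) = (\<Sum>i\<in>F. \<alpha> n (g i))"
  and \<beta>_sum: "\<beta> n (\<Sum>i\<in>F. g i) = (\<Sum>i\<in>F. \<beta> n (g i))"
proof -
  have "\<alpha> n 0 = 0" "\<beta> n 0 = 0" using \<alpha>_add[of n 0 0] \<beta>_add[of n 0 0] by simp_all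
  then show "\<alpha> n (\<Sum>i\<in>F. g i) = (\<Sum>i\<in>F. \<alpha> n (g i))" "\<beta> n (\<Sum>i\<in>F. g i) = (\<Sum>i\<in>F. \<beta> n (g i))"
    by (induction F rule: infinite_finite_induct) (auto simp: \<alpha>_add \<beta>_add)
qed

lemma \<beta>_le1: "norm (\<beta> m f) \<le> K * norm f"
proof -
  have "norm (\<beta> m f) powr p \<le> (K * norm f) powr p" using \<beta>_le[of "{m}" f] by simp
  then show ?thesis using p K by (meson mult_nonneg_nonneg norm_ge_zero not_le order_trans
    powr_less_mono2 zero_le_one less_trans zero_less_one)
qed

section \<open>Coordinate functionals and block estimates of the new basis\<close>

lemma a_add: "a m (f + g) = a m f + a m g"
  by (simp add: a_def \<alpha>_add \<beta>_add algebra_simps)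

lemma a_scale: "a m (smul c f) = c * a m f"
  by (simp add: a_def \<alpha>_scale \<beta>_scale algebra_simps)

lemma norm_qa: "norm (of_real (qa n) * (c :: 'k)) = qa n * norm c"
  using qa_pos[of n] by (simp add: norm_mult)

lemma a_le: "norm (a m f) \<le> 2 * K * norm f"
proof -
  have "norm (a m f) \<le> norm (\<beta> m f) + qa (level m) * norm (\<alpha> (level m) f)"
    unfolding a_def by (rule norm_triangle_le) (simp add: norm_qa)
  also have "\<dots> \<le> K * norm f + 1 * (K * norm f)"
    using \<beta>_le1 \<alpha>_le qa_le_1 qa_pos by (intro add_mono mult_mono) (auto simp: less_imp_le)
  finally show ?thesis by simp
qed

lemma a_v: "a m (v l) = (if m = l then 1 else 0)"
proof -
  have "a m (v l) = (if m = l then 1 else 0) - (if level m = level l then 1 / 2 ^ level m else 0)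
     + of_real (qa (level m) * qu (level l)) * (if level m = level l then 1 else 0)"
    by (simp add: a_def v_def \<alpha>_add \<beta>_add \<alpha>_scale \<beta>_scale \<alpha>_u \<alpha>_h \<beta>_u \<beta>_h)
  then show ?thesis by (auto simp: qa_qu_of_real)
qed

definition \<Delta> :: "nat \<Rightarrow> 'a \<Rightarrow> 'a" where
  "\<Delta> n f = smul (\<alpha> n f) (u n) + (\<Sum>m\<in>block n. smul (\<beta> m f) (h m))"

text \<open>On a whole block the mixed terms cancel by \<open>sum_h\<close> and
  \<open>sum_\<beta>\<close>, and the \<open>2 ^ n\<close> multiples of \<open>u n\<close> add up to
  a single one. So old and new expansions agree at the ends of blocks.\<close>

lemma sum_block_a_v: "(\<Sum>m\<in>block n. smul (a m f) (v m)) = \<Delta> n f"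
proof -
  have "(\<Sum>m\<in>block n. smul (a m f) (v m))
    = (\<Sum>m\<in>block n. smul (\<beta> m f) (h m) + smul (of_real (qa n) * \<alpha> n f) (h m)
        + smul (\<beta> m f) (smul (of_real (qu n)) (u n)) + smul (of_real (qa n * qu n) * \<alpha> n f) (u n))"
    by (rule sum.cong)
       (simp_all add: a_def v_def mem_block_iff algebra_simps)
  also have "\<dots> = (\<Sum>m\<in>block n. smul (\<beta> m f) (h m)) + smul (of_real (qa n) * \<alpha> n f) (\<Sum>m\<in>block n. h m)
      + smul (\<Sum>m\<in>block n. \<beta> m f) (smul (of_real (qu n)) (u n))
      + (\<Sum>m\<in>block n. smul (of_real (qa n * qu n) * \<alpha> n f) (u n))"
    by (simp only: sum.distrib scale_sum_right scale_sum_left)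
  also have "(\<Sum>m\<in>block n. smul (of_real (qa n * qu n) * \<alpha> n f) (u n)) = smul (\<alpha> n f) (u n)"
    by (simp add: qa_qu card_block sum_constant_scale scale_of_real[symmetric])
  finally show ?thesis by (simp add: sum_h sum_\<beta> \<Delta>_def add.commute)
qed

lemma sum_\<Delta>: "(\<Sum>i<n. \<Delta> i f) = (\<Sum>i<n. smul (\<alpha> i f) (u i)) + (\<Sum>m<2 ^ n - 1. smul (\<beta> m f) (h m))"
  unfolding \<Delta>_def sum_blocks by (rule sum.distrib)

lemma sum_\<Delta>_tendsto: "(\<lambda>n. \<Sum>i<n. \<Delta> i f) \<longlonglongrightarrow> f"
  unfolding sum_\<Delta> by (rule expansion)

lemma a_\<Delta>: "level m = n \<Longrightarrow> a m (\<Delta> n f) = a m f"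
proof -
  assume m: "level m = n"
  have am: "a m (\<Sum>i\<in>F. g i) = (\<Sum>i\<in>F. a m (g i))" for F :: "nat set" and g
    unfolding a_def \<alpha>_sum \<beta>_sum by (simp add: sum.distrib sum_distrib_left)
  have "a m (\<Delta> n f) = (\<Sum>l\<in>block n. if m = l then a l f else 0)"
    unfolding sum_block_a_v[symmetric] am by (rule sum.cong) (auto simp: a_scale a_v)
  also have "\<dots> = a m f" using m by (simp add: mem_block_iff finite_block)
  finally show ?thesis .
qed

lemma sum_lessThan_\<beta>_h_le: "norm (\<Sum>m<l. smul (\<beta> m f) (h m)) \<le> K * (K * norm f)"
proof -
  have "(\<Sum>m<l. norm (\<beta> m f) powr p) powr (1 / p) \<le> K * norm f"
    by (rule powr_inverse_le[OF \<beta>_le]) (use p K in \<open>auto intro: sum_nonneg\<close>)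
  then show ?thesis using h_le[of "{..<l}" "\<lambda>m. \<beta> m f"] K
    by (meson finite_lessThan mult_left_mono order_trans zero_le_one)
qed

lemma sum_\<Delta>_le: "norm (\<Sum>i<n. \<Delta> i f) \<le> 2 * K\<^sup>2 * norm f"
proof -
  have "K * norm f \<le> K * (K * norm f)" using K mult_right_mono[of 1 K "K * norm f"] by simp
  then show ?thesis
    using norm_triangle_le[OF add_mono[OF \<alpha>_partial_le[of f n] sum_lessThan_\<beta>_h_le[of f "2 ^ n - 1"]]]
    unfolding sum_\<Delta> by (simp add: power2_eq_square algebra_simps)
qed

text \<open>The share of \<open>\<alpha> n f\<close> is spread evenly with factor
  \<open>qa n\<close>, so its \<open>\<ell>\<^sub>p\<close> norm is that of the scalar. The power
  inequality and the sum of two equal bounds each cost a factor 2.\<close>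

lemma sum_a_powr_le: "(\<Sum>m\<in>block n. norm (a m f) powr p) powr (1 / p) \<le> 4 * K * norm f"
proof (rule powr_inverse_le)
  have "(\<Sum>m\<in>block n. norm (a m f) powr p)
    \<le> (\<Sum>m\<in>block n. 2 powr p * (norm (\<beta> m f) powr p + (1 / 2 ^ n) * norm (\<alpha> n f) powr p))"
  proof (rule sum_mono)
    fix m assume "m \<in> block n"
    then have "norm (a m f) \<le> norm (\<beta> m f) + qa n * norm (\<alpha> n f)"
      unfolding a_def mem_block_iff by (intro norm_triangle_le) (simp add: norm_qa)
    then have "norm (a m f) powr p \<le> (norm (\<beta> m f) + qa n * norm (\<alpha> n f)) powr p"
      using p by (intro powr_mono2) auto
    also have "\<dots> \<le> 2 powr p * (norm (\<beta> m f) powr p + (qa n * norm (\<alpha> n f)) powr p)"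
      using p qa_pos[of n] by (intro add_powr_le) auto
    also have "(qa n * norm (\<alpha> n f)) powr p = (1 / 2 ^ n) * norm (\<alpha> n f) powr p"
      unfolding powr_mult qa_powr ..
    finally show "norm (a m f) powr p
       \<le> 2 powr p * (norm (\<beta> m f) powr p + (1 / 2 ^ n) * norm (\<alpha> n f) powr p)" .
  qed
  also have "\<dots> = 2 powr p * ((\<Sum>m\<in>block n. norm (\<beta> m f) powr p) + norm (\<alpha> n f) powr p)"
    by (simp add: sum.distrib card_block flip: sum_distrib_left)
  also have "\<dots> \<le> 2 powr p * ((K * norm f) powr p + (K * norm f) powr p)"
    using p by (intro mult_left_mono add_mono \<beta>_le powr_mono2 \<alpha>_le finite_block) auto
  also have "\<dots> = 2 powr p * 2 powr 1 * (K * norm f) powr p" by simp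
  also have "\<dots> \<le> 2 powr p * 2 powr p * (K * norm f) powr p"
    using p by (intro mult_right_mono mult_left_mono powr_mono) auto
  also have "\<dots> = (4 * K * norm f) powr p" by (simp add: mult.assoc flip: powr_mult)
  finally show "(\<Sum>m\<in>block n. norm (a m f) powr p) \<le> (4 * K * norm f) powr p" .
qed (use p K in \<open>auto intro: sum_nonneg\<close>)

text \<open>The \<open>u\<close> part is estimated by the triangle inequality, so the conditionality
  of \<open>u\<close> does no harm here. The weights, of order
  \<open>(m + 1) powr (1 / p - 1)\<close>, are those of the Lorentz space
  \<open>\<ell>\<^sub>p\<^sub>,\<^sub>1\<close>.\<close>

lemma norm_sum_v_le:
  assumes "finite F"
  shows "norm (\<Sum>m\<in>F. smul (c m) (v m)) \<le>
    K * (\<Sum>m\<in>F. norm (c m) powr p) powr (1 / p) + K * (\<Sum>m\<in>F. qu (level m) * norm (c m))"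
proof -
  have "(\<Sum>m\<in>F. smul (c m) (v m))
     = (\<Sum>m\<in>F. smul (c m) (h m)) + (\<Sum>m\<in>F. smul (c m * of_real (qu (level m))) (u (level m)))"
    by (simp add: v_def scale_right_distrib sum.distrib)
  moreover have "norm (\<Sum>m\<in>F. smul (c m * of_real (qu (level m))) (u (level m)))
     \<le> (\<Sum>m\<in>F. K * (qu (level m) * norm (c m)))"
  proof (rule order_trans[OF norm_sum sum_mono])
    fix m
    have "norm (smul (c m * of_real (qu (level m))) (u (level m)))
       = (qu (level m) * norm (c m)) * norm (u (level m))"
      using qu_pos[of "level m"] by (simp add: norm_scale norm_mult)
    also have "\<dots> \<le> (qu (level m) * norm (c m)) * K"
      using qu_pos[of "level m"] u_le by (intro mult_left_mono) auto
    finally show "norm (smul (c m * of_real (qu (level m))) (u (level m)))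
      \<le> K * (qu (level m) * norm (c m))" by (simp only: mult_ac)
  qed
  ultimately show ?thesis
    using norm_triangle_le[OF add_mono[OF h_le[OF assms, of c]]] by (simp add: sum_distrib_left)
qed

text \<open>Within a block the weight is constant and \<open>sum_le_lp\<close> absorbs the weighted
  sum, so \<open>v\<close> is unconditional on each block, uniformly. Having
  \<open>\<Delta> n f\<close> on the right makes incomplete blocks negligible in the limit.\<close>

lemma norm_sum_block_v_le:
  assumes "F \<subseteq> block n"
  shows "norm (\<Sum>m\<in>F. smul (a m f) (v m)) \<le> 12 * K\<^sup>2 * norm (\<Delta> n f)"
proof -
  have F: "finite F" "card F \<le> 2 ^ n"
    using assms finite_subset finite_block card_mono card_block by metis+
  define S where "S = (\<Sum>m\<in>F. norm (a m f) powr p) powr (1 / p)"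
  have "(\<Sum>m\<in>F. qu (level m) * norm (a m f)) = qu n * (\<Sum>m\<in>F. norm (a m f))"
    unfolding sum_distrib_left using assms by (intro sum.cong) (auto simp: mem_block_iff)
  also have "\<dots> \<le> 2 * S"
    unfolding S_def qu_def using F p by (intro sum_le_lp) (auto simp flip: of_nat_le_iff)
  finally have "norm (\<Sum>m\<in>F. smul (a m f) (v m)) \<le> K * S + K * (2 * S)"
    using norm_sum_v_le[OF F(1), of "\<lambda>m. a m f"] K unfolding S_def[symmetric]
    by (smt (verit) mult_left_mono)
  also have "\<dots> = 3 * K * S" by simp
  also have "S \<le> (\<Sum>m\<in>block n. norm (a m (\<Delta> n f)) powr p) powr (1 / p)"
  proof -
    have "(\<Sum>m\<in>F. norm (a m f) powr p) \<le> (\<Sum>m\<in>block n. norm (a m f) powr p)"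
      using assms finite_block by (intro sum_mono2) auto
    also have "\<dots> = (\<Sum>m\<in>block n. norm (a m (\<Delta> n f)) powr p)"
      by (intro sum.cong) (auto simp: mem_block_iff a_\<Delta>)
    finally show ?thesis unfolding S_def using p by (intro powr_mono2) (auto intro: sum_nonneg)
  qed
  also have "\<dots> \<le> 4 * K * norm (\<Delta> n f)" by (rule sum_a_powr_le)
  finally show ?thesis using K by (simp add: power2_eq_square mult_left_mono)
qed

lemma \<Delta>_le: "norm (\<Delta> n f) \<le> 4 * K\<^sup>2 * norm f"
proof -
  have "\<Delta> n f = (\<Sum>i<Suc n. \<Delta> i f) - (\<Sum>i<n. \<Delta> i f)" by simp
  then have "norm (\<Delta> n f) \<le> 2 * K\<^sup>2 * norm f + 2 * K\<^sup>2 * norm f"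
    by (simp only: order_trans[OF norm_triangle_ineq4 add_mono[OF sum_\<Delta>_le sum_\<Delta>_le]])
  then show ?thesis by (simp add: mult_ac)
qed

lemma \<Delta>_tendsto: "(\<lambda>n. \<Delta> n f) \<longlonglongrightarrow> 0"
  using summable_LIMSEQ_zero[of "\<lambda>n. \<Delta> n f"] sum_\<Delta>_tendsto by (auto simp: summable_def sums_def)

lemma sum_lessThan_a_v: "(\<Sum>m<2 ^ n - 1. smul (a m f) (v m)) = (\<Sum>i<n. \<Delta> i f)"
  unfolding sum_blocks sum_block_a_v ..

text \<open>A partial sum consists of whole blocks, where it is a partial sum of the given
  expansion, and of a piece of one block, which is dominated by \<open>\<Delta>\<close> of that
  block.\<close>

lemma a_v_sums: "(\<lambda>m. smul (a m f) (v m)) sums f"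
proof -
  have split: "(\<Sum>m<M. smul (a m f) (v m))
     = (\<Sum>i<level M. \<Delta> i f) + (\<Sum>m\<in>block (level M) \<inter> {..<M}. smul (a m f) (v m))" for M
  proof -
    have "M \<in> block (level M)" by (simp add: mem_block_iff)
    then have *: "{..<M} = {..<2 ^ level M - 1} \<union> (block (level M) \<inter> {..<M})"
      by (auto simp: block_def)
    have "(\<Sum>m<M. smul (a m f) (v m)) = (\<Sum>m<2 ^ level M - 1. smul (a m f) (v m))
       + (\<Sum>m\<in>block (level M) \<inter> {..<M}. smul (a m f) (v m))"
      by (subst *, rule sum.union_disjoint) (auto simp: block_def)
    then show ?thesis unfolding sum_lessThan_a_v .
  qed
  have "(\<lambda>M. \<Sum>m\<in>block (level M) \<inter> {..<M}. smul (a m f) (v m)) \<longlonglongrightarrow> 0"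
  proof (rule Lim_null_comparison)
    show "\<forall>\<^sub>F M in sequentially. norm (\<Sum>m\<in>block (level M) \<inter> {..<M}. smul (a m f) (v m))
       \<le> 12 * K\<^sup>2 * norm (\<Delta> (level M) f)"
      by (intro always_eventually allI norm_sum_block_v_le) auto
    have "(\<lambda>M. 12 * K\<^sup>2 * norm (\<Delta> (level M) f)) \<longlonglongrightarrow> 12 * K\<^sup>2 * norm (0 :: 'a)"
      by (intro tendsto_intros filterlim_compose[OF \<Delta>_tendsto filterlim_level])
    then show "(\<lambda>M. 12 * K\<^sup>2 * norm (\<Delta> (level M) f)) \<longlonglongrightarrow> 0" by simp
  qed
  from tendsto_add[OF filterlim_compose[OF sum_\<Delta>_tendsto filterlim_level] this]
  show ?thesis unfolding sums_def split by simp
qed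

lemma schauder_basis_v: "schauder_basis smul v" and coord_v: "coord smul v m f = a m f"
  using biorthogonal_schauder_basis[of a v, OF bounded_linear_functional[OF a_add a_scale a_le] a_scale a_v a_v_sums]
  by blast+

section \<open>Greedy projections\<close>

lemma a_zero: "a m 0 = 0"
  using a_scale[of m 0 0] by simp

lemma qu_antimono: "n \<ge> k \<Longrightarrow> qu n \<le> qu k"
  unfolding qu_def using p by (intro powr_mono2') (auto intro: power_increasing)

lemma sum_qu_level:
  "(\<Sum>m<2 ^ k - 1. qu (level m)) = ((2 powr (1 / p)) ^ k - 1) / (2 powr (1 / p) - 1)"
proof -
  have "(\<Sum>m\<in>block n. qu (level m)) = (2 powr (1 / p)) ^ n" for n
  proof -
    have "(\<Sum>m\<in>block n. qu (level m)) = (\<Sum>m\<in>block n. qu n)"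
      by (intro sum.cong) (auto simp: mem_block_iff)
    also have "\<dots> = (2 ^ n) powr 1 * (2 ^ n) powr (1 / p - 1)" by (simp add: card_block qu_def)
    also have "\<dots> = (2 ^ n) powr (1 / p)" unfolding powr_add[symmetric] by simp
    also have "\<dots> = (2 powr (1 / p)) ^ n" by (simp add: powr_powr mult.commute flip: powr_realpow)
    finally show ?thesis .
  qed
  moreover have "2 powr (1 / p) \<noteq> 1" using p by (simp add: powr_eq_one_iff_gen)
  ultimately show ?thesis unfolding sum_blocks by (simp add: geometric_sum)
qed

text \<open>In this order: the expansion beyond a critical level (\<open>1 + 2 * K\<^sup>2\<close>),
  the omitted terms below it, the retained terms from it on. The denominator comes from the
  geometric series in \<open>sum_qu_level\<close>.\<close>

definition C_greedy :: real where
  "C_greedy = 1 + 2 * K\<^sup>2 + (4 * K\<^sup>2 + 4 * K\<^sup>2 / (2 powr (1 / p) - 1)) + 4 * K\<^sup>2"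

text \<open>
  Below the level \<open>k\<close> the part outside \<open>A\<close> is small, having coefficients of size at most \<open>t\<close>. From
  level \<open>k\<close> on the averages \<open>\<alpha>\<close> contribute at most \<open>t / 2\<close> to a coefficient, so the part
  inside \<open>A\<close> is controlled by \<open>\<beta>\<close>.
\<close>

lemma greedy_finite:
  assumes "finite A" "t > 0" "f \<noteq> 0"
    and out: "\<And>m. m \<notin> A \<Longrightarrow> norm (a m f) \<le> t" and ins: "\<And>m. m \<in> A \<Longrightarrow> t \<le> norm (a m f)"
  shows "norm (f - (\<Sum>m\<in>A. smul (a m f) (v m))) \<le> C_greedy * norm f"
proof -
  \<comment> \<open>The level \<open>k\<close> with \<open>2 ^ k\<close> of order
    \<open>Z powr p\<close> is the first with \<open>qa k \<le> 1 / Z\<close>, which makes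
    \<open>qa k * (K * norm f)\<close> at most \<open>t / 2\<close>. Minimality bounds
    \<open>2 ^ k\<close> from above, unless \<open>k = 0\<close>, when nothing lies below.\<close>
  define Z where "Z = 2 * K * norm f / t"
  define x where "x = 2 powr (1 / p)"
  have x: "x > 1" using p powr_less_mono[of 0 "1 / p" 2] by (simp add: x_def)
  have Z: "Z > 0" and tZ: "t * Z = 2 * K * norm f" using assms K by (auto simp: Z_def)
  define k where "k = (LEAST n. Z powr p \<le> 2 ^ n)"
  have "\<exists>n. Z powr p \<le> 2 ^ n" using real_arch_pow[of 2 "Z powr p"] by (auto intro: less_imp_le)
  then have k: "Z powr p \<le> 2 ^ k" unfolding k_def by (rule LeastI_ex)
  have k0: "2 ^ k \<le> 2 * Z powr p" if "k > 0"
  proof -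
    have l: "k = Suc (k - 1)" using that by simp
    have "\<not> Z powr p \<le> 2 ^ (k - 1)" by (rule not_less_Least) (use that in \<open>simp add: k_def\<close>)
    then show ?thesis by (subst l) simp
  qed
  define F1 where "F1 = {..<2 ^ k - 1} - A"
  define F3 where "F3 = A - {..<2 ^ k - 1}"
  have fin: "finite F1" "finite F3" using assms by (auto simp: F1_def F3_def)
  define y where "y m = smul (a m f) (v m)" for m
  have "sum y A = sum y (A \<inter> {..<2 ^ k - 1}) + sum y F3"
    unfolding F3_def using assms(1) by (rule sum.Int_Diff)
  moreover have "sum y {..<2 ^ k - 1} = sum y ({..<2 ^ k - 1} \<inter> A) + sum y F1"
    unfolding F1_def by (rule sum.Int_Diff) simp
  ultimately have dec: "f - sum y A = (f - (\<Sum>i<k. \<Delta> i f)) + sum y F1 - sum y F3"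
    unfolding sum_lessThan_a_v[of f, folded y_def, symmetric] by (simp add: Int_commute)
  have E2: "norm (f - (\<Sum>i<k. \<Delta> i f)) \<le> norm f + 2 * K\<^sup>2 * norm f"
    by (rule order_trans[OF norm_triangle_ineq4 add_mono[OF order_refl sum_\<Delta>_le]])
  have E1: "norm (sum y F1) \<le> (4 * K\<^sup>2 + 4 * K\<^sup>2 / (x - 1)) * norm f"
  proof (cases "k = 0")
    case True
    then show ?thesis using x K by (simp add: F1_def)
  next
    case False
    have "(\<Sum>m\<in>F1. norm (a m f) powr p) \<le> (\<Sum>m\<in>F1. t powr p)"
      using p out by (intro sum_mono powr_mono2) (auto simp: F1_def)
    also have "\<dots> = real (card F1) * t powr p" by simp
    also have "\<dots> \<le> 2 ^ k * t powr p"
    proof -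
      have "card F1 \<le> card {..<2 ^ k - (1::nat)}" unfolding F1_def by (intro card_mono) auto
      also have "\<dots> \<le> 2 ^ k" by simp
      finally have "real (card F1) \<le> real (2 ^ k)" by (simp only: of_nat_le_iff)
      then show ?thesis by (intro mult_right_mono) auto
    qed
    also have "\<dots> \<le> (2 * Z powr p) * t powr p" using False k0 by (intro mult_right_mono) auto
    also have "\<dots> = 2 powr 1 * (t * Z) powr p" by (simp add: powr_mult)
    also have "\<dots> \<le> 2 powr p * (t * Z) powr p" using p by (intro mult_right_mono powr_mono) auto
    also have "\<dots> = (4 * K * norm f) powr p" unfolding tZ powr_mult[symmetric] by (simp add: mult_ac)
    finally have 1: "(\<Sum>m\<in>F1. norm (a m f) powr p) powr (1 / p) \<le> 4 * K * norm f"
      using p K by (intro powr_inverse_le) (auto intro: sum_nonneg)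
    \<comment> \<open>The geometric sum of the weights is governed by \<open>x ^ k\<close>, which is
      at most \<open>2 * Z\<close> by the choice of \<open>k\<close>.\<close>
    have "(\<Sum>m\<in>F1. qu (level m) * norm (a m f)) \<le> (\<Sum>m\<in>F1. qu (level m) * t)"
      using out qu_pos by (intro sum_mono mult_left_mono) (auto simp: F1_def less_imp_le)
    also have "\<dots> \<le> (\<Sum>m<2 ^ k - 1. qu (level m) * t)"
      using assms(2) qu_pos by (intro sum_mono2) (auto simp: F1_def less_imp_le)
    also have "\<dots> = t * ((x ^ k - 1) / (x - 1))"
      unfolding sum_distrib_right[symmetric] sum_qu_level x_def by simp
    also have "\<dots> \<le> t * (2 * Z / (x - 1))"
    proof -
      have "x ^ k = (2 ^ k) powr (1 / p)" by (simp add: x_def powr_powr mult.commute flip: powr_realpow)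
      also have "\<dots> \<le> (2 powr 1 * Z powr p) powr (1 / p)"
        using p False k0 by (intro powr_mono2) auto
      also have "\<dots> \<le> (2 powr p * Z powr p) powr (1 / p)"
        using p by (intro powr_mono2 mult_right_mono powr_mono) auto
      also have "\<dots> = 2 * Z" using p Z by (simp add: powr_powr flip: powr_mult)
      finally show ?thesis using x assms(2) by (intro mult_left_mono divide_right_mono) auto
    qed
    also have "\<dots> = 2 * (t * Z) / (x - 1)" by simp
    also have "\<dots> = 4 * K * norm f / (x - 1)" unfolding tZ by simp
    finally have 2: "(\<Sum>m\<in>F1. qu (level m) * norm (a m f)) \<le> 4 * K * norm f / (x - 1)" .
    have "norm (sum y F1) \<le> K * (4 * K * norm f) + K * (4 * K * norm f / (x - 1))"
      unfolding y_def using K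
      by (intro order_trans[OF norm_sum_v_le[OF fin(1)]] add_mono mult_left_mono 1 2) auto
    then show ?thesis by (simp add: power2_eq_square algebra_simps)
  qed
  have E3: "norm (sum y F3) \<le> 4 * K\<^sup>2 * norm f"
  proof -
    have big: "norm (a m f) \<le> 2 * norm (\<beta> m f)" if "m \<in> F3" for m
    proof -
      have "\<not> level m < k" using that by (simp add: F3_def level_less_iff)
      then have "(2::real) ^ k \<le> 2 ^ level m" by (intro power_increasing) auto
      then have "Z powr p \<le> 2 ^ level m" using k by (rule order_trans[rotated])
      then have "qa (level m) \<le> (Z powr p) powr (- 1 / p)"
        unfolding qa_def using p Z by (intro powr_mono2') auto
      also have "\<dots> = 1 / Z" using p Z by (simp add: powr_powr powr_minus divide_simps)
      finally have "qa (level m) * norm (\<alpha> (level m) f) \<le> 1 / Z * (K * norm f)"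
        using \<alpha>_le Z by (intro mult_mono) auto
      also have "\<dots> = t / 2" using Z assms K by (simp add: Z_def)
      finally have "norm (a m f) \<le> norm (\<beta> m f) + t / 2"
        unfolding a_def by (intro norm_triangle_le) (simp add: norm_qa)
      then show ?thesis using ins[of m] that by (auto simp: F3_def)
    qed
    have "(\<Sum>m\<in>F3. norm (a m f) powr p) \<le> (\<Sum>m\<in>F3. 2 powr p * norm (\<beta> m f) powr p)"
      using p big unfolding powr_mult[symmetric] by (intro sum_mono powr_mono2) auto
    also have "\<dots> \<le> 2 powr p * (K * norm f) powr p"
      unfolding sum_distrib_left[symmetric] by (intro mult_left_mono \<beta>_le fin) auto
    also have "\<dots> = (2 * K * norm f) powr p" by (simp add: mult.assoc flip: powr_mult)
    finally have S: "(\<Sum>m\<in>F3. norm (a m f) powr p) \<le> (2 * K * norm f) powr p" .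
    then have 1: "(\<Sum>m\<in>F3. norm (a m f) powr p) powr (1 / p) \<le> 2 * K * norm f"
      using p K by (intro powr_inverse_le) (auto intro: sum_nonneg)
    \<comment> \<open>Coefficients of size at least \<open>t\<close> satisfy
      \<open>norm (a m f) \<le> t powr (1 - p) * norm (a m f) powr p\<close>, which reduces the
      weighted sum to the \<open>\<ell>\<^sub>p\<close> sum already bounded; the remaining powers of
      \<open>t\<close> and \<open>Z\<close> combine to \<open>t * Z\<close>.\<close>
    have "(\<Sum>m\<in>F3. qu (level m) * norm (a m f))
      \<le> (\<Sum>m\<in>F3. qu k * (t powr (1 - p) * norm (a m f) powr p))"
    proof (intro sum_mono mult_mono)
      fix m assume m: "m \<in> F3"
      then show "qu (level m) \<le> qu k"
        by (intro qu_antimono) (use level_less_iff[of m k] in \<open>simp add: F3_def\<close>)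
      have "norm (a m f) = norm (a m f) powr (1 - p) * norm (a m f) powr p"
        using ins[of m] m assms(2) by (simp add: F3_def flip: powr_add)
      also have "\<dots> \<le> t powr (1 - p) * norm (a m f) powr p"
        using ins[of m] m assms(2) p by (intro mult_right_mono powr_mono2') (auto simp: F3_def)
      finally show "norm (a m f) \<le> t powr (1 - p) * norm (a m f) powr p" .
    qed (auto simp: qu_pos less_imp_le)
    also have "\<dots> = qu k * (t powr (1 - p) * (\<Sum>m\<in>F3. norm (a m f) powr p))"
      by (simp only: sum_distrib_left)
    also have "\<dots> \<le> Z powr (1 - p) * (t powr (1 - p) * (t * Z) powr p)"
    proof (intro mult_mono mult_left_mono)
      have "qu k \<le> (Z powr p) powr (1 / p - 1)"
        unfolding qu_def using p Z k by (intro powr_mono2') auto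
      also have "p * (1 / p - 1) = 1 - p" using p by (simp add: right_diff_distrib)
      then have "(Z powr p) powr (1 / p - 1) = Z powr (1 - p)" by (simp only: powr_powr)
      finally show "qu k \<le> Z powr (1 - p)" .
      show "(\<Sum>m\<in>F3. norm (a m f) powr p) \<le> (t * Z) powr p" using S unfolding tZ .
    qed (auto intro!: sum_nonneg mult_nonneg_nonneg)
    also have "\<dots> = (t * Z) powr (1 - p) * (t * Z) powr p" by (simp add: powr_mult)
    also have "\<dots> = 2 * K * norm f" unfolding powr_add[symmetric] using tZ K by simp
    finally have 2: "(\<Sum>m\<in>F3. qu (level m) * norm (a m f)) \<le> 2 * K * norm f" .
    have "norm (sum y F3) \<le> K * (2 * K * norm f) + K * (2 * K * norm f)"
      unfolding y_def using K
      by (intro order_trans[OF norm_sum_v_le[OF fin(2)]] add_mono mult_left_mono 1 2) auto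
    then show ?thesis by (simp add: power2_eq_square algebra_simps)
  qed
  have "norm (f - sum y A) \<le> (norm f + 2 * K\<^sup>2 * norm f)
     + (4 * K\<^sup>2 + 4 * K\<^sup>2 / (x - 1)) * norm f + 4 * K\<^sup>2 * norm f"
    unfolding dec
    by (rule order_trans[OF norm_triangle_ineq4 add_mono[OF order_trans[OF norm_triangle_ineq add_mono[OF E2 E1]] E3]])
  also have "\<dots> = C_greedy * norm f" unfolding C_greedy_def x_def by (simp only: distrib_right mult_1 add_ac)
  finally show ?thesis unfolding y_def .
qed

lemma a_tendsto: "(\<lambda>m. a m f) \<longlonglongrightarrow> 0"
proof (rule Lim_null_comparison)
  show "\<forall>\<^sub>F m in sequentially. norm (a m f) \<le> 2 * K * norm (smul (a m f) (v m))"
  proof (intro always_eventually allI)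
    show "norm (a m f) \<le> 2 * K * norm (smul (a m f) (v m))" for m
      using a_le[of m "smul (a m f) (v m)"] by (simp add: a_scale a_v)
  qed
  have "(\<lambda>m. 2 * K * norm (smul (a m f) (v m))) \<longlonglongrightarrow> 2 * K * norm (0 :: 'a)"
    using sums_summable[OF a_v_sums] by (intro tendsto_intros summable_LIMSEQ_zero)
  then show "(\<lambda>m. 2 * K * norm (smul (a m f) (v m))) \<longlonglongrightarrow> 0" by simp
qed

lemma norm_v_ge: "1 / (2 * K) \<le> norm (v m)"
  using a_le[of m "v m"] K by (simp add: a_v field_simps)

lemma norm_v_le: "norm (v m) \<le> 2 * K"
proof -
  have "norm (v m) \<le> K + K * qu (level m)" using norm_sum_v_le[of "{m}" "\<lambda>_. 1"] by simp
  moreover have "K * qu (level m) \<le> K * 1" using qu_le_1 K by (intro mult_left_mono) auto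
  ultimately show ?thesis by simp
qed

lemma quasi_greedy_v: "quasi_greedy smul v"
  unfolding quasi_greedy_def
proof (intro conjI)
  show "schauder_basis smul v" by (rule schauder_basis_v)
  have "1 / (2 * K) \<le> (INF j. norm (v j))" by (rule cINF_greatest) (use norm_v_ge in auto)
  moreover have "1 / (2 * K) > 0" using K by simp
  ultimately show "0 < (INF j. norm (v j))" by linarith
  show "bdd_above (range (\<lambda>j. norm (v j)))" using norm_v_le by (auto simp: bdd_above_def)
  have "norm (f - coord_proj smul v A f) \<le> C_greedy * norm f"
    if A: "\<forall>j\<in>-A. \<forall>k\<in>A. norm (a j f) \<le> norm (a k f)" for f A
  proof -
    have C: "C_greedy \<ge> 1"
      using powr_mono[of 0 "1 / p" 2] p by (simp add: C_greedy_def)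
    \<comment> \<open>An infinite \<open>A\<close> falls under the first case: a nonzero coefficient
      outside a nonempty \<open>A\<close> bounds those inside from below, and coefficients tend to
      0.\<close>
    consider "\<forall>j\<in>-A. a j f = 0" | j where "j \<notin> A" "a j f \<noteq> 0" "A \<noteq> {}" | "A = {}" by auto
    then show ?thesis
    proof cases
      case 1
      then have "(\<lambda>n. if n \<in> A then smul (coord smul v n f) (v n) else 0) = (\<lambda>n. smul (a n f) (v n))"
        by (auto simp: coord_v)
      then have "coord_proj smul v A f = f" unfolding coord_proj_def using a_v_sums by (simp add: sums_iff)
      then show ?thesis using C by simp
    next
      case 2
      have "\<forall>\<^sub>F m in sequentially. norm (a m f) < norm (a j f)"
        using order_tendstoD(2)[OF tendsto_norm_zero[OF a_tendsto[of f]]] 2 by simp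
      then obtain M where M: "\<And>m. m \<ge> M \<Longrightarrow> norm (a m f) < norm (a j f)"
        by (auto simp: eventually_sequentially)
      have "m < M" if "m \<in> A" for m
      proof (rule ccontr)
        assume "\<not> m < M"
        then have "norm (a m f) < norm (a j f)" by (intro M) simp
        moreover have "norm (a j f) \<le> norm (a m f)" using A 2 that by auto
        ultimately show False by simp
      qed
      then have fin: "finite A" by (intro finite_subset[of A "{..<M}"]) auto
      define t where "t = Min ((\<lambda>m. norm (a m f)) ` A)"
      have "t \<in> (\<lambda>m. norm (a m f)) ` A" unfolding t_def using fin 2 by (intro Min_in) auto
      then obtain l where l: "l \<in> A" "t = norm (a l f)" by auto
      have "norm (f - (\<Sum>m\<in>A. smul (a m f) (v m))) \<le> C_greedy * norm f"
      proof (rule greedy_finite[OF fin, of t])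
        have "norm (a j f) \<le> t" using A 2 l by auto
        then show "t > 0" using 2 by (metis less_le_trans zero_less_norm_iff)
        show "f \<noteq> 0" using 2 a_zero by auto
        show "norm (a m f) \<le> t" if "m \<notin> A" for m using A that l by auto
        show "t \<le> norm (a m f)" if "m \<in> A" for m unfolding t_def using fin that by auto
      qed
      then show ?thesis by (simp add: coord_proj_finite[OF fin] coord_v)
    next
      case 3
      then show ?thesis using mult_right_mono[OF C norm_ge_zero[of f]] by (simp add: coord_proj_def)
    qed
  qed
  then show "\<exists>C. \<forall>f A. (\<forall>j\<in>- A. \<forall>k\<in>A. norm (coord smul v j f) \<le> norm (coord smul v k f)) \<longrightarrow>
      norm (f - coord_proj smul v A f) \<le> C * norm f"
    unfolding coord_v by blast
qed

section \<open>Logarithmic growth of the conditionality constants\<close>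

lemma coord_proj_le:
  assumes "supp smul v f \<subseteq> {..<m}" "m \<ge> 2"
  shows "norm (coord_proj smul v A f) \<le> 48 * K ^ 4 * (3 / ln 2 * ln (real m)) * norm f"
proof -
  define n where "n = Suc (level m)"
  define y where "y l = (if l \<in> A then smul (a l f) (v l) else 0)" for l
  have "a l f = 0" if "\<not> level l < n" for l
  proof -
    have "m < 2 ^ n - 1" unfolding n_def level_less_iff[symmetric] by simp
    then have "l \<notin> {..<m}" using that by (simp add: level_less_iff)
    then show ?thesis using assms(1) by (auto simp: supp_def coord_v)
  qed
  then have "coord_proj smul v A f = (\<Sum>l<2 ^ n - 1. y l)"
    unfolding coord_proj_def coord_v y_def[symmetric]
    by (intro suminf_finite) (auto simp: y_def level_less_iff)
  also have "\<dots> = (\<Sum>i<n. \<Sum>l\<in>block i \<inter> A. smul (a l f) (v l))"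
    unfolding sum_blocks y_def by (simp add: sum.inter_restrict finite_block)
  also have "norm \<dots> \<le> (\<Sum>i<n. 48 * K ^ 4 * norm f)"
  proof (rule order_trans[OF norm_sum sum_mono])
    fix i
    have "norm (\<Sum>l\<in>block i \<inter> A. smul (a l f) (v l)) \<le> 12 * K\<^sup>2 * norm (\<Delta> i f)"
      by (rule norm_sum_block_v_le) simp
    also have "\<dots> \<le> 12 * K\<^sup>2 * (4 * K\<^sup>2 * norm f)" by (intro mult_left_mono \<Delta>_le) auto
    finally show "norm (\<Sum>l\<in>block i \<inter> A. smul (a l f) (v l)) \<le> 48 * K ^ 4 * norm f"
      by (simp add: power2_eq_square power4_eq_xxxx mult_ac)
  qed
  also have "\<dots> = 48 * K ^ 4 * real n * norm f" by simp
  also have "\<dots> \<le> 48 * K ^ 4 * (3 / ln 2 * ln (real m)) * norm f"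
    unfolding n_def by (intro mult_right_mono mult_left_mono level_bound[OF assms(2)]) auto
  finally show ?thesis .
qed

text \<open>The upper estimate supplies the boundedness without which \<open>Sup\<close> would carry
  no information.\<close>

lemma w_cond_const_ge:
  assumes "m \<ge> 2" "f \<noteq> 0" "supp smul v f \<subseteq> {..<m}"
  shows "norm (coord_proj smul v A f) / norm f \<le> w_cond_const smul v m"
  unfolding w_cond_const_def
proof (rule cSup_upper)
  show "bdd_above {norm (coord_proj smul v A f) / norm f |f A. f \<noteq> 0 \<and> supp smul v f \<subseteq> {..<m}}"
    using coord_proj_le[OF _ assms(1)]
    by (intro bdd_aboveI[of _ "48 * K ^ 4 * (3 / ln 2 * ln (real m))"]) (auto simp: pos_divide_le_eq)
qed (use assms in blast)

lemma v_nonzero: "v m \<noteq> 0"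
  using a_v[of m m] a_zero[of m] by auto

lemma one_le_w_cond_const:
  assumes "m \<ge> 2"
  shows "1 \<le> w_cond_const smul v m"
proof -
  have "coord_proj smul v UNIV (v 0) = v 0"
    unfolding coord_proj_def coord_v using a_v_sums[of "v 0"] by (simp add: sums_iff)
  moreover have "supp smul v (v 0) \<subseteq> {..<m}"
    using assms by (auto simp: supp_def coord_v a_v split: if_splits)
  ultimately show ?thesis using w_cond_const_ge[OF assms v_nonzero[of 0], of UNIV] v_nonzero by simp
qed

lemma w_cond_const_le:
  assumes "m \<ge> 2"
  shows "w_cond_const smul v m \<le> 48 * K ^ 4 * (3 / ln 2) * ln (real m)"
  unfolding w_cond_const_def
proof (rule cSup_least)
  have "supp smul v (v 0) \<subseteq> {..<m}"
    using assms by (auto simp: supp_def coord_v a_v split: if_splits)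
  then show "{norm (coord_proj smul v A f) / norm f |f A. f \<noteq> 0 \<and> supp smul v f \<subseteq> {..<m}} \<noteq> {}"
    using v_nonzero by blast
qed (use coord_proj_le[OF _ assms] in \<open>auto simp: pos_divide_le_eq mult_ac\<close>)

text \<open>An unconditionality defect of \<open>u\<close> at \<open>M\<close> lifts to one of \<open>v\<close> at \<open>2 ^ M\<close>, by filling whole blocks.\<close>

lemma w_cond_const_lift:
  assumes "f \<noteq> 0" "f = (\<Sum>i<M. smul (b i) (u i))" "2 ^ M \<le> m" "M > 0"
  shows "norm (\<Sum>i\<in>{..<M} \<inter> D. smul (b i) (u i)) / norm f \<le> w_cond_const smul v m"
proof -
  have \<alpha>f: "\<alpha> n f = (if n < M then b n else 0)" for n
  proof -
    have "\<alpha> n f = (\<Sum>i<M. if i = n then b i else 0)"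
      unfolding assms(2) \<alpha>_sum by (rule sum.cong) (auto simp: \<alpha>_scale \<alpha>_u)
    then show ?thesis by (simp add: sum.delta)
  qed
  have \<beta>f: "\<beta> n f = 0" for n unfolding assms(2) \<beta>_sum by (simp add: \<beta>_scale \<beta>_u)
  have a0: "a l f = 0" if "\<not> level l < M" for l using that by (simp add: a_def \<alpha>f \<beta>f)
  have supp: "supp smul v f \<subseteq> {..<m}"
  proof
    fix l assume "l \<in> supp smul v f"
    then have "l < 2 ^ M - 1" using a0[of l] by (auto simp: supp_def coord_v level_less_iff)
    then show "l \<in> {..<m}" using assms(3) by simp
  qed
  define A where "A = {l. level l \<in> D}"
  define y where "y l = (if l \<in> A then smul (a l f) (v l) else 0)" for l
  have "coord_proj smul v A f = (\<Sum>l<2 ^ M - 1. y l)"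
    unfolding coord_proj_def coord_v y_def[symmetric]
    using a0 by (intro suminf_finite) (auto simp: y_def level_less_iff)
  also have "\<dots> = (\<Sum>i<M. if i \<in> D then smul (b i) (u i) else 0)"
    unfolding sum_blocks
  proof (rule sum.cong[OF refl])
    fix i assume "i \<in> {..<M}"
    have "(\<Sum>l\<in>block i. y l) = (\<Sum>l\<in>block i. if i \<in> D then smul (a l f) (v l) else 0)"
      by (rule sum.cong) (auto simp: y_def A_def mem_block_iff)
    also have "\<dots> = (if i \<in> D then \<Delta> i f else 0)" by (simp add: sum_block_a_v)
    also have "\<Delta> i f = smul (b i) (u i)" using \<open>i \<in> {..<M}\<close> by (simp add: \<Delta>_def \<alpha>f \<beta>f)
    finally show "(\<Sum>l\<in>block i. y l) = (if i \<in> D then smul (b i) (u i) else 0)" .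
  qed
  also have "\<dots> = (\<Sum>i\<in>{..<M} \<inter> D. smul (b i) (u i))" by (simp add: sum.inter_restrict)
  finally have *: "coord_proj smul v A f = (\<Sum>i\<in>{..<M} \<inter> D. smul (b i) (u i))" .
  have "(2::nat) ^ 1 \<le> 2 ^ M" using assms(4) by (intro power_increasing) auto
  then have "m \<ge> 2" using assms(3) by simp
  from w_cond_const_ge[OF this assms(1) supp, of A] show ?thesis unfolding * .
qed

text \<open>The defects are given at lengths \<open>4 * 2 ^ k\<close> only. If
  \<open>2 ^ (4 * 2 ^ l) \<le> m < 2 ^ (4 * 2 ^ Suc l)\<close>, then \<open>ln (real m)\<close> is
  known up to a factor 2, and the defect at \<open>l\<close> has the right size. Below
  \<open>2 ^ 4\<close> no length fits, and the trivial lower bound 1 suffices.\<close>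

lemma w_cond_const_approx:
  assumes c: "c > 0"
    and cond: "\<And>k. \<exists>b D. (\<Sum>i<4 * 2 ^ k. smul (b i) (u i)) \<noteq> 0 \<and>
      c * 2 ^ k * norm (\<Sum>i<4 * 2 ^ k. smul (b i) (u i)) \<le> norm (\<Sum>i\<in>{..<4 * 2 ^ k} \<inter> D. smul (b i) (u i))"
  shows "approx_on {2..} (w_cond_const smul v) (\<lambda>m. ln (real m))"
  unfolding approx_on_def lesssim_on_def
proof (intro conjI exI ballI)
  show "w_cond_const smul v m \<le> 48 * K ^ 4 * (3 / ln 2) * ln (real m)" if "m \<in> {2..}" for m
    using that w_cond_const_le by simp
next
  fix m :: nat assume "m \<in> {2..}"
  then have m: "m \<ge> 2" by simp
  define C where "C = 4 * ln 2 + 8 * ln 2 / c"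
  have ln_le: "ln (real m) \<le> real n * ln 2" if "m < 2 ^ n" for n
  proof -
    have "real m \<le> real (2 ^ n)" using that by (simp only: of_nat_le_iff)
    then have "ln (real m) \<le> ln (2 ^ n)" using m by (intro ln_mono) auto
    then show ?thesis by (simp add: ln_realpow)
  qed
  have w1: "1 \<le> w_cond_const smul v m" by (rule one_le_w_cond_const[OF m])
  show "ln (real m) \<le> C * w_cond_const smul v m"
  proof (cases "m < 2 ^ 4")
    case True
    have "ln (real m) \<le> 4 * ln 2 * 1" using ln_le[OF True] by simp
    also have "\<dots> \<le> C * w_cond_const smul v m" unfolding C_def using c w1 by (intro mult_mono) auto
    finally show ?thesis .
  next
    case False
    define k where "k = (LEAST k. m < 2 ^ (4 * 2 ^ k))"
    have "m < 2 ^ (4 * 2 ^ m)"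
    proof -
      have "m < 2 ^ m" by (rule less_exp)
      also have "\<dots> \<le> 2 ^ (4 * 2 ^ m)"
      proof (intro power_increasing)
        show "m \<le> 4 * 2 ^ m" using less_exp[of m] by linarith
      qed simp
      finally show ?thesis .
    qed
    then have k: "m < 2 ^ (4 * 2 ^ k)" unfolding k_def by (rule LeastI)
    then obtain l where l: "k = Suc l" using False by (cases k) auto
    have "\<not> m < 2 ^ (4 * 2 ^ l)" by (rule not_less_Least) (use l in \<open>simp add: k_def\<close>)
    then have lm: "2 ^ (4 * 2 ^ l) \<le> m" by simp
    obtain b D where bD: "(\<Sum>i<4 * 2 ^ l. smul (b i) (u i)) \<noteq> 0"
      "c * 2 ^ l * norm (\<Sum>i<4 * 2 ^ l. smul (b i) (u i))
        \<le> norm (\<Sum>i\<in>{..<4 * 2 ^ l} \<inter> D. smul (b i) (u i))" using cond by blast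
    have "c * 2 ^ l \<le> norm (\<Sum>i\<in>{..<4 * 2 ^ l} \<inter> D. smul (b i) (u i)) / norm (\<Sum>i<4 * 2 ^ l. smul (b i) (u i))"
      using bD by (simp add: pos_le_divide_eq)
    also have "\<dots> \<le> w_cond_const smul v m" by (rule w_cond_const_lift[OF bD(1) refl lm]) simp
    finally have "c * 2 ^ l \<le> w_cond_const smul v m" .
    then have "2 ^ l \<le> w_cond_const smul v m / c" using c by (simp add: pos_le_divide_eq mult.commute)
    then have "8 * ln 2 * 2 ^ l \<le> 8 * ln 2 * (w_cond_const smul v m / c)" by (intro mult_left_mono) auto
    moreover have "ln (real m) \<le> 8 * ln 2 * 2 ^ l" using ln_le[OF k] by (simp add: l mult_ac)
    moreover have "8 * ln 2 * (w_cond_const smul v m / c) \<le> C * w_cond_const smul v m"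
    proof -
      have "8 * ln 2 * (w_cond_const smul v m / c) = (8 * ln 2 / c) * w_cond_const smul v m" by simp
      also have "\<dots> \<le> C * w_cond_const smul v m"
        unfolding C_def using w1 by (intro mult_right_mono) auto
      finally show ?thesis .
    qed
    ultimately show ?thesis by linarith
  qed
qed

end

subsection \<open>The spaces \<open>B\<^sub>1\<^sub>,\<^sub>p\<close> and \<open>B\<^sub>\<infinity>\<^sub>,\<^sub>p\<close>\<close>

lemma l_norm_infinity: "l_norm \<infinity> (Suc n) w = Max ((\<lambda>i. norm (w i)) ` {..<Suc n})"
  by (simp add: l_norm_def)

lemma l_norm_1: "l_norm 1 n w = (\<Sum>i<n. norm (w i))"
  by (simp add: l_norm_def sum_nonneg one_ereal_def)

lemma l_norm_nonneg: "r = 1 \<or> r = \<infinity> \<Longrightarrow> l_norm r (Suc n) w \<ge> 0"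
  by (auto simp: l_norm_infinity l_norm_1 sum_nonneg Max_ge_iff lessThan_Suc)

text \<open>Both norms are monotone and invariant under relocation of coordinates. This one
  statement treats the two cases alike when coordinates are moved between blocks of different
  dimension.\<close>

lemma l_norm_embed:
  assumes "r = 1 \<or> r = \<infinity>"
    and "\<And>i. i \<le> m \<Longrightarrow> w i \<noteq> 0 \<Longrightarrow> \<iota> i \<le> n \<and> norm (w i) \<le> norm (w' (\<iota> i))"
    and "inj_on \<iota> {i. i \<le> m \<and> w i \<noteq> 0}"
  shows "l_norm r (Suc m) w \<le> l_norm r (Suc n) w'"
proof (cases "r = 1")
  case True
  let ?S = "{i. i \<le> m \<and> w i \<noteq> 0}"
  have "(\<Sum>i<Suc m. norm (w i)) = (\<Sum>i\<in>?S. norm (w i))"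
    by (rule sum.mono_neutral_right) auto
  also have "\<dots> \<le> (\<Sum>i\<in>?S. norm (w' (\<iota> i)))" using assms(2) by (intro sum_mono) auto
  also have "\<dots> = (\<Sum>i\<in>\<iota> ` ?S. norm (w' i))" using assms(3) by (simp add: sum.reindex)
  also have "\<dots> \<le> (\<Sum>i<Suc n. norm (w' i))" using assms(2) by (intro sum_mono2) (auto simp: less_Suc_eq_le)
  finally show ?thesis by (simp add: True l_norm_1)
next
  case False
  then have r: "r = \<infinity>" using assms(1) by simp
  have "norm (w i) \<le> Max ((\<lambda>i. norm (w' i)) ` {..<Suc n})" if "i \<le> m" for i
  proof (cases "w i = 0")
    case True
    then show ?thesis using l_norm_nonneg[OF assms(1), of n w'] by (simp add: r l_norm_infinity)
  next
    case False
    then have "norm (w i) \<le> norm (w' (\<iota> i))" "\<iota> i < Suc n" using assms(2)[OF that] by auto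
    moreover have "norm (w' (\<iota> i)) \<le> Max ((\<lambda>i. norm (w' i)) ` {..<Suc n})"
      using \<open>\<iota> i < Suc n\<close> by (intro Max_ge) auto
    ultimately show ?thesis by linarith
  qed
  then show ?thesis unfolding r l_norm_infinity by (intro Max.boundedI) (auto simp: less_Suc_eq_le)
qed

lemma l_norm_mono:
  assumes "r = 1 \<or> r = \<infinity>" "\<And>i. i \<le> n \<Longrightarrow> norm (w i) \<le> norm (w' i)"
  shows "l_norm r (Suc n) w \<le> l_norm r (Suc n) w'"
  by (rule l_norm_embed[where \<iota> = "\<lambda>i. i"]) (use assms in auto)

lemma l_norm_triangle:
  assumes "r = 1 \<or> r = \<infinity>"
  shows "l_norm r (Suc n) (\<lambda>i. u i + w i) \<le> l_norm r (Suc n) u + l_norm r (Suc n) w"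
proof (cases "r = 1")
  case True
  then show ?thesis unfolding True l_norm_1 sum.distrib[symmetric] by (intro sum_mono norm_triangle_ineq)
next
  case False
  then have r: "r = \<infinity>" using assms(1) by simp
  have "norm (u i + w i) \<le> l_norm r (Suc n) u + l_norm r (Suc n) w" if "i < Suc n" for i
    unfolding r l_norm_infinity using that
    by (intro norm_triangle_le add_mono Max_ge) auto
  then show ?thesis unfolding r l_norm_infinity by (intro Max.boundedI) auto
qed

lemma l_norm_diff:
  assumes "r = 1 \<or> r = \<infinity>"
  shows "l_norm r (Suc n) (\<lambda>i. u i - w i) \<le> l_norm r (Suc n) u + l_norm r (Suc n) w"
  using l_norm_triangle[OF assms, of n u "\<lambda>i. - w i"] l_norm_mono[OF assms, of n "\<lambda>i. - w i" w] by simp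

lemma l_norm_scale:
  assumes "r = 1 \<or> r = \<infinity>"
  shows "l_norm r (Suc n) (\<lambda>i. c * w i :: 'k::real_normed_field) \<le> norm c * l_norm r (Suc n) w"
proof (cases "r = 1")
  case True
  then show ?thesis unfolding True l_norm_1 norm_mult sum_distrib_left by simp
next
  case False
  then have r: "r = \<infinity>" using assms(1) by simp
  have "norm (c * w i) \<le> norm c * l_norm r (Suc n) w" if "i < Suc n" for i
    unfolding r l_norm_infinity norm_mult using that by (intro mult_left_mono Max_ge) auto
  then show ?thesis unfolding r l_norm_infinity by (intro Max.boundedI) auto
qed

lemma norm_le_l_norm:
  assumes "r = 1 \<or> r = \<infinity>" "i \<le> n"
  shows "norm (w i) \<le> l_norm r (Suc n) w"
proof (cases "r = 1")
  case True
  then show ?thesis using assms(2) member_le_sum[of i "{..<Suc n}" "\<lambda>i. norm (w i)"]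
    by (simp add: l_norm_1)
next
  case False
  then show ?thesis using assms by (auto simp: l_norm_infinity intro!: Max_ge)
qed

lemma l_norm_single:
  assumes "r = 1 \<or> r = \<infinity>" "\<And>i. i \<noteq> 0 \<Longrightarrow> w i = 0"
  shows "l_norm r (Suc n) w = norm (w 0)"
proof (rule antisym)
  show "norm (w 0) \<le> l_norm r (Suc n) w" by (rule norm_le_l_norm) (use assms in auto)
  have "l_norm r (Suc n) w \<le> l_norm r (Suc 0) w"
    by (rule l_norm_embed[where \<iota> = "\<lambda>i. i"]) (use assms in \<open>auto intro: ccontr\<close>)
  also have "\<dots> = norm (w 0)" using assms(1) by (auto simp: l_norm_1 l_norm_infinity lessThan_Suc)
  finally show "l_norm r (Suc n) w \<le> norm (w 0)" .
qed

locale B_space_setup =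
  fixes r :: ereal and p :: real and type :: "'k::real_normed_field itself"
  assumes r: "r = 1 \<or> r = \<infinity>" and p: "1 < p"
begin

abbreviation B :: "(nat \<Rightarrow> nat \<Rightarrow> 'k) set" where "B \<equiv> B_space r p"
abbreviation N :: "(nat \<Rightarrow> nat \<Rightarrow> 'k) \<Rightarrow> real" where "N \<equiv> B_norm r p"
abbreviation \<nu> :: "nat \<Rightarrow> (nat \<Rightarrow> 'k) \<Rightarrow> real" where "\<nu> n \<equiv> l_norm r (Suc n)"

lemma N_nonneg: "N v \<ge> 0"
  by (simp add: B_norm_def lp_sum_norm_def)

lemma B_zero_above: "v \<in> B \<Longrightarrow> n < i \<Longrightarrow> v n i = 0"
  by (auto simp: B_space_def lp_sum_def fin_seqs_def)

lemma sum_le_N: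
  assumes "v \<in> B" "finite F"
  shows "(\<Sum>n\<in>F. \<nu> n (v n) powr p) \<le> N v powr p"
proof -
  have s: "summable (\<lambda>n. \<nu> n (v n) powr p)" using assms by (simp add: B_space_def lp_sum_def)
  have "(\<Sum>n\<in>F. \<nu> n (v n) powr p) \<le> (\<Sum>n. \<nu> n (v n) powr p)"
    using s assms by (intro sum_le_suminf) auto
  also have "\<dots> = N v powr p"
    unfolding B_norm_def lp_sum_norm_def using p s by (simp add: powr_powr suminf_nonneg)
  finally show ?thesis .
qed

text \<open>Membership and norm bound are both read off finite sums, so that later estimates can
  ignore summability.\<close>

lemma B_I:
  assumes "\<And>n i. n < i \<Longrightarrow> v n i = 0" "s \<ge> 0"
    and "\<And>F. finite F \<Longrightarrow> (\<Sum>n\<in>F. \<nu> n (v n) powr p) \<le> s powr p"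
  shows "v \<in> B" and "N v \<le> s"
proof -
  have s: "summable (\<lambda>n. \<nu> n (v n) powr p)"
    by (rule bounded_imp_summable[where B = "s powr p"]) (use assms(3)[of "{.._}"] in auto)
  then show "v \<in> B" using assms(1) by (auto simp: B_space_def lp_sum_def fin_seqs_def)
  have "(\<Sum>n. \<nu> n (v n) powr p) \<le> s powr p"
    using assms(3) by (intro suminf_le_const[OF s]) auto
  then show "N v \<le> s" unfolding B_norm_def lp_sum_norm_def
    using p assms(2) s by (intro powr_inverse_le) (auto intro: suminf_nonneg)
qed

text \<open>The reindexing \<open>\<tau>\<close> allows blocks to be permuted or embedded into
  larger ones, as the self-similarity of \<open>B\<close> requires.\<close>

lemma B_dominated:
  assumes v: "v \<in> B" and C: "C \<ge> 0" and z: "\<And>n i. n < i \<Longrightarrow> w n i = 0"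
    and inj: "inj_on \<tau> {n. w n \<noteq> (\<lambda>_. 0)}"
    and le: "\<And>n. w n \<noteq> (\<lambda>_. 0) \<Longrightarrow> \<nu> n (w n) \<le> C * \<nu> (\<tau> n) (v (\<tau> n))"
  shows "w \<in> B" and "N w \<le> C * N v"
proof -
  have "(\<Sum>n\<in>F. \<nu> n (w n) powr p) \<le> (C * N v) powr p" if F: "finite F" for F
  proof -
    let ?S = "{n \<in> F. w n \<noteq> (\<lambda>_. 0)}"
    have z: "\<nu> n (\<lambda>_. 0) = 0" for n using l_norm_single[OF r, of "\<lambda>_. 0 :: 'k" n] by simp
    have "(\<Sum>n\<in>F. \<nu> n (w n) powr p) = (\<Sum>n\<in>?S. \<nu> n (w n) powr p)"
      by (rule sum.mono_neutral_right) (use F z p in auto)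
    also have "\<dots> \<le> (\<Sum>n\<in>?S. (C * \<nu> (\<tau> n) (v (\<tau> n))) powr p)"
      using le p l_norm_nonneg[OF r] by (intro sum_mono powr_mono2) auto
    also have "\<dots> = C powr p * (\<Sum>n\<in>?S. \<nu> (\<tau> n) (v (\<tau> n)) powr p)"
      by (simp add: powr_mult sum_distrib_left)
    also have "(\<Sum>n\<in>?S. \<nu> (\<tau> n) (v (\<tau> n)) powr p) = (\<Sum>n\<in>\<tau> ` ?S. \<nu> n (v n) powr p)"
      by (subst sum.reindex) (auto intro: inj_on_subset[OF inj])
    also have "\<dots> \<le> N v powr p" using F by (intro sum_le_N v) auto
    finally show ?thesis by (simp add: powr_mult mult_left_mono)
  qed
  note * = B_I[of w "C * N v", OF z _ this]
  show "w \<in> B" "N w \<le> C * N v" using * C N_nonneg[of v] by auto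
qed

lemma B_dominated_id:
  assumes "v \<in> B" "C \<ge> 0" "\<And>n i. n < i \<Longrightarrow> w n i = 0" "\<And>n. \<nu> n (w n) \<le> C * \<nu> n (v n)"
  shows "w \<in> B" and "N w \<le> C * N v"
  using B_dominated[of v C w "\<lambda>n. n"] assms by auto

text \<open>For membership a crude power inequality replaces Minkowski's; norm bounds for
  differences are later obtained in the Banach space, through the isomorphism.\<close>

lemma B_add:
  assumes "u \<in> B" "v \<in> B"
  shows "(\<lambda>n i. u n i + v n i) \<in> B"
proof (rule B_I(1))
  define s where "s = (2 powr p * (N u powr p + N v powr p)) powr (1 / p)"
  show "s \<ge> 0" by (simp add: s_def)
  fix F :: "nat set" assume F: "finite F"
  have "(\<Sum>n\<in>F. \<nu> n (\<lambda>i. u n i + v n i) powr p)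
     \<le> (\<Sum>n\<in>F. 2 powr p * (\<nu> n (u n) powr p + \<nu> n (v n) powr p))"
  proof (rule sum_mono)
    fix n
    have "\<nu> n (\<lambda>i. u n i + v n i) powr p \<le> (\<nu> n (u n) + \<nu> n (v n)) powr p"
      using p by (intro powr_mono2 l_norm_triangle r l_norm_nonneg) auto
    also have "\<dots> \<le> 2 powr p * (\<nu> n (u n) powr p + \<nu> n (v n) powr p)"
      using p by (intro add_powr_le l_norm_nonneg r) auto
    finally show "\<nu> n (\<lambda>i. u n i + v n i) powr p \<le> 2 powr p * (\<nu> n (u n) powr p + \<nu> n (v n) powr p)" .
  qed
  also have "\<dots> \<le> 2 powr p * (N u powr p + N v powr p)"
    unfolding sum_distrib_left[symmetric] sum.distrib
    by (intro mult_left_mono add_mono sum_le_N assms F) auto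
  also have "\<dots> = s powr p" using p by (simp add: s_def powr_powr)
  finally show "(\<Sum>n\<in>F. \<nu> n (\<lambda>i. u n i + v n i) powr p) \<le> s powr p" .
qed (use assms in \<open>simp add: B_zero_above\<close>)

lemma B_scale:
  assumes "v \<in> B"
  shows "(\<lambda>n i. c * v n i) \<in> B"
  by (rule B_dominated_id(1)[OF assms, of "norm c"])
     (use assms l_norm_scale[OF r] in \<open>simp_all add: B_zero_above\<close>)

lemma B_diff:
  assumes "u \<in> B" "v \<in> B"
  shows "(\<lambda>n i. u n i - v n i) \<in> B"
  using B_add[OF assms(1) B_scale[OF assms(2), of "-1"]] by simp

lemma B_zero: "(\<lambda>n i. 0) \<in> B"
proof (rule B_I(1)[of _ 0])
  have "\<nu> n (\<lambda>_. 0) = 0" for n using l_norm_single[OF r, of "\<lambda>_. 0 :: 'k" n] by simp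
  then show "(\<Sum>n\<in>F. \<nu> n (\<lambda>i. 0) powr p) \<le> 0 powr p" for F using p by simp
qed auto

lemma B_finite:
  assumes "\<And>n i. n < i \<Longrightarrow> v n i = 0" "\<And>n. n \<notin> G \<Longrightarrow> v n = (\<lambda>_. 0)" "finite G"
  shows "v \<in> B" and "N v \<le> (\<Sum>n\<in>G. \<nu> n (v n) powr p) powr (1 / p)"
proof -
  have *: "\<nu> n (\<lambda>_. 0) = 0" for n using l_norm_single[OF r, of "\<lambda>_. 0 :: 'k" n] by simp
  have "(\<Sum>n\<in>F. \<nu> n (v n) powr p) \<le> ((\<Sum>n\<in>G. \<nu> n (v n) powr p) powr (1 / p)) powr p"
    if "finite F" for F
  proof -
    have "(\<Sum>n\<in>F. \<nu> n (v n) powr p) = (\<Sum>n\<in>F \<inter> G. \<nu> n (v n) powr p)"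
      by (rule sum.mono_neutral_right) (use that assms * p in auto)
    also have "\<dots> \<le> (\<Sum>n\<in>G. \<nu> n (v n) powr p)" using assms(3) by (intro sum_mono2) auto
    finally show ?thesis using p by (simp add: powr_powr sum_nonneg)
  qed
  from B_I[OF assms(1) _ this] show "v \<in> B" "N v \<le> (\<Sum>n\<in>G. \<nu> n (v n) powr p) powr (1 / p)" by auto
qed

lemma \<nu>_le_N: "v \<in> B \<Longrightarrow> \<nu> n (v n) \<le> N v"
  using sum_le_N[of v "{n}"] p powr_mono2[of "1 / p" "\<nu> n (v n) powr p" "N v powr p"]
  by (simp add: powr_powr N_nonneg l_norm_nonneg[OF r])

lemma coordinate_le_N: "v \<in> B \<Longrightarrow> norm (v n i) \<le> N v"
  using order_trans[OF norm_le_l_norm[OF r, of i n "v n"] \<nu>_le_N[of v n]] B_zero_above[of v n i] N_nonneg[of v]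
  by (cases "i \<le> n") auto

definition tail :: "nat \<Rightarrow> (nat \<Rightarrow> nat \<Rightarrow> 'k) \<Rightarrow> nat \<Rightarrow> nat \<Rightarrow> 'k" where
  "tail M v = (\<lambda>n i. if n < M then 0 else v n i)"

lemma tail_B: "v \<in> B \<Longrightarrow> tail M v \<in> B"
  by (rule B_dominated_id(1)[of v 1])
     (auto simp: tail_def B_zero_above intro!: l_norm_mono r)

text \<open>As \<open>p\<close> is finite, the norm of \<open>B\<close> is given by a convergent
  series. This is the source of convergence for all expansions built from \<open>B\<close>.\<close>

lemma tail_tendsto:
  assumes "v \<in> B"
  shows "(\<lambda>M. N (tail M v)) \<longlonglongrightarrow> 0"
proof -
  define g where "g n = \<nu> n (v n) powr p" for n
  have s: "summable g" using assms unfolding B_space_def lp_sum_def g_def by simp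
  have sh: "summable (\<lambda>n. g (n + M))" for M by (rule summable_ignore_initial_segment[OF s])
  have g: "g n \<ge> 0" for n by (simp add: g_def)
  have "(\<lambda>M. \<Sum>n. g (n + M)) \<longlonglongrightarrow> 0" by (rule suminf_exist_split2[OF s])
  then have "(\<lambda>M. (\<Sum>n. g (n + M)) powr (1 / p)) \<longlonglongrightarrow> 0 powr (1 / p)"
    using p by (intro tendsto_powr2) (auto intro!: always_eventually suminf_nonneg sh g)
  moreover have "N (tail M v) \<le> (\<Sum>n. g (n + M)) powr (1 / p)" for M
  proof (rule B_I(2))
    show "tail M v n i = 0" if "n < i" for n i using that assms by (simp add: tail_def B_zero_above)
    fix F :: "nat set" assume F: "finite F"
    have z: "\<nu> n (\<lambda>_. 0) = 0" for n using l_norm_single[OF r, of "\<lambda>_. 0 :: 'k" n] by simp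
    have "(\<Sum>n\<in>F. \<nu> n (tail M v n) powr p) = (\<Sum>n\<in>F - {..<M}. \<nu> n (tail M v n) powr p)"
      by (rule sum.mono_neutral_right) (use F p z in \<open>auto simp: tail_def\<close>)
    also have "\<dots> = (\<Sum>n\<in>F - {..<M}. g n)" by (rule sum.cong) (auto simp: tail_def g_def)
    also have "\<dots> = (\<Sum>n\<in>(\<lambda>n. n - M) ` (F - {..<M}). g (n + M))"
      by (subst sum.reindex) (auto simp: inj_on_def)
    also have "\<dots> \<le> (\<Sum>n. g (n + M))"
      using F by (intro sum_le_suminf summable_ignore_initial_segment s) (auto simp: g_def)
    also have "\<dots> = ((\<Sum>n. g (n + M)) powr (1 / p)) powr p"
      using p suminf_nonneg[OF sh g] by (simp add: powr_powr)
    finally show "(\<Sum>n\<in>F. \<nu> n (tail M v n) powr p) \<le> ((\<Sum>n. g (n + M)) powr (1 / p)) powr p" .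
  qed simp
  ultimately show ?thesis
    using p N_nonneg
    by (intro Lim_null_comparison[of "\<lambda>M. N (tail M v)" "\<lambda>M. (\<Sum>n. g (n + M)) powr (1 / p)"]) simp_all
qed

end

subsection \<open>Partial bases\<close>

context banach_space_over
begin

text \<open>A basis of the range of a projection \<open>Q\<close>, bounded above and away from 0,
  with functionals defined on the whole space. Their continuity is not listed, as it follows in
  \<open>partial_basis_coefficient_le\<close>.\<close>

definition partial_basis ::
    "(nat \<Rightarrow> 'a) \<Rightarrow> (nat \<Rightarrow> 'a \<Rightarrow> 'k) \<Rightarrow> ('a \<Rightarrow> 'a) \<Rightarrow> real \<Rightarrow> bool" where
  "partial_basis u \<alpha> Q K \<longleftrightarrow> K \<ge> 0 \<and>
     (\<forall>n f g. \<alpha> n (f + g) = \<alpha> n f + \<alpha> n g) \<and> (\<forall>n c f. \<alpha> n (smul c f) = c * \<alpha> n f) \<and>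
     (\<forall>n l. \<alpha> n (u l) = (if n = l then 1 else 0)) \<and>
     (\<forall>f M. norm (\<Sum>i<M. smul (\<alpha> i f) (u i)) \<le> K * norm f) \<and>
     (\<forall>f. (\<lambda>M. \<Sum>i<M. smul (\<alpha> i f) (u i)) \<longlonglongrightarrow> Q f) \<and>
     (\<forall>n. norm (u n) \<le> K \<and> 1 \<le> K * norm (u n))"

lemma partial_basis_coefficient_le:
  assumes "partial_basis u \<alpha> Q K"
  shows "norm (\<alpha> n f) \<le> 2 * K\<^sup>2 * norm f"
proof -
  have K: "K \<ge> 0" and S: "norm (\<Sum>i<M. smul (\<alpha> i f) (u i)) \<le> K * norm f"
    and u: "1 \<le> K * norm (u n)" for M
    using assms by (auto simp: partial_basis_def)
  have "smul (\<alpha> n f) (u n) = (\<Sum>i<Suc n. smul (\<alpha> i f) (u i)) - (\<Sum>i<n. smul (\<alpha> i f) (u i))" by simp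
  then have "norm (smul (\<alpha> n f) (u n)) \<le> K * norm f + K * norm f"
    by (simp only: order_trans[OF norm_triangle_ineq4 add_mono[OF S S]])
  then have "K * (norm (\<alpha> n f) * norm (u n)) \<le> K * (2 * (K * norm f))"
    using K by (intro mult_left_mono) (auto simp: norm_scale)
  moreover have "norm (\<alpha> n f) * 1 \<le> norm (\<alpha> n f) * (K * norm (u n))"
    using u by (intro mult_left_mono) auto
  ultimately show ?thesis by (simp add: power2_eq_square mult_ac)
qed

definition interleave :: "(nat \<Rightarrow> 'b) \<Rightarrow> (nat \<Rightarrow> 'b) \<Rightarrow> nat \<Rightarrow> 'b" where
  "interleave x y n = (if even n then x (n div 2) else y (n div 2))"

lemma sum_interleave:
  "(\<Sum>i<M. interleave x y i) = (\<Sum>i<(M + 1) div 2. x i) + (\<Sum>i<M div 2. y i)"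
  for x :: "nat \<Rightarrow> 'b::comm_monoid_add"
proof (induction M)
  case (Suc M)
  show ?case
  proof (cases "even M")
    case True
    then have "(Suc M + 1) div 2 = Suc (M div 2)" "Suc M div 2 = M div 2" "(M + 1) div 2 = M div 2" by auto
    then show ?thesis using Suc True by (simp add: interleave_def add_ac)
  next
    case False
    then have "(Suc M + 1) div 2 = (M + 1) div 2" "Suc M div 2 = Suc (M div 2)" by (auto elim!: oddE)
    then show ?thesis using Suc False by (simp add: interleave_def add_ac)
  qed
qed simp

text \<open>A partial sum of the alternating sequence is a sum of one partial sum of each kind, of
  nearly equal lengths, so bounds and limits simply add.\<close>

lemma partial_basis_interleave:
  assumes 1: "partial_basis u \<alpha> Q K" and 2: "partial_basis u' \<alpha>' Q' K'"
    and orth: "\<And>n m. \<alpha> n (u' m) = 0" "\<And>n m. \<alpha>' n (u m) = 0"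
  shows "partial_basis (interleave u u') (interleave \<alpha> \<alpha>') (\<lambda>f. Q f + Q' f) (K + K')"
proof -
  have il: "smul (interleave \<alpha> \<alpha>' i f) (interleave u u' i)
      = interleave (\<lambda>i. smul (\<alpha> i f) (u i)) (\<lambda>i. smul (\<alpha>' i f) (u' i)) i" for i f
    by (simp add: interleave_def)
  have K: "K \<ge> 0" "K' \<ge> 0" using 1 2 by (auto simp: partial_basis_def)
  have b: "norm (\<Sum>i<M. smul (\<alpha> i f) (u i)) \<le> K * norm f"
    "norm (\<Sum>i<M. smul (\<alpha>' i f) (u' i)) \<le> K' * norm f" for M f
    using 1 2 by (auto simp: partial_basis_def)
  have l: "(\<lambda>M. \<Sum>i<M. smul (\<alpha> i f) (u i)) \<longlonglongrightarrow> Q f"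
    "(\<lambda>M. \<Sum>i<M. smul (\<alpha>' i f) (u' i)) \<longlonglongrightarrow> Q' f" for f
    using 1 2 by (auto simp: partial_basis_def)
  have fl: "filterlim (\<lambda>M::nat. (M + 1) div 2) at_top at_top" "filterlim (\<lambda>M::nat. M div 2) at_top at_top"
    unfolding filterlim_at_top eventually_sequentially by presburger+
  have bnd: "norm (interleave u u' n) \<le> K + K'" "1 \<le> (K + K') * norm (interleave u u' n)" for n
  proof -
    have "norm (u l) \<le> K" "1 \<le> K * norm (u l)" "norm (u' l) \<le> K'" "1 \<le> K' * norm (u' l)" for l
      using 1 2 by (auto simp: partial_basis_def)
    from this[of "n div 2"] K show "norm (interleave u u' n) \<le> K + K'" "1 \<le> (K + K') * norm (interleave u u' n)"
      by (auto simp: interleave_def distrib_right intro: add_increasing add_increasing2)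
  qed
  have \<delta>: "\<alpha> n (u l) = (if n = l then 1 else 0)" "\<alpha>' n (u' l) = (if n = l then 1 else 0)" for n l
    using 1 2 by (auto simp: partial_basis_def)
  show ?thesis unfolding partial_basis_def il sum_interleave
  proof (intro conjI allI)
    show "interleave \<alpha> \<alpha>' n (interleave u u' l) = (if n = l then 1 else 0)" for n l
      by (auto simp: interleave_def orth \<delta> elim!: evenE oddE)
    show "norm ((\<Sum>i<(M + 1) div 2. smul (\<alpha> i f) (u i)) + (\<Sum>i<M div 2. smul (\<alpha>' i f) (u' i))) \<le> (K + K') * norm f" for f M
      unfolding distrib_right by (intro norm_triangle_le add_mono b)
    show "(\<lambda>M. (\<Sum>i<(M + 1) div 2. smul (\<alpha> i f) (u i)) + (\<Sum>i<M div 2. smul (\<alpha>' i f) (u' i))) \<longlonglongrightarrow> Q f + Q' f" for f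
      by (intro tendsto_add filterlim_compose[OF l(1) fl(1)] filterlim_compose[OF l(2) fl(2)])
    show "interleave \<alpha> \<alpha>' n (f + g) = interleave \<alpha> \<alpha>' n f + interleave \<alpha> \<alpha>' n g" for n f g
      using 1 2 by (auto simp: interleave_def partial_basis_def)
    show "interleave \<alpha> \<alpha>' n (smul c f) = c * interleave \<alpha> \<alpha>' n f" for n c f
      using 1 2 by (auto simp: interleave_def partial_basis_def)
  qed (use K bnd in auto)
qed

text \<open>Normalising the vectors does not change the partial sums; their uniform bound is
  \<open>partial_sum_bounded\<close>.\<close>

lemma schauder_basis_partial_basis:
  assumes "schauder_basis smul x"
  shows "\<exists>u \<alpha> K. partial_basis u \<alpha> (\<lambda>f. f) K"
proof -
  obtain K where K: "\<And>f n. norm (partial_sum x n f) \<le> K * norm f"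
    using partial_sum_bounded[OF assms] by blast
  define u where "u n = smul (of_real (1 / norm (x n))) (x n)" for n
  define \<alpha> where "\<alpha> n f = of_real (norm (x n)) * coord smul x n f" for n f
  have x: "x n \<noteq> 0" for n by (rule basis_nonzero[OF assms])
  have u: "norm (u n) = 1" for n using x by (simp add: u_def norm_scale norm_divide)
  have "smul (\<alpha> i f) (u i) = smul (coord smul x i f) (x i)" for i f
    using x by (simp add: u_def \<alpha>_def flip: of_real_mult of_real_divide)
  then have S: "(\<Sum>i<M. smul (\<alpha> i f) (u i)) = partial_sum x M f" for M f
    by (simp add: partial_sum_def)
  have "partial_basis u \<alpha> (\<lambda>f. f) (max 1 K)" unfolding partial_basis_def S
  proof (intro conjI allI)
    show "norm (partial_sum x M f) \<le> max 1 K * norm f" for M f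
      by (rule order_trans[OF K]) (auto intro: mult_right_mono)
    show "\<alpha> n (u l) = (if n = l then 1 else 0)" for n l
      using x by (auto simp: \<alpha>_def u_def coord_linear[OF assms] coord_basis[OF assms] simp flip: of_real_mult of_real_divide)
  qed (auto simp: u partial_sum_tendsto[OF assms] \<alpha>_def coord_linear[OF assms] distrib_left mult_ac)
  then show ?thesis by blast
qed

text \<open>Transport along an isomorphic embedding \<open>U\<close>; its left inverse
  \<open>V\<close> extends the functionals to the whole space and makes \<open>U\<close> after
  \<open>V\<close> the projection.\<close>

lemma partial_basis_embed:
  assumes pb: "partial_basis u \<alpha> (\<lambda>f. f) K"
    and U: "bounded_linear U" "\<And>c f. U (smul c f) = smul c (U f)"
    and V: "bounded_linear V" "\<And>c f. V (smul c f) = smul c (V f)"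
    and VU: "\<And>f. V (U f) = f"
  shows "\<exists>K. partial_basis (\<lambda>n. U (u n)) (\<lambda>n f. \<alpha> n (V f)) (\<lambda>f. U (V f)) K"
proof -
  interpret U: bounded_linear U by (rule U)
  interpret V: bounded_linear V by (rule V)
  obtain KU where KU: "KU > 0" "\<And>f. norm (U f) \<le> norm f * KU" using U.pos_bounded by blast
  obtain KV where KV: "KV > 0" "\<And>f. norm (V f) \<le> norm f * KV" using V.pos_bounded by blast
  have K: "K \<ge> 0" and u: "norm (u n) \<le> K" "1 \<le> K * norm (u n)"
    and b: "norm (\<Sum>i<M. smul (\<alpha> i f) (u i)) \<le> K * norm f"
    and l: "(\<lambda>M. \<Sum>i<M. smul (\<alpha> i f) (u i)) \<longlonglongrightarrow> f" for n f M
    using pb by (auto simp: partial_basis_def)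
  have S: "(\<Sum>i<M. smul (\<alpha> i (V f)) (U (u i))) = U (\<Sum>i<M. smul (\<alpha> i (V f)) (u i))" for M f
    by (simp add: U.sum U(2))
  define K' where "K' = K * KU * KV + K * KU + K * KV"
  have K': "K' \<ge> 0" "K * KU * KV \<le> K'" "K * KU \<le> K'" "K * KV \<le> K'"
    using K KU KV by (auto simp: K'_def)
  have "partial_basis (\<lambda>n. U (u n)) (\<lambda>n f. \<alpha> n (V f)) (\<lambda>f. U (V f)) K'"
    unfolding partial_basis_def S
  proof (intro conjI allI)
    show "norm (U (\<Sum>i<M. smul (\<alpha> i (V f)) (u i))) \<le> K' * norm f" for f M
    proof -
      have "norm (U (\<Sum>i<M. smul (\<alpha> i (V f)) (u i))) \<le> K * norm (V f) * KU"
        using KU by (intro order_trans[OF KU(2)] mult_right_mono b) auto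
      also have "\<dots> \<le> K * (norm f * KV) * KU"
        using KU K by (intro mult_right_mono mult_left_mono KV) auto
      also have "\<dots> = (K * KU * KV) * norm f" by simp
      also have "\<dots> \<le> K' * norm f" using K' by (intro mult_right_mono) auto
      finally show ?thesis .
    qed
    show "(\<lambda>M. U (\<Sum>i<M. smul (\<alpha> i (V f)) (u i))) \<longlonglongrightarrow> U (V f)" for f
      by (intro U.tendsto l)
    show "norm (U (u n)) \<le> K'" for n
      using KU u K'(3) by (meson mult_right_mono order_trans less_imp_le)
    show "1 \<le> K' * norm (U (u n))" for n
    proof -
      have "1 \<le> K * norm (V (U (u n)))" using u by (simp add: VU)
      also have "\<dots> \<le> K * (norm (U (u n)) * KV)" using K by (intro mult_left_mono KV) auto
      also have "\<dots> = (K * KV) * norm (U (u n))" by simp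
      also have "\<dots> \<le> K' * norm (U (u n))" using K' by (intro mult_right_mono) auto
      finally show ?thesis .
    qed
  qed (use K' pb in \<open>auto simp: partial_basis_def VU V.add V(2)\<close>)
  then show ?thesis by blast
qed

end

subsection \<open>Complemented copies of \<open>B\<close>\<close>

locale B_embedding = banach_space_over smul + B_space_setup r p "TYPE('k)"
  for smul :: "'k::real_or_complex \<Rightarrow> 'a::banach \<Rightarrow> 'a" and r p +
  fixes T :: "(nat \<Rightarrow> nat \<Rightarrow> 'k) \<Rightarrow> 'a" and P :: "'a \<Rightarrow> 'a" and ca cb :: real
  assumes T_bij: "bij_betw T B (range P)"
    and T_add: "\<And>u v. u \<in> B \<Longrightarrow> v \<in> B \<Longrightarrow> T (\<lambda>n i. u n i + v n i) = T u + T v"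
    and T_scale: "\<And>c v. v \<in> B \<Longrightarrow> T (\<lambda>n i. c * v n i) = smul c (T v)"
    and ca: "ca > 0" and cb: "cb > 0"
    and T_ge: "\<And>v. v \<in> B \<Longrightarrow> ca * N v \<le> norm (T v)" and T_le: "\<And>v. v \<in> B \<Longrightarrow> norm (T v) \<le> cb * N v"
    and P: "bounded_linear P" and P_scale: "\<And>c f. P (smul c f) = smul c (P f)" and P_P: "\<And>f. P (P f) = P f"
begin

sublocale P: bounded_linear P by (rule P)

text \<open>The inverse of \<open>T\<close> after the projection: every vector of the space acquires
  coordinates in \<open>B\<close>.\<close>

definition R :: "'a \<Rightarrow> nat \<Rightarrow> nat \<Rightarrow> 'k" where "R f = inv_into B T (P f)"

lemma R_B: "R f \<in> B"
  unfolding R_def by (rule inv_into_into) (use T_bij in \<open>auto simp: bij_betw_def\<close>)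

lemma T_R: "T (R f) = P f"
  unfolding R_def by (rule f_inv_into_f[of "P f" T B]) (use T_bij in \<open>simp add: bij_betw_def\<close>)

lemma P_T:
  assumes "v \<in> B"
  shows "P (T v) = T v"
proof -
  obtain f where "T v = P f" using bij_betw_apply[OF T_bij assms] by blast
  then show ?thesis by (simp add: P_P)
qed

lemma T_inj: "u \<in> B \<Longrightarrow> v \<in> B \<Longrightarrow> T u = T v \<Longrightarrow> u = v"
  using T_bij by (auto simp: bij_betw_def inj_on_def)

lemma R_T: "v \<in> B \<Longrightarrow> R (T v) = v"
  by (rule T_inj) (simp_all add: R_B T_R P_T)

lemma T_zero: "T (\<lambda>n i. 0) = 0"
  using T_scale[OF B_zero, of 0] by simp

lemma T_diff: "u \<in> B \<Longrightarrow> v \<in> B \<Longrightarrow> T (\<lambda>n i. u n i - v n i) = T u - T v"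
  using T_add[of u "\<lambda>n i. -1 * v n i"] B_scale[of v "-1"] T_scale[of v "-1"] by simp

lemma R_add: "R (f + g) = (\<lambda>n i. R f n i + R g n i)"
  by (rule T_inj) (simp_all add: R_B B_add T_add T_R P.add)

lemma R_scale: "R (smul c f) = (\<lambda>n i. c * R f n i)"
  by (rule T_inj) (simp_all add: R_B B_scale T_scale T_R P_scale)

lemma R_complement: "R (f - P f) = (\<lambda>n i. 0)"
  by (rule T_inj) (simp_all add: R_B B_zero T_zero T_R P.diff P_P)

lemma T_sum:
  assumes "\<And>j. j \<in> F \<Longrightarrow> w j \<in> B"
  shows "(\<lambda>n i. \<Sum>j\<in>F. w j n i) \<in> B" and "T (\<lambda>n i. \<Sum>j\<in>F. w j n i) = (\<Sum>j\<in>F. T (w j))"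
  using assms
  by (induction F rule: infinite_finite_induct) (simp_all add: B_zero T_zero B_add T_add)

lemma N_R: "\<exists>cR>0. \<forall>f. N (R f) \<le> cR * norm f"
proof -
  obtain KP where KP: "KP > 0" "\<And>f. norm (P f) \<le> norm f * KP" using P.pos_bounded by blast
  have "N (R f) \<le> KP / ca * norm f" for f
  proof -
    have "ca * N (R f) \<le> norm f * KP" using T_ge[OF R_B, of f] KP(2)[of f] by (simp add: T_R)
    then show ?thesis using ca by (simp add: field_simps)
  qed
  moreover have "KP / ca > 0" using KP ca by simp
  ultimately show ?thesis by blast
qed

text \<open>The triangle inequality of the Banach space, pulled back through \<open>T\<close> at the
  price of \<open>cb / ca\<close>.\<close>

lemma N_diff:
  assumes "u \<in> B" "v \<in> B"
  shows "N (\<lambda>n i. u n i - v n i) \<le> cb / ca * (N u + N v)"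
proof -
  have "ca * N (\<lambda>n i. u n i - v n i) \<le> norm (T u - T v)"
    using T_ge[OF B_diff[OF assms]] by (simp add: T_diff assms)
  also have "\<dots> \<le> cb * N u + cb * N v"
    by (rule order_trans[OF norm_triangle_ineq4 add_mono]) (simp_all add: T_le assms)
  finally show ?thesis using ca by (simp add: field_simps)
qed

lemma lift_bounded_linear:
  assumes q: "\<And>v. v \<in> B \<Longrightarrow> q v \<in> B" "\<And>v. v \<in> B \<Longrightarrow> N (q v) \<le> C * N v"
    and add: "\<And>u v. q (\<lambda>n i. u n i + v n i) = (\<lambda>n i. q u n i + q v n i)"
    and scale: "\<And>c v. q (\<lambda>n i. c * v n i) = (\<lambda>n i. c * q v n i)"
  shows "bounded_linear (\<lambda>f. T (q (R f)))" and "T (q (R (smul c f))) = smul c (T (q (R f)))"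
proof -
  show sc: "T (q (R (smul c f))) = smul c (T (q (R f)))" for c f
    by (simp add: R_scale scale T_scale q R_B)
  obtain cR where cR: "cR > 0" "\<And>f. N (R f) \<le> cR * norm f" using N_R by blast
  show "bounded_linear (\<lambda>f. T (q (R f)))"
  proof (rule bounded_linear_intro[where K = "cb * (max 0 C * cR)"])
    show "T (q (R (c *\<^sub>R f))) = c *\<^sub>R T (q (R f))" for c f
      using sc[of "of_real c" f] by (simp add: scale_of_real)
    show "norm (T (q (R f))) \<le> norm f * (cb * (max 0 C * cR))" for f
    proof -
      have "N (q (R f)) \<le> max 0 C * N (R f)"
        using q(2)[OF R_B, of f] mult_right_mono[of C "max 0 C" "N (R f)"] N_nonneg by (meson max.cobounded2 order_trans)
      also have "\<dots> \<le> max 0 C * (cR * norm f)" by (intro mult_left_mono cR) auto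
      finally have "cb * N (q (R f)) \<le> cb * (max 0 C * (cR * norm f))" using cb by (intro mult_left_mono) auto
      then show ?thesis using T_le[OF q(1)[OF R_B], of f] by (simp add: mult_ac)
    qed
  qed (simp add: R_add add T_add q R_B)
qed

text \<open>The map \<open>q M\<close> is an explicit formula for the \<open>M\<close>-th partial
  sum and \<open>qI\<close> for the limit. Convergence reduces to \<open>tail_tendsto\<close>: what
  \<open>q M\<close> misses is controlled by the blocks from \<open>t M\<close> on.\<close>

lemma partial_basis_lift:
  assumes \<sigma>: "\<And>g. \<sigma> g \<in> B" "\<And>g. N (\<sigma> g) \<le> C" "\<And>g. 1 \<le> C * N (\<sigma> g)"
    and \<phi>_add: "\<And>g u v. \<phi> g (\<lambda>n i. u n i + v n i) = \<phi> g u + \<phi> g v"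
    and \<phi>_scale: "\<And>g c v. \<phi> g (\<lambda>n i. c * v n i) = c * \<phi> g v"
    and \<phi>_\<sigma>: "\<And>g l. \<phi> g (\<sigma> l) = (if g = l then 1 else 0)"
    and q_0: "\<And>v. q 0 v = (\<lambda>n i. 0)"
    and q_Suc: "\<And>M v. v \<in> B \<Longrightarrow> q (Suc M) v = (\<lambda>n i. q M v n i + \<phi> M v * \<sigma> M n i)"
    and q_le: "\<And>M v. v \<in> B \<Longrightarrow> N (q M v) \<le> C * N v"
    and qI: "\<And>v. v \<in> B \<Longrightarrow> qI v \<in> B"
    and d: "\<And>M v. v \<in> B \<Longrightarrow> N (\<lambda>n i. qI v n i - q M v n i) \<le> C * N (tail (t M) v)"
    and t: "filterlim t at_top at_top"
  shows "\<exists>K. partial_basis (\<lambda>g. T (\<sigma> g)) (\<lambda>g f. \<phi> g (R f)) (\<lambda>f. T (qI (R f))) K"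
    and "v \<in> B \<Longrightarrow> (\<Sum>g<M. smul (\<phi> g v) (T (\<sigma> g))) = T (q M v)"
proof -
  obtain cR where cR: "cR > 0" "\<And>f. N (R f) \<le> cR * norm f" using N_R by blast
  have q_B: "q M v \<in> B" if "v \<in> B" for M v
  proof (induction M)
    case 0
    show ?case unfolding q_0 by (rule B_zero)
  next
    case (Suc M)
    show ?case unfolding q_Suc[OF that] by (intro B_add B_scale Suc \<sigma>)
  qed
  show S: "(\<Sum>g<M. smul (\<phi> g v) (T (\<sigma> g))) = T (q M v)" if "v \<in> B" for M v
  proof (induction M)
    case 0
    show ?case unfolding q_0 T_zero by simp
  next
    case (Suc M)
    show ?case unfolding q_Suc[OF that] T_add[OF q_B[OF that] B_scale[OF \<sigma>(1)]] T_scale[OF \<sigma>(1)]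
      by (simp add: Suc)
  qed
  have C: "C \<ge> 0" using \<sigma>(2)[of 0] N_nonneg[of "\<sigma> 0"] by linarith
  define K where "K = cb * C * cR + cb * C + C / ca"
  have K: "K \<ge> 0" "cb * C * cR \<le> K" "cb * C \<le> K" "C / ca \<le> K"
    using C cR cb ca by (auto simp: K_def)
  have "partial_basis (\<lambda>g. T (\<sigma> g)) (\<lambda>g f. \<phi> g (R f)) (\<lambda>f. T (qI (R f))) K"
    unfolding partial_basis_def S[OF R_B]
  proof (intro conjI allI)
    show "norm (T (q M (R f))) \<le> K * norm f" for f M
    proof -
      have "norm (T (q M (R f))) \<le> cb * (C * N (R f))"
        using cb by (intro order_trans[OF T_le] mult_left_mono q_B q_le R_B) auto
      also have "\<dots> \<le> cb * (C * (cR * norm f))" using cb C by (intro mult_left_mono cR) auto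
      also have "\<dots> = (cb * C * cR) * norm f" by simp
      also have "\<dots> \<le> K * norm f" using K by (intro mult_right_mono) auto
      finally show ?thesis .
    qed
    show "norm (T (\<sigma> n)) \<le> K" for n
    proof -
      have "norm (T (\<sigma> n)) \<le> cb * C"
        using cb by (intro order_trans[OF T_le] mult_left_mono \<sigma>) auto
      then show ?thesis using K by linarith
    qed
    show "1 \<le> K * norm (T (\<sigma> n))" for n
    proof -
      have "1 \<le> C / ca * (ca * N (\<sigma> n))" using \<sigma>(3)[of n] ca by simp
      also have "\<dots> \<le> C / ca * norm (T (\<sigma> n))" using C ca by (intro mult_left_mono T_ge \<sigma>) auto
      also have "\<dots> \<le> K * norm (T (\<sigma> n))" using K by (intro mult_right_mono) auto
      finally show ?thesis .
    qed
    show "(\<lambda>M. T (q M (R f))) \<longlonglongrightarrow> T (qI (R f))" for f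
    proof (rule Lim_transform2)
      show "(\<lambda>_. T (qI (R f))) \<longlonglongrightarrow> T (qI (R f))" by simp
      show "(\<lambda>M. T (qI (R f)) - T (q M (R f))) \<longlonglongrightarrow> 0"
      proof (rule Lim_null_comparison)
        show "\<forall>\<^sub>F M in sequentially. norm (T (qI (R f)) - T (q M (R f))) \<le> cb * (C * N (tail (t M) (R f)))"
        proof (intro always_eventually allI)
          fix M
          have "norm (T (\<lambda>n i. qI (R f) n i - q M (R f) n i)) \<le> cb * (C * N (tail (t M) (R f)))"
            using cb by (intro order_trans[OF T_le] mult_left_mono B_diff qI q_B d R_B) auto
          then show "norm (T (qI (R f)) - T (q M (R f))) \<le> cb * (C * N (tail (t M) (R f)))"
            by (simp add: T_diff qI q_B R_B)
        qed
        have "(\<lambda>M. cb * (C * N (tail (t M) (R f)))) \<longlonglongrightarrow> cb * (C * 0)"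
          by (intro tendsto_mult tendsto_const filterlim_compose[OF tail_tendsto[OF R_B] t])
        then show "(\<lambda>M. cb * (C * N (tail (t M) (R f)))) \<longlonglongrightarrow> 0" by simp
      qed
    qed
  qed (use K in \<open>auto simp: R_add R_scale \<phi>_add \<phi>_scale \<phi>_\<sigma> R_T \<sigma>\<close>)
  then show "\<exists>K. partial_basis (\<lambda>g. T (\<sigma> g)) (\<lambda>g f. \<phi> g (R f)) (\<lambda>f. T (qI (R f))) K" by blast
qed

end

subsection \<open>Splitting the coordinates of \<open>B\<close>\<close>

definition pow2 :: "nat \<Rightarrow> bool" where "pow2 m \<longleftrightarrow> (\<exists>k. m = 2 ^ k)"

definition halve_pow2 :: "nat \<Rightarrow> nat" where "halve_pow2 m = (if pow2 m then m div 2 else m)"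

definition double_pow2 :: "nat \<Rightarrow> nat" where "double_pow2 e = (if pow2 e then 2 * e else e)"

text \<open>The intervals \<open>{m div 2<..m}\<close> over the powers of two tile the positive
  integers. So the position \<open>i = Suc g\<close> alone determines its block, and the conditional
  vectors are enumerated by \<open>g\<close> without coding pairs.\<close>

definition cond_coord :: "nat \<Rightarrow> nat \<Rightarrow> bool" where
  "cond_coord m i \<longleftrightarrow> pow2 m \<and> m div 2 < i \<and> i \<le> m"

lemma less_exp_minus_1_iff: "m < 2 ^ n - Suc 0 \<longleftrightarrow> level m < n"
  by (simp add: level_less_iff)

lemma pow2_double: "pow2 e \<Longrightarrow> pow2 (2 * e)"
  unfolding pow2_def by (metis power_Suc)

lemma pow2_half: "pow2 m \<Longrightarrow> m div 2 > 0 \<Longrightarrow> pow2 (m div 2) \<and> 2 * (m div 2) = m"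
  unfolding pow2_def
proof (elim exE)
  fix k assume "m = 2 ^ k" "m div 2 > 0"
  then show "(\<exists>k. m div 2 = 2 ^ k) \<and> 2 * (m div 2) = m" by (cases k) auto
qed

lemma halve_pow2_le: "halve_pow2 m \<le> m"
  by (simp add: halve_pow2_def)

lemma le_double_pow2: "e \<le> double_pow2 e"
  by (simp add: double_pow2_def)

lemma double_halve_pow2: "halve_pow2 m > 0 \<Longrightarrow> double_pow2 (halve_pow2 m) = m"
  using pow2_half[of m] by (auto simp: halve_pow2_def double_pow2_def)

lemma halve_double_pow2: "e > 0 \<Longrightarrow> halve_pow2 (double_pow2 e) = e"
  using pow2_double[of e] by (auto simp: halve_pow2_def double_pow2_def)

lemma cond_coord_iff: "cond_coord m i \<longleftrightarrow> i \<noteq> 0 \<and> i \<le> m \<and> \<not> i \<le> halve_pow2 m"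
  by (auto simp: cond_coord_def halve_pow2_def)

context B_space_setup
begin

text \<open>
  Removing from \<open>B\<close> the coordinates \<open>i = 0\<close> and those of \<open>cond_coord\<close> leaves in block \<open>m\<close>
  the coordinates \<open>1, \<dots>, halve_pow2 m\<close>. Since \<open>halve_pow2\<close> takes each positive value
  exactly once, what is left is again a copy of \<open>B\<close>.
\<close>

definition shift :: "(nat \<Rightarrow> nat \<Rightarrow> 'k) \<Rightarrow> nat \<Rightarrow> nat \<Rightarrow> 'k" where
  "shift v m i = (if 1 \<le> i \<and> i \<le> halve_pow2 m then v (halve_pow2 m - 1) (i - 1) else 0)"

text \<open>The offsets reflect that block \<open>k\<close> has dimension \<open>Suc k\<close> and
  that coordinate 0 is reserved for \<open>\<ell>\<^sub>p\<close>.\<close>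

definition unshift :: "(nat \<Rightarrow> nat \<Rightarrow> 'k) \<Rightarrow> nat \<Rightarrow> nat \<Rightarrow> 'k" where
  "unshift v k i = (if i \<le> k then v (double_pow2 (Suc k)) (Suc i) else 0)"

lemma shift_B:
  assumes "v \<in> B"
  shows "shift v \<in> B" and "N (shift v) \<le> 1 * N v"
proof -
  have 1: "shift v n i = 0" if "n < i" for n i
    using that halve_pow2_le[of n] by (simp add: shift_def)
  have 2: "inj_on (\<lambda>m. halve_pow2 m - 1) {n. shift v n \<noteq> (\<lambda>_. 0)}"
  proof (rule inj_on_subset)
    show "inj_on (\<lambda>m. halve_pow2 m - 1) {m. halve_pow2 m > 0}"
    proof (rule inj_onI)
      fix m m' assume "m \<in> {m. halve_pow2 m > 0}" "m' \<in> {m. halve_pow2 m > 0}" "halve_pow2 m - 1 = halve_pow2 m' - 1"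
      then have "halve_pow2 m = halve_pow2 m'" "halve_pow2 m > 0" "halve_pow2 m' > 0" by auto
      then show "m = m'" using double_halve_pow2 by metis
    qed
  qed (auto simp: shift_def)
  have 3: "\<nu> n (shift v n) \<le> 1 * \<nu> (halve_pow2 n - 1) (v (halve_pow2 n - 1))" for n
    unfolding mult_1 by (rule l_norm_embed[OF r, where \<iota> = "\<lambda>i. i - 1"])
      (auto simp: shift_def inj_on_def split: if_splits)
  show "shift v \<in> B" "N (shift v) \<le> 1 * N v" using B_dominated[OF assms _ 1 2 3] by auto
qed

lemma unshift_B:
  assumes "v \<in> B"
  shows "unshift v \<in> B" and "N (unshift v) \<le> 1 * N v"
proof -
  have 1: "unshift v n i = 0" if "n < i" for n i
    using that by (simp add: unshift_def)
  have 2: "inj_on (\<lambda>k. double_pow2 (Suc k)) {n. unshift v n \<noteq> (\<lambda>_. 0)}"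
    by (rule inj_onI) (metis halve_double_pow2 nat.inject zero_less_Suc)
  have 3: "\<nu> n (unshift v n) \<le> 1 * \<nu> (double_pow2 (Suc n)) (v (double_pow2 (Suc n)))" for n
    unfolding mult_1 using le_double_pow2[of "Suc n"] by (intro l_norm_embed[OF r, where \<iota> = Suc])
      (auto simp: unshift_def split: if_splits)
  show "unshift v \<in> B" "N (unshift v) \<le> 1 * N v" using B_dominated[OF assms _ 1 2 3] by auto
qed

lemma unshift_shift:
  assumes "v \<in> B"
  shows "unshift (shift v) = v"
proof (intro ext)
  fix k i
  show "unshift (shift v) k i = v k i"
    using B_zero_above[OF assms, of k i] by (auto simp: unshift_def shift_def halve_double_pow2)
qed

lemma shift_unshift: "shift (unshift v) m i = (if 1 \<le> i \<and> i \<le> halve_pow2 m then v m i else 0)"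
  by (auto simp: unshift_def shift_def double_halve_pow2)

lemma unshift_eq_0:
  assumes "\<And>m i. 1 \<le> i \<Longrightarrow> i \<le> halve_pow2 m \<Longrightarrow> v m i = 0"
  shows "unshift v = (\<lambda>n i. 0)"
proof (intro ext)
  fix n i
  show "unshift v n i = 0" using assms[of "Suc i" "double_pow2 (Suc n)"] by (simp add: unshift_def halve_double_pow2)
qed

section \<open>Block averages in \<open>\<ell>\<^sub>p\<close>\<close>

definition average :: "nat \<Rightarrow> (nat \<Rightarrow> nat \<Rightarrow> 'k) \<Rightarrow> 'k" where
  "average n v = (\<Sum>m\<in>block n. v m 0) / 2 ^ n"

lemma average_add: "average n (\<lambda>n i. u n i + v n i) = average n u + average n v"
  by (simp add: average_def sum.distrib add_divide_distrib)

lemma average_scale: "average n (\<lambda>n i. c * v n i) = c * average n v"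
  by (simp add: average_def sum_distrib_left)

lemma average_const:
  assumes "\<And>m. m \<in> block n \<Longrightarrow> v m 0 = c"
  shows "average n v = c"
  using assms by (simp add: average_def card_block)

text \<open>Boundedness of block averaging on \<open>\<ell>\<^sub>p\<close>: a mean of
  \<open>2 ^ n\<close> entries, repeated \<open>2 ^ n\<close> times, is controlled by Hoelder's
  inequality, whose form \<open>sum_le_lp\<close> accounts for the 2. A finite set is first enlarged
  to whole blocks.\<close>

lemma sum_average_le:
  assumes v: "v \<in> B" and F: "finite F"
  shows "(\<Sum>m\<in>F. norm (average (level m) v) powr p) \<le> (2 * N v) powr p"
proof -
  have blk: "(\<Sum>m\<in>block n. norm (average (level m) v) powr p) \<le> 2 powr p * (\<Sum>m\<in>block n. norm (v m 0) powr p)" for n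
  proof -
    define S where "S = (\<Sum>m\<in>block n. norm (v m 0) powr p)"
    have "norm (average n v) \<le> (\<Sum>m\<in>block n. norm (v m 0)) / 2 ^ n"
      unfolding average_def norm_divide by (simp add: norm_power norm_sum divide_right_mono)
    also have "\<dots> = (2 ^ n) powr (- 1 / p) * ((2 ^ n) powr (1 / p - 1) * (\<Sum>m\<in>block n. norm (v m 0)))"
    proof -
      have "(2 ^ n) powr (- 1 / p) * (2 ^ n) powr (1 / p - 1) = inverse (2 ^ n :: real)"
        unfolding powr_add[symmetric] by (simp add: powr_minus)
      then show ?thesis by (simp add: divide_inverse mult.assoc[symmetric])
    qed
    also have "\<dots> \<le> (2 ^ n) powr (- 1 / p) * (2 * S powr (1 / p))"
      unfolding S_def by (intro mult_left_mono sum_le_lp) (use p in \<open>auto simp: finite_block card_block\<close>)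
    finally have "norm (average n v) powr p \<le> ((2 ^ n) powr (- 1 / p) * (2 * S powr (1 / p))) powr p"
      using p by (intro powr_mono2) auto
    also have "\<dots> = (2 ^ n) powr (- 1 / p * p) * (2 powr p * S powr (1 / p * p))"
      by (simp only: powr_mult powr_powr)
    also have "\<dots> = inverse (2 ^ n) * (2 powr p * S)"
      using p by (simp add: powr_minus S_def sum_nonneg)
    finally have *: "2 ^ n * norm (average n v) powr p \<le> 2 powr p * S" by (simp add: field_simps)
    have "(\<Sum>m\<in>block n. norm (average (level m) v) powr p) = (\<Sum>m\<in>block n. norm (average n v) powr p)"
      by (rule sum.cong) (auto simp: mem_block_iff)
    then show ?thesis using * by (simp add: card_block S_def)
  qed
  obtain n where n: "F \<subseteq> {..<2 ^ n - 1}"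
  proof -
    have "m < 2 ^ Suc (Max (level ` F)) - 1" if "m \<in> F" for m
      unfolding level_less_iff[symmetric] using F that by (simp add: le_imp_less_Suc)
    then have "F \<subseteq> {..<2 ^ Suc (Max (level ` F)) - 1}" by blast
    then show ?thesis by (rule that)
  qed
  have "(\<Sum>m\<in>F. norm (average (level m) v) powr p) \<le> (\<Sum>m<2 ^ n - 1. norm (average (level m) v) powr p)"
    using n by (intro sum_mono2) auto
  also have "\<dots> \<le> (\<Sum>i<n. 2 powr p * (\<Sum>m\<in>block i. norm (v m 0) powr p))"
    unfolding sum_blocks by (intro sum_mono blk)
  also have "\<dots> = 2 powr p * (\<Sum>m<2 ^ n - 1. norm (v m 0) powr p)"
    unfolding sum_blocks by (simp only: sum_distrib_left)
  also have "\<dots> \<le> 2 powr p * (\<Sum>m<2 ^ n - 1. \<nu> m (v m) powr p)"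
    using p by (intro mult_left_mono sum_mono powr_mono2 norm_le_l_norm r) auto
  also have "\<dots> \<le> 2 powr p * N v powr p" by (intro mult_left_mono sum_le_N v) auto
  also have "\<dots> = (2 * N v) powr p" by (simp add: powr_mult)
  finally show ?thesis .
qed

definition avg_part :: "(nat \<Rightarrow> nat \<Rightarrow> 'k) \<Rightarrow> nat \<Rightarrow> nat \<Rightarrow> 'k" where
  "avg_part v m i = (if i = 0 then average (level m) v else 0)"

definition avg_partial :: "nat \<Rightarrow> (nat \<Rightarrow> nat \<Rightarrow> 'k) \<Rightarrow> nat \<Rightarrow> nat \<Rightarrow> 'k" where
  "avg_partial M v m i = (if i = 0 \<and> level m < M then average (level m) v else 0)"

text \<open>Constant on its block with \<open>\<ell>\<^sub>p\<close> norm 1, and dual to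
  \<open>avg_fun\<close>. These directions go into \<open>u\<close>, which leaves the mean-zero part
  of \<open>\<ell>\<^sub>p\<close> for \<open>h\<close>.\<close>

definition avg_vec :: "nat \<Rightarrow> nat \<Rightarrow> nat \<Rightarrow> 'k" where
  "avg_vec n m i = (if i = 0 \<and> level m = n then of_real ((2 ^ n) powr (- 1 / p)) else 0)"

definition avg_fun :: "nat \<Rightarrow> (nat \<Rightarrow> nat \<Rightarrow> 'k) \<Rightarrow> 'k" where
  "avg_fun n v = of_real ((2 ^ n) powr (1 / p)) * average n v"

lemma single_coordinate_B:
  assumes "\<And>m i. i \<noteq> 0 \<Longrightarrow> w m i = 0" "s \<ge> 0"
    and "\<And>F. finite F \<Longrightarrow> (\<Sum>m\<in>F. norm (w m 0) powr p) \<le> s powr p"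
  shows "w \<in> B" and "N w \<le> s"
proof -
  have "\<nu> m (w m) = norm (w m 0)" for m by (rule l_norm_single[OF r]) (use assms(1) in auto)
  then show "w \<in> B" "N w \<le> s" using B_I[of w s] assms by auto
qed

lemma avg_part_B:
  assumes "v \<in> B"
  shows "avg_part v \<in> B" and "N (avg_part v) \<le> 2 * N v"
  using single_coordinate_B[of "avg_part v" "2 * N v"] sum_average_le[OF assms] N_nonneg[of v]
  by (auto simp: avg_part_def)

lemma avg_partial_le:
  assumes "v \<in> B"
  shows "N (avg_partial M v) \<le> 2 * N v"
proof (rule single_coordinate_B(2))
  fix F :: "nat set" assume F: "finite F"
  have "(\<Sum>m\<in>F. norm (avg_partial M v m 0) powr p) \<le> (\<Sum>m\<in>F. norm (average (level m) v) powr p)"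
    using p by (intro sum_mono) (auto simp: avg_partial_def)
  also have "\<dots> \<le> (2 * N v) powr p" by (rule sum_average_le[OF assms F])
  finally show "(\<Sum>m\<in>F. norm (avg_partial M v m 0) powr p) \<le> (2 * N v) powr p" .
qed (auto simp: avg_partial_def N_nonneg)

lemma avg_vec_B: "avg_vec n \<in> B" and avg_vec_le: "N (avg_vec n) \<le> 2" and avg_vec_ge: "1 \<le> N (avg_vec n)"
proof -
  have e: "norm (of_real ((2 ^ n) powr (- 1 / p)) :: 'k) powr p = inverse (2 ^ n)"
  proof -
    have "norm (of_real ((2 ^ n) powr (- 1 / p)) :: 'k) = (2 ^ n) powr (- 1 / p)" by (simp only: norm_of_real abs_of_nonneg powr_ge_zero)
    moreover have "- 1 / p * p = - 1" using p by simp
    ultimately show ?thesis by (simp only: powr_powr powr_minus powr_one) simp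
  qed
  have bn: "(\<Sum>m\<in>block n. norm (avg_vec n m 0) powr p) = 1"
  proof -
    have "(\<Sum>m\<in>block n. norm (avg_vec n m 0) powr p) = (\<Sum>m\<in>block n. inverse (2 ^ n))"
      by (rule sum.cong) (simp_all only: avg_vec_def mem_block_iff e simp_thms if_True)
    then show ?thesis by (simp add: card_block)
  qed
  have *: "(\<Sum>m\<in>F. norm (avg_vec n m 0) powr p) \<le> 1 powr p" if "finite F" for F
  proof -
    have "(\<Sum>m\<in>F. norm (avg_vec n m 0) powr p) = (\<Sum>m\<in>F \<inter> block n. norm (avg_vec n m 0) powr p)"
      by (rule sum.mono_neutral_right) (use that p in \<open>auto simp: avg_vec_def mem_block_iff\<close>)
    also have "\<dots> \<le> (\<Sum>m\<in>block n. norm (avg_vec n m 0) powr p)"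
      by (intro sum_mono2 finite_block) auto
    finally show ?thesis unfolding bn by simp
  qed
  have s: "avg_vec n m i = 0" if "i \<noteq> 0" for m i using that by (simp add: avg_vec_def)
  show B: "avg_vec n \<in> B" and "N (avg_vec n) \<le> 2"
    using single_coordinate_B[of "avg_vec n", OF s _ *] by auto
  have "(\<Sum>m\<in>block n. \<nu> m (avg_vec n m) powr p) = 1"
    using bn l_norm_single[OF r, of "avg_vec n _"] s by simp
  then have "1 \<le> N (avg_vec n) powr p" using sum_le_N[OF B finite_block, of n] by simp
  then show "1 \<le> N (avg_vec n)"
    using p powr_less_mono2[of p "N (avg_vec n)" 1] N_nonneg[of "avg_vec n"] by force
qed

lemma avg_fun_vec: "avg_fun n (avg_vec l) = (if n = l then 1 else 0)"
proof -
  have "average n (avg_vec l) = (if n = l then of_real ((2 ^ n) powr (- 1 / p)) else 0)"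
    by (rule average_const) (simp add: avg_vec_def mem_block_iff)
  then show ?thesis by (simp add: avg_fun_def powr_minus flip: of_real_mult)
qed

lemma avg_partial_Suc: "avg_partial (Suc M) v = (\<lambda>n i. avg_partial M v n i + avg_fun M v * avg_vec M n i)"
proof (intro ext)
  fix n i
  have "(of_real ((2 ^ M) powr (1 / p)) * of_real ((2 ^ M) powr (- 1 / p)) :: 'k) = 1"
    by (simp add: powr_minus flip: of_real_mult)
  then have "avg_fun M v * of_real ((2 ^ M) powr (- 1 / p)) = average M v"
    by (simp add: avg_fun_def mult.commute mult.left_commute)
  then show "avg_partial (Suc M) v n i = avg_partial M v n i + avg_fun M v * avg_vec M n i"
    by (auto simp: avg_partial_def avg_vec_def less_Suc_eq)
qed

text \<open>A cut at \<open>2 ^ M - 1\<close> falls between two blocks, hence commutes with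
  averaging, and the error is the averaged tail.\<close>

lemma avg_part_diff_le:
  assumes "v \<in> B"
  shows "N (\<lambda>n i. avg_part v n i - avg_partial M v n i) \<le> 2 * N (tail (2 ^ M - 1) v)"
proof -
  have "(\<lambda>n i. avg_part v n i - avg_partial M v n i) = avg_part (tail (2 ^ M - 1) v)"
  proof (intro ext)
    fix n i
    have "average (level n) (tail (2 ^ M - 1) v) = (if level n < M then 0 else average (level n) v)"
    proof (cases "level n < M")
      case True
      then have "average (level n) (tail (2 ^ M - 1) v) = 0"
        by (intro average_const) (auto simp: tail_def mem_block_iff less_exp_minus_1_iff)
      then show ?thesis using True by simp
    next
      case False
      then show ?thesis unfolding average_def
        by (auto simp: tail_def mem_block_iff less_exp_minus_1_iff intro!: sum.cong)
    qed
    then show "avg_part v n i - avg_partial M v n i = avg_part (tail (2 ^ M - 1) v) n i"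
      by (simp add: avg_part_def avg_partial_def)
  qed
  then show ?thesis using avg_part_B(2)[OF tail_B[OF assms]] by simp
qed

section \<open>Fluctuations around the block averages\<close>

definition fluct :: "(nat \<Rightarrow> nat \<Rightarrow> 'k) \<Rightarrow> nat \<Rightarrow> nat \<Rightarrow> 'k" where
  "fluct v m i = (if i = 0 then v m 0 - average (level m) v else 0)"

definition fluct_vec :: "nat \<Rightarrow> nat \<Rightarrow> nat \<Rightarrow> 'k" where
  "fluct_vec l m i = (if i = 0 then (if m = l then 1 else 0) - (if m \<in> block (level l) then 1 / 2 ^ level l else 0) else 0)"

text \<open>A finitely supported element of \<open>\<ell>\<^sub>p\<close>. Since
  \<open>fluct\<close> maps it to the combination of the \<open>fluct_vec m\<close> with
  coefficients \<open>b m\<close>, the norm of the latter is bounded by projecting.\<close>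

definition line :: "nat set \<Rightarrow> (nat \<Rightarrow> 'k) \<Rightarrow> nat \<Rightarrow> nat \<Rightarrow> 'k" where
  "line F b m i = (if i = 0 \<and> m \<in> F then b m else 0)"

lemma sum_fluct: "(\<Sum>m\<in>block n. fluct v m 0) = 0"
proof -
  have "(\<Sum>m\<in>block n. fluct v m 0) = (\<Sum>m\<in>block n. v m 0 - average n v)"
    by (rule sum.cong) (auto simp: fluct_def mem_block_iff)
  then show ?thesis by (simp add: sum_subtractf card_block average_def)
qed

lemma average_line_insert:
  assumes "finite F" "l \<notin> F"
  shows "average n (line (insert l F) b) = average n (line F b) + (if level l = n then b l / 2 ^ n else 0)"
proof -
  have "(\<Sum>m\<in>block n. line (insert l F) b m 0) = (\<Sum>m\<in>block n. line F b m 0 + (if m = l then b l else 0))"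
    by (rule sum.cong) (use assms in \<open>auto simp: line_def\<close>)
  also have "\<dots> = (\<Sum>m\<in>block n. line F b m 0) + (if level l = n then b l else 0)"
    by (simp add: sum.distrib sum.delta finite_block mem_block_iff)
  finally show ?thesis by (simp add: average_def add_divide_distrib)
qed

lemma fluct_line_insert:
  assumes "finite F" "l \<notin> F"
  shows "fluct (line (insert l F) b) = (\<lambda>m i. fluct (line F b) m i + b l * fluct_vec l m i)"
  using assms by (intro ext) (auto simp: fluct_def fluct_vec_def average_line_insert line_def mem_block_iff right_diff_distrib)

lemma line_B:
  assumes "finite F"
  shows "line F b \<in> B" and "N (line F b) \<le> (\<Sum>m\<in>F. norm (b m) powr p) powr (1 / p)"
proof -
  have z: "line F b m i = 0" if "i \<noteq> 0" for m i using that by (simp add: line_def)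
  have "(\<Sum>m\<in>G. norm (line F b m 0) powr p) \<le> ((\<Sum>m\<in>F. norm (b m) powr p) powr (1 / p)) powr p" if "finite G" for G
  proof -
    have "(\<Sum>m\<in>G. norm (line F b m 0) powr p) = (\<Sum>m\<in>G \<inter> F. norm (line F b m 0) powr p)"
      by (rule sum.mono_neutral_right) (use that p in \<open>auto simp: line_def\<close>)
    also have "\<dots> = (\<Sum>m\<in>G \<inter> F. norm (b m) powr p)" by (rule sum.cong) (auto simp: line_def)
    also have "\<dots> \<le> (\<Sum>m\<in>F. norm (b m) powr p)" using assms by (intro sum_mono2) auto
    finally show ?thesis using p by (simp add: powr_powr sum_nonneg)
  qed
  note * = single_coordinate_B[of "line F b", OF z _ this]
  from * show "line F b \<in> B" "N (line F b) \<le> (\<Sum>m\<in>F. norm (b m) powr p) powr (1 / p)"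
    by auto
qed

definition zero_part :: "(nat \<Rightarrow> nat \<Rightarrow> 'k) \<Rightarrow> nat \<Rightarrow> nat \<Rightarrow> 'k" where
  "zero_part v m i = (if i = 0 then v m 0 else 0)"

lemma zero_part_B:
  assumes "v \<in> B"
  shows "zero_part v \<in> B" and "N (zero_part v) \<le> 1 * N v"
proof -
  have 1: "zero_part v n i = 0" if "n < i" for n i using that by (simp add: zero_part_def)
  have 2: "\<nu> n (zero_part v n) \<le> 1 * \<nu> n (v n)" for n
    unfolding mult_1 by (rule l_norm_mono[OF r]) (simp add: zero_part_def)
  show "zero_part v \<in> B" "N (zero_part v) \<le> 1 * N v" using B_dominated_id[OF assms _ 1 2] by auto
qed

lemma fluct_eq: "fluct v = (\<lambda>m i. zero_part v m i - avg_part v m i)"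
  by (intro ext) (simp add: fluct_def zero_part_def avg_part_def)

lemma fluct_B: "v \<in> B \<Longrightarrow> fluct v \<in> B"
  unfolding fluct_eq by (intro B_diff zero_part_B avg_part_B)

lemma fluct_vec_B: "fluct_vec l \<in> B"
proof -
  have "fluct (line {l} (\<lambda>_. 1)) = fluct_vec l"
    using fluct_line_insert[of "{}" l "\<lambda>_. 1"]
    by (auto simp: fluct_def line_def average_def fun_eq_iff)
  then show ?thesis using fluct_B[OF line_B(1)[of "{l}" "\<lambda>_. 1"]] by simp
qed

text \<open>The restriction of a mean-zero family to whole blocks still has mean zero, so
  \<open>fluct\<close> leaves it unchanged. This identifies the partial sums of the expansion in
  \<open>h\<close>.\<close>

lemma fluct_line_lessThan:
  "fluct (line {..<2 ^ M - 1} (\<lambda>m. fluct v m 0)) m i = (if level m < M then fluct v m i else 0)"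
proof -
  have "average (level m) (line {..<2 ^ M - 1} (\<lambda>m. fluct v m 0)) = 0"
  proof (cases "level m < M")
    case True
    then have "(\<Sum>l\<in>block (level m). line {..<2 ^ M - 1} (\<lambda>m. fluct v m 0) l 0) = (\<Sum>l\<in>block (level m). fluct v l 0)"
      by (intro sum.cong) (auto simp: line_def mem_block_iff less_exp_minus_1_iff)
    then show ?thesis by (simp add: average_def sum_fluct)
  next
    case False
    then show ?thesis
      by (intro average_const) (auto simp: line_def mem_block_iff less_exp_minus_1_iff)
  qed
  then show ?thesis by (auto simp: fluct_def[of "line _ _"] line_def less_exp_minus_1_iff) (auto simp: fluct_def)
qed

lemma sum_fluct_vec: "(\<Sum>l\<in>block n. fluct_vec l m i) = 0"
proof (cases "i = 0")
  case True
  have "(\<Sum>l\<in>block n. fluct_vec l m i)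
    = (\<Sum>l\<in>block n. (if l = m then 1 else 0) - (if m \<in> block n then 1 / 2 ^ n else 0))"
    by (rule sum.cong) (auto simp: fluct_vec_def True mem_block_iff)
  also have "\<dots> = 0" by (simp add: sum_subtractf finite_block card_block)
  finally show ?thesis .
qed (simp add: fluct_vec_def)

lemma average_fluct_vec: "average n (fluct_vec l) = 0"
proof -
  have "(\<Sum>m\<in>block n. fluct_vec l m 0)
    = (\<Sum>m\<in>block n. (if m = l then 1 else 0) - (if n = level l then 1 / 2 ^ n else 0))"
    by (rule sum.cong) (auto simp: fluct_vec_def mem_block_iff)
  also have "\<dots> = 0" by (simp add: sum_subtractf finite_block card_block mem_block_iff)
  finally show ?thesis by (simp add: average_def)
qed

end

subsection \<open>Assembling the basis\<close>

text \<open>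
  A basis \<open>\<sigma>\<close> of the coordinates in \<open>cond_coord\<close> with coordinate functionals \<open>\<phi>\<close> and partial sum
  projections \<open>q\<close>, which is as conditional as possible.
\<close>

locale conditional_system = B_space_setup r p type
  for r p and type :: "'k::real_normed_field itself" +
  fixes \<sigma> :: "nat \<Rightarrow> nat \<Rightarrow> nat \<Rightarrow> 'k" and \<phi> :: "nat \<Rightarrow> (nat \<Rightarrow> nat \<Rightarrow> 'k) \<Rightarrow> 'k"
    and q :: "nat \<Rightarrow> (nat \<Rightarrow> nat \<Rightarrow> 'k) \<Rightarrow> nat \<Rightarrow> nat \<Rightarrow> 'k" and C c :: real
  assumes c: "c > 0"
    and \<sigma>_B: "\<And>g. \<sigma> g \<in> B" and \<sigma>_out: "\<And>g m i. \<not> cond_coord m i \<Longrightarrow> \<sigma> g m i = 0"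
    and \<sigma>_le: "\<And>g. N (\<sigma> g) \<le> C" and \<sigma>_ge: "\<And>g. 1 \<le> C * N (\<sigma> g)"
    and \<phi>_add: "\<And>g u v. \<phi> g (\<lambda>n i. u n i + v n i) = \<phi> g u + \<phi> g v"
    and \<phi>_scale: "\<And>g c v. \<phi> g (\<lambda>n i. c * v n i) = c * \<phi> g v"
    and \<phi>_\<sigma>: "\<And>g l. \<phi> g (\<sigma> l) = (if g = l then 1 else 0)"
    and \<phi>_out: "\<And>g v. (\<And>m i. cond_coord m i \<Longrightarrow> v m i = 0) \<Longrightarrow> \<phi> g v = 0"
    and q_0: "\<And>v. q 0 v = (\<lambda>n i. 0)"
    and q_Suc: "\<And>M v. v \<in> B \<Longrightarrow> q (Suc M) v = (\<lambda>n i. q M v n i + \<phi> M v * \<sigma> M n i)"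
    and q_le: "\<And>M v. v \<in> B \<Longrightarrow> N (q M v) \<le> C * N v"
    and q_diff_le: "\<And>M v. v \<in> B \<Longrightarrow>
      N (\<lambda>n i. (if cond_coord n i then v n i else 0) - q M v n i) \<le> C * N (tail M v)"
    and conditional: "\<And>k. \<exists>v D. v \<in> B \<and> v \<noteq> (\<lambda>n i. 0) \<and> N v \<le> 1 \<and> q (2 ^ k) v = v \<and> D \<subseteq> {..<2 ^ k} \<and>
      c * 2 ^ k \<le> N (\<lambda>n i. \<Sum>g\<in>D. \<phi> g v * \<sigma> g n i)"
begin

definition cond_part :: "(nat \<Rightarrow> nat \<Rightarrow> 'k) \<Rightarrow> nat \<Rightarrow> nat \<Rightarrow> 'k" where
  "cond_part v m i = (if cond_coord m i then v m i else 0)"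

lemma cond_part_B:
  assumes "v \<in> B"
  shows "cond_part v \<in> B"
  by (rule B_dominated_id(1)[OF assms, of 1])
     (use assms in \<open>simp_all add: cond_part_def B_zero_above l_norm_mono[OF r]\<close>)

end

text \<open>Only every fourth place belongs to \<open>y\<close>, so \<open>M\<close> conditional
  vectors require length \<open>4 * M\<close>; this is the origin of the factor 4 in
  \<open>w_cond_const_approx\<close>.\<close>

lemma sum_interleave_middle:
  fixes u :: "nat \<Rightarrow> 'a::banach" and smul :: "'k::real_or_complex \<Rightarrow> 'a \<Rightarrow> 'a"
  assumes "banach_space_over smul"
  shows "(\<Sum>i<4 * M. smul (banach_space_over.interleave (\<lambda>_. 0) (banach_space_over.interleave b (\<lambda>_. 0)) i)
      (banach_space_over.interleave x (banach_space_over.interleave y z) i)) = (\<Sum>g<M. smul (b g) (y g))"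
proof -
  interpret banach_space_over smul by (rule assms)
  have il: "smul (interleave a b i) (interleave u w i) = interleave (\<lambda>i. smul (a i) (u i)) (\<lambda>i. smul (b i) (w i)) i"
    for a b u w i by (simp add: interleave_def)
  have "4 * M div 2 = 2 * M" "(2 * M + 1) div 2 = M" by auto
  then show ?thesis by (simp only: il sum_interleave) simp
qed

locale conditional_embedding = B_embedding smul r p T P ca cb + conditional_system r p "TYPE('k)" \<sigma> \<phi> q C c
  for smul :: "'k::real_or_complex \<Rightarrow> 'a::banach \<Rightarrow> 'a" and r p T P ca cb \<sigma> \<phi> q C c
begin

text \<open>The identity on the kernel of \<open>P\<close> and \<open>shift\<close> on the copy of
  \<open>B\<close>: an isomorphism of the whole space onto the part that avoids coordinate 0 and the
  coordinates in \<open>cond_coord\<close>. It carries the given basis there.\<close>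

definition U :: "'a \<Rightarrow> 'a" where "U f = (f - P f) + T (shift (R f))"

definition V :: "'a \<Rightarrow> 'a" where "V f = (f - P f) + T (unshift (R f))"

lemma R_U: "R (U f) = shift (R f)"
  by (simp add: U_def R_add R_complement R_T shift_B R_B)

lemma R_V: "R (V f) = unshift (R f)"
  by (simp add: V_def R_add R_complement R_T unshift_B R_B)

lemma P_U: "P (U f) = T (shift (R f))" and P_V: "P (V f) = T (unshift (R f))"
  by (simp_all add: R_U R_V flip: T_R)

lemma V_U: "V (U f) = f"
  by (simp add: V_def[of "U f"] P_U R_U unshift_shift R_B) (simp add: U_def T_R)

lemma U_V: "U (V f) = (f - P f) + T (shift (unshift (R f)))"
  by (simp add: U_def[of "V f"] P_V R_V) (simp add: V_def)

lemma V_T: "w \<in> B \<Longrightarrow> V (T w) = T (unshift w)"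
  by (simp add: V_def P_T R_T)

lemma U_linear: "bounded_linear U" "U (smul s f) = smul s (U f)"
  and V_linear: "bounded_linear V" "V (smul s f) = smul s (V f)"
proof -
  have sh: "bounded_linear (\<lambda>f. T (shift (R f)))" "\<And>c f. T (shift (R (smul c f))) = smul c (T (shift (R f)))"
    by (rule lift_bounded_linear[of shift 1]; use shift_B in \<open>auto simp: shift_def fun_eq_iff\<close>)+
  have un: "bounded_linear (\<lambda>f. T (unshift (R f)))" "\<And>c f. T (unshift (R (smul c f))) = smul c (T (unshift (R f)))"
    by (rule lift_bounded_linear[of unshift 1]; use unshift_B in \<open>auto simp: unshift_def fun_eq_iff\<close>)+
  show "bounded_linear U" "bounded_linear V" unfolding U_def V_def
    by (intro bounded_linear_add bounded_linear_sub bounded_linear_ident P sh un)+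
  show "U (smul s f) = smul s (U f)" "V (smul s f) = smul s (V f)"
    by (simp_all add: U_def V_def sh un P_scale scale_right_distrib scale_right_diff_distrib)
qed

lemma fluct_le:
  assumes "v \<in> B"
  shows "N (fluct v) \<le> 3 * cb / ca * N v"
proof -
  have "N (fluct v) \<le> cb / ca * (N (zero_part v) + N (avg_part v))"
    unfolding fluct_eq by (intro N_diff zero_part_B avg_part_B assms)
  also have "\<dots> \<le> cb / ca * (1 * N v + 2 * N v)"
    using ca cb by (intro mult_left_mono add_mono zero_part_B avg_part_B assms) auto
  finally show ?thesis by (simp add: mult_ac)
qed

lemma sum_fluct_vec_T:
  assumes "finite F"
  shows "(\<Sum>m\<in>F. smul (b m) (T (fluct_vec m))) = T (fluct (line F b))"
  using assms
proof (induction F rule: finite_induct)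
  case empty
  have "fluct (line {} b) = (\<lambda>n i. 0)" by (auto simp: fluct_def line_def average_def fun_eq_iff)
  then show ?case by (simp add: T_zero)
next
  case (insert l F)
  have "T (fluct (line (insert l F) b)) = T (fluct (line F b)) + smul (b l) (T (fluct_vec l))"
    unfolding fluct_line_insert[OF insert(1,2)]
    by (simp add: T_add T_scale fluct_B line_B insert(1) B_scale fluct_vec_B)
  then show ?case using insert by (simp add: add.commute)
qed

text \<open>Each coordinate is retained by \<open>shift\<close>, or lies in
  \<open>cond_coord\<close>, or has position 0, where the value splits into average and
  fluctuation.\<close>

lemma R_decompose: "R f n i = shift (unshift (R f)) n i + (cond_part (R f) n i + avg_part (R f) n i) + fluct (R f) n i"
proof -
  consider "i = 0" | "i \<noteq> 0" "i \<le> halve_pow2 n" | "cond_coord n i" | "i > n" using cond_coord_iff[of n i] by linarith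
  then show ?thesis
  proof cases
    case 4
    then show ?thesis using B_zero_above[OF R_B, of n i f] halve_pow2_le[of n]
      by (auto simp: shift_unshift cond_part_def avg_part_def fluct_def cond_coord_iff)
  qed (auto simp: shift_unshift cond_part_def avg_part_def fluct_def cond_coord_iff)
qed

theorem exists_quasi_greedy:
  assumes "schauder_basis smul x"
  shows "\<exists>w. quasi_greedy smul w \<and> approx_on {2..} (w_cond_const smul w) (\<lambda>m. ln (real m))"
proof -
  obtain x' a K0 where x': "partial_basis x' a (\<lambda>f. f) K0"
    using schauder_basis_partial_basis[OF assms] by blast
  obtain K1 where pE: "partial_basis (\<lambda>n. U (x' n)) (\<lambda>n f. a n (V f)) (\<lambda>f. U (V f)) K1"
    using partial_basis_embed[OF x' U_linear V_linear V_U] by blast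
  have G: "cond_part v \<in> B" "N (\<lambda>n i. cond_part v n i - q M v n i) \<le> C * N (tail M v)" if "v \<in> B" for v M
    using cond_part_B[OF that] q_diff_le[OF that, of M] by (simp_all add: cond_part_def)
  obtain K2 where pG: "partial_basis (\<lambda>g. T (\<sigma> g)) (\<lambda>g f. \<phi> g (R f)) (\<lambda>f. T (cond_part (R f))) K2"
    using partial_basis_lift(1)[OF \<sigma>_B \<sigma>_le \<sigma>_ge \<phi>_add \<phi>_scale \<phi>_\<sigma> q_0 q_Suc q_le G filterlim_ident] by blast
  have sum_G: "(\<Sum>g<M. smul (\<phi> g v) (T (\<sigma> g))) = T (q M v)" if "v \<in> B" for M v
    using partial_basis_lift(2)[OF \<sigma>_B \<sigma>_le \<sigma>_ge \<phi>_add \<phi>_scale \<phi>_\<sigma> q_0 q_Suc q_le G filterlim_ident that] .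
  have pw: "filterlim (\<lambda>M::nat. 2 ^ M - 1 :: nat) at_top at_top"
    unfolding filterlim_at_top eventually_sequentially
    by (metis One_nat_def Suc_leI diff_le_mono diff_Suc_1 less_exp less_le_trans less_or_eq_imp_le)
  have "\<exists>K. partial_basis (\<lambda>g. T (avg_vec g)) (\<lambda>g f. avg_fun g (R f)) (\<lambda>f. T (avg_part (R f))) K"
  proof (rule partial_basis_lift(1)[where q = avg_partial and C = 2 and t = "\<lambda>M. 2 ^ M - 1"])
    show "1 \<le> 2 * N (avg_vec g)" for g using avg_vec_ge[of g] by simp
    show "avg_partial 0 v = (\<lambda>n i. 0)" for v by (simp add: avg_partial_def fun_eq_iff)
    show "avg_fun g (\<lambda>n i. u n i + v n i) = avg_fun g u + avg_fun g v"
      "avg_fun g (\<lambda>n i. s * v n i) = s * avg_fun g v" for g u v s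
      by (simp_all add: avg_fun_def average_add average_scale distrib_left)
  qed (assumption | rule avg_vec_B avg_vec_le avg_fun_vec avg_partial_Suc avg_partial_le avg_part_B
      avg_part_diff_le pw)+
  then obtain K3 where pS: "partial_basis (\<lambda>g. T (avg_vec g)) (\<lambda>g f. avg_fun g (R f)) (\<lambda>f. T (avg_part (R f))) K3" ..
  have aE: "a n 0 = 0" for n
  proof -
    have "a n (0 + 0) = a n 0 + a n 0" using x' unfolding partial_basis_def by blast
    then show ?thesis by simp
  qed
  have avg0: "average n v = 0" if "\<And>m. v m 0 = 0" for n v using that by (simp add: average_def)
  have V0: "V (T w) = 0" if "w \<in> B" "\<And>m i. 1 \<le> i \<Longrightarrow> i \<le> halve_pow2 m \<Longrightarrow> w m i = 0" for w
    using that by (simp add: V_T unshift_eq_0 T_zero)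
  have V_\<sigma>: "V (T (\<sigma> g)) = 0" for g by (rule V0[OF \<sigma>_B]) (auto intro: \<sigma>_out simp: cond_coord_iff)
  have V_avg: "V (T (avg_vec g)) = 0" for g by (rule V0[OF avg_vec_B]) (auto simp: avg_vec_def)
  have V_fluct: "V (T (fluct_vec g)) = 0" for g by (rule V0[OF fluct_vec_B]) (auto simp: fluct_vec_def)
  have \<sigma>_0: "\<sigma> g m 0 = 0" for g m by (rule \<sigma>_out) (simp add: cond_coord_iff)
  have shift_0: "shift v m 0 = 0" for v m by (simp add: shift_def)
  \<comment> \<open>Even places carry the transported basis, places \<open>4 * g + 1\<close> the
    conditional vectors, and places \<open>4 * g + 3\<close> the block averages.\<close>
  define u where "u = interleave (\<lambda>n. U (x' n)) (interleave (\<lambda>g. T (\<sigma> g)) (\<lambda>g. T (avg_vec g)))"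
  define \<alpha> where "\<alpha> = interleave (\<lambda>n f. a n (V f)) (interleave (\<lambda>g f. \<phi> g (R f)) (\<lambda>g f. avg_fun g (R f)))"
  define Q where "Q f = U (V f) + (T (cond_part (R f)) + T (avg_part (R f)))" for f
  have pb: "partial_basis u \<alpha> Q (K1 + (K2 + K3))"
    unfolding u_def \<alpha>_def Q_def
  proof (intro partial_basis_interleave pE pG pS)
    show "\<phi> n (R (T (avg_vec m))) = 0" for n m
      unfolding R_T[OF avg_vec_B] by (rule \<phi>_out) (simp add: avg_vec_def cond_coord_iff)
    show "avg_fun n (R (T (\<sigma> m))) = 0" for n m
      by (simp add: R_T \<sigma>_B avg_fun_def avg0 \<sigma>_0)
    show "a n (V (interleave (\<lambda>g. T (\<sigma> g)) (\<lambda>g. T (avg_vec g)) m)) = 0" for n m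
      by (simp add: interleave_def V_\<sigma> V_avg aE)
    have "\<phi> n (R (U f)) = 0" for n f
      unfolding R_U by (rule \<phi>_out) (simp add: shift_def cond_coord_iff)
    then show "interleave (\<lambda>g f. \<phi> g (R f)) (\<lambda>g f. avg_fun g (R f)) n (U (x' m)) = 0" for n m
      by (simp add: interleave_def R_U avg_fun_def avg0 shift_0)
  qed
  define \<beta> where "\<beta> m f = fluct (R f) m 0" for m f
  define h where "h m = T (fluct_vec m)" for m
  have R_fluct: "R (h m) = fluct_vec m" for m by (simp add: h_def R_T fluct_vec_B)
  have sum_h: "(\<Sum>m<2 ^ n - 1. smul (\<beta> m f) (h m)) = T (\<lambda>m i. if level m < n then fluct (R f) m i else 0)" for n f
    unfolding h_def \<beta>_def sum_fluct_vec_T[OF finite_lessThan] fluct_line_lessThan[abs_def] ..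
  obtain cR where cR: "cR > 0" "\<And>f. N (R f) \<le> cR * norm f" using N_R by blast
  have K123: "K1 + (K2 + K3) \<ge> 0" using pb by (simp add: partial_basis_def)
  \<comment> \<open>One constant must serve all hypotheses of \<open>dkk_system\<close>. The square
    comes from \<open>partial_basis_coefficient_le\<close>, the last two terms bound the functionals
    \<open>\<beta>\<close> and the combinations of the \<open>h m\<close>.\<close>
  define K where "K = 1 + (K1 + (K2 + K3)) + 2 * (K1 + (K2 + K3))\<^sup>2 + 3 * cb / ca * cR + cb * (3 * cb / ca)"
  have K: "1 \<le> K" "K1 + (K2 + K3) \<le> K" "2 * (K1 + (K2 + K3))\<^sup>2 \<le> K" "3 * cb / ca * cR \<le> K" "cb * (3 * cb / ca) \<le> K"
  proof -
    have "2 * (K1 + (K2 + K3))\<^sup>2 \<ge> 0" "3 * cb / ca * cR \<ge> 0" "cb * (3 * cb / ca) \<ge> 0"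
      using ca cb cR by auto
    with K123 show "1 \<le> K" "K1 + (K2 + K3) \<le> K" "2 * (K1 + (K2 + K3))\<^sup>2 \<le> K"
      "3 * cb / ca * cR \<le> K" "cb * (3 * cb / ca) \<le> K"
      unfolding K_def by linarith+
  qed
  have fluct_R: "N (fluct (R f)) \<le> K * norm f" for f
  proof -
    have "N (fluct (R f)) \<le> 3 * cb / ca * (cR * norm f)"
      using ca cb by (intro order_trans[OF fluct_le[OF R_B]] mult_left_mono cR) auto
    also have "\<dots> = (3 * cb / ca * cR) * norm f" by simp
    also have "\<dots> \<le> K * norm f" using K by (intro mult_right_mono) auto
    finally show ?thesis .
  qed
  interpret dkk: dkk_system smul p K u h \<alpha> \<beta>
  proof unfold_locales
    show "1 < p" by (rule p)
    show "1 \<le> K" by (rule K)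
    show "\<alpha> n (f + g) = \<alpha> n f + \<alpha> n g" "\<alpha> n (smul c f) = c * \<alpha> n f"
      "\<alpha> n (u l) = (if n = l then 1 else 0)" for n f g c l
      using pb by (auto simp: partial_basis_def)
    show "\<beta> n (f + g) = \<beta> n f + \<beta> n g" "\<beta> n (smul c f) = c * \<beta> n f" for n f g c
      by (simp_all add: \<beta>_def R_add R_scale fluct_def average_add average_scale algebra_simps)
    show "\<alpha> n (h m) = 0" for n m
    proof -
      have "\<phi> g (fluct_vec m) = 0" for g by (rule \<phi>_out) (simp add: fluct_vec_def cond_coord_iff)
      then show ?thesis
        by (simp add: \<alpha>_def interleave_def R_fluct avg_fun_def average_fluct_vec) (simp add: h_def V_fluct aE)
    qed
    show "\<beta> m (u n) = 0" for m n
    proof -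
      have "fluct (avg_vec g) m 0 = 0" for g
      proof -
        have "average (level m) (avg_vec g) = avg_vec g m 0"
          by (rule average_const) (simp add: avg_vec_def mem_block_iff)
        then show ?thesis by (simp add: fluct_def)
      qed
      then show ?thesis
        by (simp add: \<beta>_def u_def interleave_def R_U R_T \<sigma>_B avg_vec_B) (simp add: fluct_def avg0 shift_0 \<sigma>_0)
    qed
    show "\<beta> m (h l) = (if m = l then 1 else 0) - (if level m = level l then 1 / 2 ^ level m else 0)" for m l
      by (auto simp: \<beta>_def R_fluct fluct_def average_fluct_vec fluct_vec_def mem_block_iff)
    show "(\<Sum>m\<in>block n. h m) = 0" for n
      unfolding h_def T_sum(2)[of "block n" fluct_vec, OF fluct_vec_B, symmetric] by (simp add: sum_fluct_vec T_zero)
    show "(\<Sum>m\<in>block n. \<beta> m f) = 0" for n f unfolding \<beta>_def by (rule sum_fluct)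
    show "norm (u n) \<le> K" for n using pb K unfolding partial_basis_def by (meson order_trans)
    show "norm (\<Sum>i<n. smul (\<alpha> i f) (u i)) \<le> K * norm f" for n f
    proof -
      have "norm (\<Sum>i<n. smul (\<alpha> i f) (u i)) \<le> (K1 + (K2 + K3)) * norm f"
        using pb by (simp add: partial_basis_def)
      also have "\<dots> \<le> K * norm f" using K by (intro mult_right_mono) auto
      finally show ?thesis .
    qed
    show "norm (\<alpha> n f) \<le> K * norm f" for n f
      by (rule order_trans[OF partial_basis_coefficient_le[OF pb] mult_right_mono[OF K(3) norm_ge_zero]])
    show "(\<Sum>m\<in>F. norm (\<beta> m f) powr p) \<le> (K * norm f) powr p" if "finite F" for F f
    proof -
      have "(\<Sum>m\<in>F. norm (\<beta> m f) powr p) \<le> (\<Sum>m\<in>F. \<nu> m (fluct (R f) m) powr p)"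
        unfolding \<beta>_def using p by (intro sum_mono powr_mono2 norm_le_l_norm r) auto
      also have "\<dots> \<le> N (fluct (R f)) powr p" by (rule sum_le_N[OF fluct_B[OF R_B] that])
      also have "\<dots> \<le> (K * norm f) powr p" using p fluct_R N_nonneg by (intro powr_mono2) auto
      finally show ?thesis .
    qed
    show "norm (\<Sum>m\<in>F. smul (b m) (h m)) \<le> K * (\<Sum>m\<in>F. norm (b m) powr p) powr (1 / p)" if F: "finite F" for F b
    proof -
      have "norm (\<Sum>m\<in>F. smul (b m) (h m)) \<le> cb * (3 * cb / ca * N (line F b))"
        unfolding h_def sum_fluct_vec_T[OF F] using cb
        by (intro order_trans[OF T_le] mult_left_mono fluct_B fluct_le line_B F) auto
      also have "\<dots> = (cb * (3 * cb / ca)) * N (line F b)" by simp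
      also have "\<dots> \<le> K * (\<Sum>m\<in>F. norm (b m) powr p) powr (1 / p)"
        using K by (intro mult_mono line_B F N_nonneg) auto
      finally show ?thesis .
    qed
    show "(\<lambda>n. (\<Sum>i<n. smul (\<alpha> i f) (u i)) + (\<Sum>m<2 ^ n - 1. smul (\<beta> m f) (h m))) \<longlonglongrightarrow> f" for f
    proof -
      have 1: "(\<lambda>n. \<Sum>i<n. smul (\<alpha> i f) (u i)) \<longlonglongrightarrow> Q f" using pb by (simp add: partial_basis_def)
      have lB: "(\<lambda>m i. if level m < n then fluct (R f) m i else 0) \<in> B" for n
        unfolding fluct_line_lessThan[symmetric, abs_def] by (intro fluct_B line_B) simp
      have 2: "(\<lambda>n. \<Sum>m<2 ^ n - 1. smul (\<beta> m f) (h m)) \<longlonglongrightarrow> T (fluct (R f))"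
      proof (rule Lim_transform2)
        show "(\<lambda>_. T (fluct (R f))) \<longlonglongrightarrow> T (fluct (R f))" by simp
        show "(\<lambda>n. T (fluct (R f)) - (\<Sum>m<2 ^ n - 1. smul (\<beta> m f) (h m))) \<longlonglongrightarrow> 0"
        proof (rule Lim_null_comparison)
          show "\<forall>\<^sub>F n in sequentially. norm (T (fluct (R f)) - (\<Sum>m<2 ^ n - 1. smul (\<beta> m f) (h m)))
              \<le> cb * N (tail (2 ^ n - 1) (fluct (R f)))"
          proof (intro always_eventually allI)
            fix n
            have "(\<lambda>m i. fluct (R f) m i - (if level m < n then fluct (R f) m i else 0)) = tail (2 ^ n - 1) (fluct (R f))"
              by (auto simp: tail_def less_exp_minus_1_iff fun_eq_iff)
            then have "T (fluct (R f)) - (\<Sum>m<2 ^ n - 1. smul (\<beta> m f) (h m)) = T (tail (2 ^ n - 1) (fluct (R f)))"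
              unfolding sum_h T_diff[OF fluct_B[OF R_B] lB, symmetric] by (simp only:)
            then show "norm (T (fluct (R f)) - (\<Sum>m<2 ^ n - 1. smul (\<beta> m f) (h m))) \<le> cb * N (tail (2 ^ n - 1) (fluct (R f)))"
              by (simp only:) (intro T_le tail_B fluct_B R_B)
          qed
          have "(\<lambda>n. cb * N (tail (2 ^ n - 1) (fluct (R f)))) \<longlonglongrightarrow> cb * 0"
            by (intro tendsto_mult tendsto_const filterlim_compose[OF tail_tendsto[OF fluct_B[OF R_B]] pw])
          then show "(\<lambda>n. cb * N (tail (2 ^ n - 1) (fluct (R f)))) \<longlonglongrightarrow> 0" by simp
        qed
      qed
      have "Q f + T (fluct (R f)) = (f - P f) + (T (shift (unshift (R f))) + (T (cond_part (R f)) + T (avg_part (R f))) + T (fluct (R f)))"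
        by (simp add: Q_def U_V)
      also have "T (shift (unshift (R f))) + (T (cond_part (R f)) + T (avg_part (R f))) + T (fluct (R f)) = T (R f)"
      proof -
        have B: "shift (unshift (R f)) \<in> B" "cond_part (R f) \<in> B" "avg_part (R f) \<in> B" "fluct (R f) \<in> B"
          by (intro shift_B unshift_B cond_part_B avg_part_B fluct_B R_B)+
        have "T (R f) = T (\<lambda>n i. (shift (unshift (R f)) n i + (cond_part (R f) n i + avg_part (R f) n i)) + fluct (R f) n i)"
          by (rule arg_cong[of _ _ T]) (intro ext R_decompose)
        then show ?thesis by (simp add: T_add B B_add)
      qed
      finally have "Q f + T (fluct (R f)) = f" by (simp add: T_R)
      then show ?thesis using tendsto_add[OF 1 2] by simp
    qed
  qed
  have "approx_on {2..} (w_cond_const smul dkk.v) (\<lambda>m. ln (real m))"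
  proof (rule dkk.w_cond_const_approx)
    \<comment> \<open>The witness has norm at most \<open>cb\<close> after applying
      \<open>T\<close>, its projection at least \<open>ca * (c * 2 ^ k)\<close>.\<close>
    show "ca * c / cb > 0" using ca cb c by simp
    fix k
    obtain v D where v: "v \<in> B" "v \<noteq> (\<lambda>n i. 0)" "N v \<le> 1" "q (2 ^ k) v = v" "D \<subseteq> {..<2 ^ k}"
      "c * 2 ^ k \<le> N (\<lambda>n i. \<Sum>g\<in>D. \<phi> g v * \<sigma> g n i)"
      using conditional by blast
    define b where "b = interleave (\<lambda>_. 0) (interleave (\<lambda>g. \<phi> g v) (\<lambda>_. 0))"
    define D' where "D' = {i. interleave (\<lambda>_. False) (interleave (\<lambda>g. g \<in> D) (\<lambda>_. False)) i}"
    have 1: "(\<Sum>i<4 * 2 ^ k. smul (b i) (u i)) = T v"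
      unfolding b_def u_def sum_interleave_middle[OF banach_space_over_axioms] sum_G[OF v(1)] v(4) ..
    have "(\<Sum>i\<in>{..<4 * 2 ^ k} \<inter> D'. smul (b i) (u i)) = (\<Sum>i<4 * 2 ^ k. if i \<in> D' then smul (b i) (u i) else 0)"
      by (simp add: sum.inter_restrict)
    also have "\<dots> = (\<Sum>i<4 * 2 ^ k. smul (interleave (\<lambda>_. 0) (interleave (\<lambda>g. if g \<in> D then \<phi> g v else 0) (\<lambda>_. 0)) i) (u i))"
      by (rule sum.cong) (auto simp: b_def D'_def interleave_def)
    also have "\<dots> = (\<Sum>g<2 ^ k. smul (if g \<in> D then \<phi> g v else 0) (T (\<sigma> g)))"
      unfolding u_def sum_interleave_middle[OF banach_space_over_axioms] ..
    also have "\<dots> = (\<Sum>g\<in>D. T (\<lambda>n i. \<phi> g v * \<sigma> g n i))"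
      by (rule sum.mono_neutral_cong_right) (use v(5) in \<open>auto simp: T_scale \<sigma>_B\<close>)
    also have "\<dots> = T (\<lambda>n i. \<Sum>g\<in>D. \<phi> g v * \<sigma> g n i)"
      by (rule T_sum(2)[symmetric]) (intro B_scale \<sigma>_B)
    finally have 2: "(\<Sum>i\<in>{..<4 * 2 ^ k} \<inter> D'. smul (b i) (u i)) = T (\<lambda>n i. \<Sum>g\<in>D. \<phi> g v * \<sigma> g n i)" .
    have "T v \<noteq> 0"
    proof
      assume "T v = 0"
      then have "v = (\<lambda>n i. 0)" using T_inj[OF v(1) B_zero] by (simp add: T_zero)
      then show False using v(2) by simp
    qed
    moreover have "ca * c / cb * 2 ^ k * norm (T v) \<le> norm (T (\<lambda>n i. \<Sum>g\<in>D. \<phi> g v * \<sigma> g n i))"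
    proof -
      have "norm (T v) \<le> cb * 1" using cb v by (intro order_trans[OF T_le] mult_left_mono) auto
      then have "ca * c / cb * 2 ^ k * norm (T v) \<le> ca * c / cb * 2 ^ k * (cb * 1)"
        using ca cb c by (intro mult_left_mono) auto
      also have "\<dots> = ca * (c * 2 ^ k)" using cb by simp
      also have "\<dots> \<le> ca * N (\<lambda>n i. \<Sum>g\<in>D. \<phi> g v * \<sigma> g n i)" using ca v by (intro mult_left_mono) auto
      also have "\<dots> \<le> norm (T (\<lambda>n i. \<Sum>g\<in>D. \<phi> g v * \<sigma> g n i))"
        by (intro T_ge T_sum(1) B_scale \<sigma>_B)
      finally show ?thesis .
    qed
    ultimately show "\<exists>b D. (\<Sum>i<4 * 2 ^ k. smul (b i) (u i)) \<noteq> 0 \<and>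
      ca * c / cb * 2 ^ k * norm (\<Sum>i<4 * 2 ^ k. smul (b i) (u i)) \<le> norm (\<Sum>i\<in>{..<4 * 2 ^ k} \<inter> D. smul (b i) (u i))"
      unfolding 1[symmetric] 2[symmetric] by blast
  qed
  with dkk.quasi_greedy_v show ?thesis by blast
qed

end

subsection \<open>Conditional bases of the blocks\<close>

text \<open>The unique power of two \<open>m\<close> with \<open>m div 2 \<le> g\<close> and
  \<open>g < m\<close>, that is, the block in which position \<open>Suc g\<close> lies in
  \<open>cond_coord\<close>.\<close>

definition cond_block :: "nat \<Rightarrow> nat" where "cond_block g = 2 ^ (LEAST k. g < 2 ^ k)"

lemma cond_block_bounds: "pow2 (cond_block g)" "cond_block g div 2 \<le> g" "g < cond_block g"
proof -
  define k where "k = (LEAST k. g < 2 ^ k)"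
  have "g < 2 ^ g" by (rule less_exp)
  then show "g < cond_block g" unfolding cond_block_def by (rule LeastI)
  show "pow2 (cond_block g)" by (auto simp: pow2_def cond_block_def)
  show "cond_block g div 2 \<le> g"
  proof (cases k)
    case (Suc j)
    have "\<not> g < 2 ^ j" by (rule not_less_Least) (simp add: Suc flip: k_def)
    then show ?thesis by (simp add: cond_block_def Suc flip: k_def)
  qed (simp add: cond_block_def flip: k_def)
qed

lemma pow2_unique:
  assumes "pow2 m" "pow2 m'" "m div 2 \<le> g" "g < m" "m' div 2 \<le> g" "g < m'"
  shows "m = m'"
proof -
  have *: "\<not> j < k" if "2 ^ k div 2 \<le> g" "g < 2 ^ j" for j k :: nat
  proof
    assume "j < k"
    then obtain l where "k = Suc l" "j \<le> l" by (cases k) auto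
    moreover have "(2::nat) ^ j \<le> 2 ^ l" using \<open>j \<le> l\<close> by (intro power_increasing) auto
    ultimately show False using that by (simp del: power_increasing_iff)
  qed
  obtain j k where "m = 2 ^ j" "m' = 2 ^ k" using assms by (auto simp: pow2_def)
  then show ?thesis using *[of j k] *[of k j] assms by auto
qed

lemma cond_coord_Suc_iff: "cond_coord m (Suc g) \<longleftrightarrow> m = cond_block g"
  using cond_block_bounds[of g] pow2_unique[of m "cond_block g" g] by (auto simp: cond_coord_def)

lemma cond_coord_cond_block: "m = cond_block g \<Longrightarrow> g < i \<Longrightarrow> i \<le> m \<Longrightarrow> cond_coord m i"
  using cond_block_bounds[of g] by (auto simp: cond_coord_def)

lemma cond_coord_block_eq: "cond_coord m i \<Longrightarrow> m div 2 \<le> g \<Longrightarrow> g < i \<Longrightarrow> m = cond_block g"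
  unfolding cond_coord_Suc_iff[symmetric] by (auto simp: cond_coord_def)

lemma cond_block_lower: "m = cond_block g \<Longrightarrow> m div 2 \<le> g"
  using cond_block_bounds[of g] by simp

text \<open>Starting with the first vector of the block and rounding the count up keeps at least
  \<open>m / 4\<close> indices, even for \<open>m = 1\<close>; this gives the conditionality
  constant \<open>1 / 4\<close>.\<close>

definition every_other :: "nat \<Rightarrow> nat set" where
  "every_other m = (\<lambda>j. m div 2 + 2 * j) ` {..<(m - m div 2 + 1) div 2}"

lemma every_other_less: "g \<in> every_other m \<Longrightarrow> m div 2 \<le> g \<and> g < m"
  by (auto simp: every_other_def)

lemma every_other_even: "g \<in> every_other m \<Longrightarrow> even (g - m div 2)"
  by (auto simp: every_other_def)

lemma card_every_other: "1 / 4 * real m \<le> real (card (every_other m))"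
proof -
  have "card (every_other m) = (m - m div 2 + 1) div 2"
    unfolding every_other_def by (subst card_image) (auto simp: inj_on_def)
  moreover have "m \<le> 4 * ((m - m div 2 + 1) div 2)" by presburger
  ultimately show ?thesis by linarith
qed

lemma finite_every_other: "finite (every_other m)"
  by (simp add: every_other_def)

lemma every_other_cond_block:
  assumes "g \<in> every_other (2 ^ k)"
  shows "cond_block g = 2 ^ k"
proof -
  have "cond_coord (2 ^ k) (Suc g)"
    using every_other_less[OF assms] by (auto simp: cond_coord_def pow2_def)
  then show ?thesis by (simp add: cond_coord_Suc_iff)
qed

lemma (in B_space_setup) single_block_B:
  assumes "\<And>n i. n < i \<Longrightarrow> v n i = 0" "\<And>n. n \<noteq> m \<Longrightarrow> v n = (\<lambda>_. 0)" "\<nu> m (v m) \<le> s"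
  shows "v \<in> B" and "N v \<le> s"
proof -
  have "v \<in> B" "N v \<le> (\<Sum>n\<in>{m}. \<nu> n (v n) powr p) powr (1 / p)"
    by (rule B_finite[of v "{m}"]; use assms in auto)+
  then show "v \<in> B" "N v \<le> s"
    using assms(3) p l_norm_nonneg[OF r, of m "v m"] by (auto simp: powr_powr)
qed

text \<open>
  The summing basis: the vector \<open>(1, 0, 1, 0, \<dots>)\<close> has the coefficients \<open>1, -1, 1, -1, \<dots>\<close>, and
  keeping only the positive ones makes the last coordinate large.
\<close>

definition sum_vec :: "nat \<Rightarrow> nat \<Rightarrow> nat \<Rightarrow> 'k::real_normed_field" where
  "sum_vec g m i = (if m = cond_block g \<and> g < i \<and> i \<le> m then 1 else 0)"

definition sum_fun :: "nat \<Rightarrow> (nat \<Rightarrow> nat \<Rightarrow> 'k::real_normed_field) \<Rightarrow> 'k" where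
  "sum_fun g v = v (cond_block g) (Suc g) - (if cond_block g div 2 < g then v (cond_block g) g else 0)"

text \<open>Stopping the summing basis freezes the coordinates beyond \<open>M\<close> at the value
  of coordinate \<open>M\<close>. The condition \<open>m div 2 < M\<close> excludes blocks not yet
  begun, in which position \<open>M\<close> is outside \<open>cond_coord\<close>.\<close>

definition sum_partial :: "nat \<Rightarrow> (nat \<Rightarrow> nat \<Rightarrow> 'k::real_normed_field) \<Rightarrow> nat \<Rightarrow> nat \<Rightarrow> 'k" where
  "sum_partial M v m i = (if cond_coord m i \<and> m div 2 < M then v m (min i M) else 0)"

lemma sum_partial_Suc:
  "sum_partial (Suc M) v = (\<lambda>n i. sum_partial M v n i + sum_fun M v * sum_vec M n i)"
proof (intro ext)
  fix m i
  show "sum_partial (Suc M) v m i = sum_partial M v m i + sum_fun M v * sum_vec M m i"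
  proof (cases "cond_coord m i")
    case False
    then show ?thesis using cond_coord_cond_block[of m M i] by (auto simp: sum_partial_def sum_vec_def)
  next
    case True
    \<comment> \<open>The block has not begun, or the coordinate is settled, or it passes from the
      value at \<open>M\<close> to that at \<open>Suc M\<close>; for \<open>M = m div 2\<close> it
      passes from 0.\<close>
    consider "m div 2 > M" | "m div 2 \<le> M" "i \<le> M" | "m div 2 \<le> M" "M < i" by linarith
    then show ?thesis
    proof cases
      case 1
      then show ?thesis using cond_block_lower[of m M] by (auto simp: sum_partial_def sum_vec_def)
    next
      case 2
      then show ?thesis using True by (auto simp: sum_partial_def sum_vec_def cond_coord_def)
    next
      case 3
      then have "m = cond_block M" using cond_coord_block_eq[OF True] by simp
      moreover have "min i (Suc M) = Suc M" "min i M = M" using 3 by auto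
      ultimately show ?thesis using 3 True
        by (auto simp: sum_partial_def sum_vec_def sum_fun_def cond_coord_def)
    qed
  qed
qed

lemma l_norm_infinity_le: "l_norm \<infinity> (Suc n) w \<le> s" if "\<And>i. i \<le> n \<Longrightarrow> norm (w i) \<le> s"
  using that by (auto simp: l_norm_infinity less_Suc_eq_le intro!: Max.boundedI)

text \<open>Partial sums only repeat or delete values of \<open>v\<close>, hence do not increase the
  maximum norm. The constant 3 is the one that the \<open>\<ell>\<^sub>1\<close> system
  yields.\<close>

lemma conditional_system_infinity:
  assumes "1 < p"
  shows "conditional_system \<infinity> p (sum_vec :: nat \<Rightarrow> nat \<Rightarrow> nat \<Rightarrow> 'k::real_normed_field) sum_fun sum_partial 3 (1 / 4)"
proof -
  interpret B_space_setup \<infinity> p "TYPE('k)" by unfold_locales (use assms in auto)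
  note le = norm_le_l_norm[OF r]
  have sv: "(sum_vec g :: nat \<Rightarrow> nat \<Rightarrow> 'k) \<in> B" "N (sum_vec g :: nat \<Rightarrow> nat \<Rightarrow> 'k) \<le> 1" for g
    by (rule single_block_B[of _ "cond_block g"]; auto simp: sum_vec_def fun_eq_iff intro!: l_norm_infinity_le)+
  show ?thesis
  proof unfold_locales
    show "(sum_vec g :: nat \<Rightarrow> nat \<Rightarrow> 'k) \<in> B" for g by (rule sv)
    show "N (sum_vec g :: nat \<Rightarrow> nat \<Rightarrow> 'k) \<le> 3" for g using sv(2)[of g] by simp
    show "1 \<le> 3 * N (sum_vec g :: nat \<Rightarrow> nat \<Rightarrow> 'k)" for g
      using coordinate_le_N[OF sv(1)[of g], of "cond_block g" "Suc g"] cond_block_bounds[of g] by (simp add: sum_vec_def)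
    show "sum_vec g m i = (0::'k)" if "\<not> cond_coord m i" for g m i
      using that cond_coord_cond_block[of m g i] by (auto simp: sum_vec_def)
    show "sum_fun g (sum_vec l) = (if g = l then 1 else 0 :: 'k)" for g l
    proof (cases "cond_block g = cond_block l")
      case True
      then show ?thesis using cond_block_bounds[of g] cond_block_bounds[of l] by (auto simp: sum_fun_def sum_vec_def)
    next
      case False
      then show ?thesis by (auto simp: sum_fun_def sum_vec_def)
    qed
    show "sum_fun g v = 0" if "\<And>m i. cond_coord m i \<Longrightarrow> v m i = 0" for g and v :: "nat \<Rightarrow> nat \<Rightarrow> 'k"
      using that cond_block_bounds[of g] by (simp add: sum_fun_def cond_coord_def)
    show "sum_fun g (\<lambda>n i. u n i + v n i) = sum_fun g u + (sum_fun g v :: 'k)" for g u v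
      by (simp add: sum_fun_def)
    show "sum_fun g (\<lambda>n i. s * v n i) = s * (sum_fun g v :: 'k)" for g s v
      by (simp add: sum_fun_def right_diff_distrib)
    show "sum_partial 0 v = (\<lambda>n i. 0 :: 'k)" for v by (simp add: sum_partial_def fun_eq_iff)
    show "sum_partial (Suc M) v = (\<lambda>n i. sum_partial M v n i + sum_fun M v * (sum_vec M n i :: 'k))" for M v
      by (rule sum_partial_Suc)
    have part: "norm (sum_partial M v m i) \<le> \<nu> m (v m)" for M m i and v :: "nat \<Rightarrow> nat \<Rightarrow> 'k"
      using le[of "min i M" m "v m"] l_norm_nonneg[OF r, of m "v m"] by (auto simp: sum_partial_def cond_coord_def)
    show "N (sum_partial M v) \<le> 3 * N v" if v: "v \<in> B" for M and v :: "nat \<Rightarrow> nat \<Rightarrow> 'k"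
    proof (rule B_dominated_id(2)[OF v])
      show "\<nu> n (sum_partial M v n) \<le> 3 * \<nu> n (v n)" for n
        using l_norm_infinity_le[of n "sum_partial M v n", OF part] l_norm_nonneg[OF r, of n "v n"] by linarith
    qed (auto simp: sum_partial_def cond_coord_def)
    show "N (\<lambda>n i. (if cond_coord n i then v n i else 0) - sum_partial M v n i) \<le> 3 * N (tail M v)"
      if v: "v \<in> B" for M and v :: "nat \<Rightarrow> nat \<Rightarrow> 'k"
    proof (rule B_dominated_id(2)[OF tail_B[OF v]])
      show "\<nu> n (\<lambda>i. (if cond_coord n i then v n i else 0) - sum_partial M v n i) \<le> 3 * \<nu> n (tail M v n)" for n
      proof (cases "n < M")
        case True
        then have "(\<lambda>i. (if cond_coord n i then v n i else 0) - sum_partial M v n i) = (\<lambda>i. 0)"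
          by (auto simp: sum_partial_def fun_eq_iff cond_coord_def)
        then show ?thesis
          using l_norm_nonneg[OF r, of n "tail M v n"] l_norm_single[OF r, of "\<lambda>_. 0 :: 'k" n] by simp
      next
        case False
        then have t: "tail M v n = v n" by (simp add: tail_def)
        have "norm ((if cond_coord n i then v n i else 0) - sum_partial M v n i) \<le> 3 * \<nu> n (v n)" if "i \<le> n" for i
          using norm_triangle_ineq4[of "if cond_coord n i then v n i else 0" "sum_partial M v n i"]
            part[of M v n i] le[OF that, of "v n"] l_norm_nonneg[OF r, of n "v n"] by (auto split: if_splits)
        then show ?thesis unfolding t by (rule l_norm_infinity_le)
      qed
    qed (use B_zero_above[OF v] in \<open>auto simp: sum_partial_def cond_coord_def\<close>)
    show "\<exists>v D. v \<in> B \<and> v \<noteq> (\<lambda>n i. 0 :: 'k) \<and> N v \<le> 1 \<and> sum_partial (2 ^ k) v = v \<and> D \<subseteq> {..<2 ^ k} \<and>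
        1 / 4 * 2 ^ k \<le> N (\<lambda>n i. \<Sum>g\<in>D. sum_fun g v * sum_vec g n i)" for k
    proof -
      define m :: nat where "m = 2 ^ k"
      define D where "D = every_other m"
      define v :: "nat \<Rightarrow> nat \<Rightarrow> 'k" where
        "v n i = (if n = m \<and> m div 2 < i \<and> i \<le> m \<and> even (i - m div 2 - 1) then 1 else 0)" for n i
      have m: "m > 0" "pow2 m" by (auto simp: m_def pow2_def)
      have v: "v \<in> B" "N v \<le> 1"
      proof -
        have 1: "v n i = 0" if "n < i" for n i using that by (auto simp: v_def)
        have 2: "v n = (\<lambda>_. 0)" if "n \<noteq> m" for n using that by (auto simp: v_def)
        have 3: "\<nu> m (v m) \<le> 1" by (rule l_norm_infinity_le) (simp add: v_def)
        show "v \<in> B" "N v \<le> 1" using single_block_B[of v m 1, OF 1 2 3] by auto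
      qed
      have "v m (Suc (m div 2)) = 1" using m by (simp add: v_def)
      then have "v \<noteq> (\<lambda>n i. 0)" by (metis zero_neq_one)
      moreover have "sum_partial m v = v"
        using m by (auto simp: sum_partial_def v_def fun_eq_iff cond_coord_def)
      moreover have cond_block: "cond_block g = m" "sum_fun g v = 1" if "g \<in> D" for g
      proof -
        show *: "cond_block g = m" using every_other_cond_block that by (simp add: D_def m_def)
        show "sum_fun g v = 1"
          using every_other_less[of g m] every_other_even[of g m] that by (auto simp: sum_fun_def * v_def D_def)
      qed
      moreover have "D \<subseteq> {..<m}" using every_other_less by (auto simp: D_def)
      moreover have "1 / 4 * 2 ^ k \<le> N (\<lambda>n i. \<Sum>g\<in>D. sum_fun g v * sum_vec g n i)"
      proof -
        have "(\<Sum>g\<in>D. sum_fun g v * sum_vec g m m) = (\<Sum>g\<in>D. 1 :: 'k)"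
          using every_other_less[of _ m] by (intro sum.cong) (auto simp: cond_block sum_vec_def D_def[symmetric])
        also have "\<dots> = of_nat (card D)" by simp
        finally have 1: "norm (\<Sum>g\<in>D. sum_fun g v * sum_vec g m m :: 'k) = real (card D)" by simp
        have "(\<lambda>n i. \<Sum>g\<in>D. sum_fun g v * sum_vec g n i) \<in> B"
        proof (rule single_block_B(1)[of _ m])
          show "(\<lambda>i. \<Sum>g\<in>D. sum_fun g v * sum_vec g n i) = (\<lambda>_. 0)" if "n \<noteq> m" for n
            using that by (auto simp: fun_eq_iff sum_vec_def cond_block intro!: sum.neutral)
        qed (auto simp: sum_vec_def intro!: sum.neutral)
        from coordinate_le_N[OF this, of m m] have "real (card D) \<le> N (\<lambda>n i. \<Sum>g\<in>D. sum_fun g v * sum_vec g n i)"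
          by (simp only: 1)
        then show ?thesis using card_every_other[of m] by (simp add: D_def m_def)
      qed
      ultimately show ?thesis using v unfolding m_def by blast
    qed
  qed simp
qed

text \<open>
  The differences of consecutive unit vectors: their sum is the first unit vector, whereas every
  other one of them are disjoint.
\<close>

definition diff_vec :: "nat \<Rightarrow> nat \<Rightarrow> nat \<Rightarrow> 'k::real_normed_field" where
  "diff_vec g m i = (if m = cond_block g \<and> i \<le> m then (if i = Suc g then 1 else if i = Suc (Suc g) then - 1 else 0) else 0)"

text \<open>Cumulative sums are dual to differences. In \<open>diff_vec\<close> the condition
  \<open>i \<le> m\<close> truncates the last vector of a block to a unit vector, so the vectors of
  a block span all its coordinates in \<open>cond_coord\<close>.\<close>

definition diff_fun :: "nat \<Rightarrow> (nat \<Rightarrow> nat \<Rightarrow> 'k::real_normed_field) \<Rightarrow> 'k" where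
  "diff_fun g v = (\<Sum>i\<in>{cond_block g div 2<..Suc g}. v (cond_block g) i)"

text \<open>Summation by parts: the coordinates up to \<open>M\<close> are final, and the next one
  carries minus the accumulated sum. In a block that begins there the sum is empty.\<close>

definition diff_partial :: "nat \<Rightarrow> (nat \<Rightarrow> nat \<Rightarrow> 'k::real_normed_field) \<Rightarrow> nat \<Rightarrow> nat \<Rightarrow> 'k" where
  "diff_partial M v m i = (if cond_coord m i then
     (if i \<le> M then v m i else if i = Suc M then - (\<Sum>j\<in>{m div 2<..M}. v m j) else 0) else 0)"

lemma diff_partial_Suc:
  "diff_partial (Suc M) v = (\<lambda>n i. diff_partial M v n i + diff_fun M v * diff_vec M n i)"
proof (intro ext)
  fix m i
  show "diff_partial (Suc M) v m i = diff_partial M v m i + diff_fun M v * diff_vec M m i"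
  proof (cases "cond_coord m i")
    case False
    then show ?thesis using cond_coord_cond_block[of m M i] by (auto simp: diff_partial_def diff_vec_def)
  next
    case True
    consider "i \<le> M" | "i = Suc M" | "i = Suc (Suc M)" "m = cond_block M" | "i = Suc (Suc M)" "m \<noteq> cond_block M" | "i > Suc (Suc M)"
      by linarith
    then show ?thesis
    proof cases
      case 2
      then have m: "m = cond_block M" using True cond_coord_Suc_iff by simp
      then have "{m div 2<..Suc M} = insert (Suc M) {m div 2<..M}" using cond_block_bounds[of M] by auto
      then show ?thesis using 2 True m
        by (simp add: diff_partial_def diff_vec_def diff_fun_def cond_coord_def)
    next
      case 3
      then show ?thesis using True by (simp add: diff_partial_def diff_vec_def diff_fun_def cond_coord_def)
    next
      case 4
      then have "\<not> m div 2 \<le> M" using True cond_coord_block_eq[OF True, of M] by auto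
      then have "{m div 2<..Suc M} = {}" by auto
      then show ?thesis using True 4 by (simp add: diff_partial_def diff_vec_def)
    qed (use True in \<open>auto simp: diff_partial_def diff_vec_def\<close>)
  qed
qed

lemma conditional_system_1:
  assumes "1 < p"
  shows "conditional_system 1 p (diff_vec :: nat \<Rightarrow> nat \<Rightarrow> nat \<Rightarrow> 'k::real_normed_field) diff_fun diff_partial 3 (1 / 4)"
proof -
  interpret B_space_setup 1 p "TYPE('k)" by unfold_locales (use assms in auto)
  note le = norm_le_l_norm[OF r]
  have dv: "(diff_vec g :: nat \<Rightarrow> nat \<Rightarrow> 'k) \<in> B" "N (diff_vec g :: nat \<Rightarrow> nat \<Rightarrow> 'k) \<le> 2" for g
  proof -
    have "\<nu> (cond_block g) (diff_vec g (cond_block g) :: nat \<Rightarrow> 'k) \<le> (\<Sum>i<Suc (cond_block g). (if i = Suc g then 1 else 0) + (if i = Suc (Suc g) then 1 else 0))"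
      unfolding l_norm_1 by (intro sum_mono) (auto simp: diff_vec_def)
    also have "\<dots> \<le> 2" unfolding sum.distrib by (simp only: sum.delta finite_lessThan) auto
    finally have *: "\<nu> (cond_block g) (diff_vec g (cond_block g) :: nat \<Rightarrow> 'k) \<le> 2" .
    show "(diff_vec g :: nat \<Rightarrow> nat \<Rightarrow> 'k) \<in> B" "N (diff_vec g :: nat \<Rightarrow> nat \<Rightarrow> 'k) \<le> 2"
      using single_block_B[of "diff_vec g" "cond_block g" 2] * by (auto simp: diff_vec_def[abs_def])
  qed
  show ?thesis
  proof unfold_locales
    show "(diff_vec g :: nat \<Rightarrow> nat \<Rightarrow> 'k) \<in> B" for g by (rule dv)
    show "N (diff_vec g :: nat \<Rightarrow> nat \<Rightarrow> 'k) \<le> 3" for g using dv(2)[of g] by simp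
    show "1 \<le> 3 * N (diff_vec g :: nat \<Rightarrow> nat \<Rightarrow> 'k)" for g
      using coordinate_le_N[OF dv(1)[of g], of "cond_block g" "Suc g"] cond_block_bounds[of g] by (simp add: diff_vec_def)
    show "diff_vec g m i = (0::'k)" if "\<not> cond_coord m i" for g m i
      using that cond_coord_cond_block[of m g i] by (auto simp: diff_vec_def)
    show "diff_fun g (diff_vec l) = (if g = l then 1 else 0 :: 'k)" for g l
    proof (cases "cond_block g = cond_block l")
      case True
      have "diff_fun g (diff_vec l) = (\<Sum>i\<in>{cond_block g div 2<..Suc g}. (if i = Suc l then 1 else 0) - (if i = Suc (Suc l) then 1 else 0 :: 'k))"
        unfolding diff_fun_def using cond_block_bounds(3)[of g] by (intro sum.cong) (auto simp: diff_vec_def True)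
      then show ?thesis using cond_block_bounds[of g] cond_block_bounds[of l] True by (auto simp: sum_subtractf)
    next
      case False
      then show ?thesis by (auto simp: diff_fun_def diff_vec_def)
    qed
    show "diff_fun g v = 0" if "\<And>m i. cond_coord m i \<Longrightarrow> v m i = 0" for g and v :: "nat \<Rightarrow> nat \<Rightarrow> 'k"
      using that cond_block_bounds[of g] by (auto simp: diff_fun_def cond_coord_def intro!: sum.neutral)
    show "diff_fun g (\<lambda>n i. u n i + v n i) = diff_fun g u + (diff_fun g v :: 'k)" for g u v
      by (simp add: diff_fun_def sum.distrib)
    show "diff_fun g (\<lambda>n i. s * v n i) = s * (diff_fun g v :: 'k)" for g s v
      by (simp add: diff_fun_def sum_distrib_left)
    show "diff_partial 0 v = (\<lambda>n i. 0 :: 'k)" for v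
      by (auto simp: diff_partial_def fun_eq_iff cond_coord_def)
    show "diff_partial (Suc M) v = (\<lambda>n i. diff_partial M v n i + diff_fun M v * (diff_vec M n i :: 'k))" for M v
      by (rule diff_partial_Suc)
    have part: "\<nu> m (diff_partial M v m) \<le> 2 * \<nu> m (v m)" for M m and v :: "nat \<Rightarrow> nat \<Rightarrow> 'k"
    proof -
      \<comment> \<open>At most one coordinate is new, and it is bounded by the whole
        \<open>\<ell>\<^sub>1\<close> norm; hence the factor 2, and 3 for the difference from the
        limit.\<close>
      have "norm (diff_partial M v m i) \<le> norm (v m i) + (if i = Suc M then \<nu> m (v m) else 0)" if "i < Suc m" for i
      proof (cases "cond_coord m i \<and> i = Suc M")
        case True
        have "norm (- (\<Sum>j\<in>{m div 2<..M}. v m j)) \<le> (\<Sum>j\<in>{m div 2<..M}. norm (v m j))" by (simp add: norm_sum)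
        also have "\<dots> \<le> (\<Sum>j<Suc m. norm (v m j))" using True that by (intro sum_mono2) auto
        finally show ?thesis using True
          by (auto simp: diff_partial_def l_norm_1 simp del: sum.lessThan_Suc intro: add_increasing)
      qed (auto simp: diff_partial_def l_norm_nonneg[OF r])
      then have "\<nu> m (diff_partial M v m) \<le> (\<Sum>i<Suc m. norm (v m i) + (if i = Suc M then \<nu> m (v m) else 0))"
        unfolding l_norm_1[of "Suc m" "diff_partial M v m"] by (intro sum_mono) auto
      also have "\<dots> \<le> \<nu> m (v m) + \<nu> m (v m)"
        unfolding sum.distrib l_norm_1[symmetric] using l_norm_nonneg[OF r, of m "v m"]
        by (intro add_left_mono) (simp only: sum.delta finite_lessThan split: if_splits, auto)
      finally show ?thesis by simp
    qed
    show "N (diff_partial M v) \<le> 3 * N v" if v: "v \<in> B" for M and v :: "nat \<Rightarrow> nat \<Rightarrow> 'k"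
    proof (rule B_dominated_id(2)[OF v])
      show "\<nu> n (diff_partial M v n) \<le> 3 * \<nu> n (v n)" for n
        using part[of n M v] l_norm_nonneg[OF r, of n "v n"] by linarith
    qed (auto simp: diff_partial_def cond_coord_def)
    show "N (\<lambda>n i. (if cond_coord n i then v n i else 0) - diff_partial M v n i) \<le> 3 * N (tail M v)"
      if v: "v \<in> B" for M and v :: "nat \<Rightarrow> nat \<Rightarrow> 'k"
    proof (rule B_dominated_id(2)[OF tail_B[OF v]])
      show "\<nu> n (\<lambda>i. (if cond_coord n i then v n i else 0) - diff_partial M v n i) \<le> 3 * \<nu> n (tail M v n)" for n
      proof (cases "n < M")
        case True
        then have "(\<lambda>i. (if cond_coord n i then v n i else 0) - diff_partial M v n i) = (\<lambda>i. 0)"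
          by (auto simp: diff_partial_def fun_eq_iff cond_coord_def)
        then show ?thesis
          using l_norm_nonneg[OF r, of n "tail M v n"] l_norm_single[OF r, of "\<lambda>_. 0 :: 'k" n] by simp
      next
        case False
        then have t: "tail M v n = v n" by (simp add: tail_def)
        have "\<nu> n (\<lambda>i. if cond_coord n i then v n i else 0) \<le> \<nu> n (v n)" by (rule l_norm_mono[OF r]) simp
        then show ?thesis unfolding t
          using l_norm_diff[OF r, of n "\<lambda>i. if cond_coord n i then v n i else 0" "diff_partial M v n"] part[of n M v]
          by linarith
      qed
    qed (use B_zero_above[OF v] in \<open>auto simp: diff_partial_def cond_coord_def\<close>)
    show "\<exists>v D. v \<in> B \<and> v \<noteq> (\<lambda>n i. 0 :: 'k) \<and> N v \<le> 1 \<and> diff_partial (2 ^ k) v = v \<and> D \<subseteq> {..<2 ^ k} \<and>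
        1 / 4 * 2 ^ k \<le> N (\<lambda>n i. \<Sum>g\<in>D. diff_fun g v * diff_vec g n i)" for k
    proof -
      define m :: nat where "m = 2 ^ k"
      define D where "D = every_other m"
      define v :: "nat \<Rightarrow> nat \<Rightarrow> 'k" where "v n i = (if n = m \<and> i = Suc (m div 2) then 1 else 0)" for n i
      have m: "m > 0" "pow2 m" "m div 2 < m" by (auto simp: m_def pow2_def)
      have nu: "\<nu> m (v m) \<le> 1"
      proof -
        have "\<nu> m (v m) \<le> (\<Sum>i<Suc m. if i = Suc (m div 2) then 1 else 0)"
          unfolding l_norm_1 by (intro sum_mono) (auto simp: v_def)
        also have "\<dots> \<le> 1" by (simp only: sum.delta finite_lessThan) auto
        finally show ?thesis .
      qed
      have v: "v \<in> B" "N v \<le> 1"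
      proof -
        have 1: "v n i = 0" if "n < i" for n i using that m by (auto simp: v_def)
        have 2: "v n = (\<lambda>_. 0)" if "n \<noteq> m" for n using that by (auto simp: v_def)
        show "v \<in> B" "N v \<le> 1" using single_block_B[of v m 1, OF 1 2 nu] by auto
      qed
      have "v m (Suc (m div 2)) = 1" by (simp add: v_def)
      then have "v \<noteq> (\<lambda>n i. 0)" by (metis zero_neq_one)
      moreover have "diff_partial m v = v"
        using m by (auto simp: diff_partial_def v_def fun_eq_iff cond_coord_def)
      moreover have cond_block: "cond_block g = m" "diff_fun g v = 1" if "g \<in> D" for g
      proof -
        show *: "cond_block g = m" using every_other_cond_block that by (simp add: D_def m_def)
        have "m div 2 \<le> g" using every_other_less[of g m] that by (simp add: D_def)
        then show "diff_fun g v = 1" by (simp add: diff_fun_def * v_def)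
      qed
      moreover have "D \<subseteq> {..<m}" using every_other_less by (auto simp: D_def)
      moreover have "1 / 4 * 2 ^ k \<le> N (\<lambda>n i. \<Sum>g\<in>D. diff_fun g v * diff_vec g n i)"
      proof -
        define w :: "nat \<Rightarrow> nat \<Rightarrow> 'k" where "w n i = (\<Sum>g\<in>D. diff_fun g v * diff_vec g n i)" for n i
        have fin: "finite D" by (simp add: D_def finite_every_other)
        have w1: "w m (Suc g) = 1" if g: "g \<in> D" for g
        proof -
          have "diff_fun l v * diff_vec l m (Suc g) = (if l = g then 1 else 0)" if "l \<in> D" for l
          proof -
            \<comment> \<open>The entry -1 of \<open>diff_vec l\<close> sits at
              \<open>Suc (Suc l)\<close> and would meet the entry 1 of \<open>diff_vec g\<close>
              only for neighbours, which parity excludes. So the \<open>\<ell>\<^sub>1\<close> norm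
              counts all of \<open>D\<close>.\<close>
            have "g \<noteq> Suc l"
            proof
              assume "g = Suc l"
              then have "g - m div 2 = Suc (l - m div 2)"
                using every_other_less[of l m] that by (simp add: D_def Suc_diff_le)
              then show False using every_other_even[of g m] every_other_even[of l m] g that by (simp add: D_def)
            qed
            moreover have "g < m" using every_other_less[of g m] g by (simp add: D_def)
            ultimately show ?thesis using cond_block[OF that] by (auto simp: diff_vec_def)
          qed
          then have "w m (Suc g) = (\<Sum>l\<in>D. if l = g then 1 else 0)" unfolding w_def by (rule sum.cong[OF refl])
          then show ?thesis using fin g by simp
        qed
        have "w \<in> B"
        proof (rule single_block_B(1)[of _ m])
          show "w n = (\<lambda>_. 0)" if "n \<noteq> m" for n
            using that by (auto simp: w_def fun_eq_iff diff_vec_def cond_block intro!: sum.neutral)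
        qed (auto simp: w_def diff_vec_def intro!: sum.neutral)
        have "real (card D) = (\<Sum>g\<in>D. norm (w m (Suc g)))" by (simp add: w1)
        also have "\<dots> = (\<Sum>i\<in>Suc ` D. norm (w m i))" by (simp add: sum.reindex)
        also have "\<dots> \<le> (\<Sum>i<Suc m. norm (w m i))"
          using every_other_less[of _ m] by (intro sum_mono2) (auto simp: D_def)
        also have "\<dots> \<le> N w" using \<nu>_le_N[OF \<open>w \<in> B\<close>, of m] by (simp only: l_norm_1)
        finally show ?thesis using card_every_other[of m] unfolding w_def by (simp add: D_def m_def)
      qed
      ultimately show ?thesis using v unfolding m_def by blast
    qed
  qed simp
qed

lemma (in banach_space_over) exists_quasi_greedy_of_complemented:
  fixes \<sigma> :: "nat \<Rightarrow> nat \<Rightarrow> nat \<Rightarrow> 'k"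
  assumes "conditional_system r p \<sigma> \<phi> q C c"
    and "schauder_basis smul x" "complemented_subspace smul Y"
    and "isomorphic_to smul (B_space r p) (B_norm r p) Y"
  shows "\<exists>x. quasi_greedy smul x \<and> approx_on {2..} (w_cond_const smul x) (\<lambda>m. ln (real m))"
proof -
  interpret conditional_system r p "TYPE('k)" \<sigma> \<phi> q C c by (rule assms)
  obtain P where P: "bounded_linear P" "\<And>c x. P (smul c x) = smul c (P x)" "\<And>x. P (P x) = P x" "range P = Y"
    using assms(3) unfolding complemented_subspace_def by blast
  obtain T a b where T: "bij_betw T B Y" "\<And>u v. u \<in> B \<Longrightarrow> v \<in> B \<Longrightarrow> T (\<lambda>n i. u n i + v n i) = T u + T v"
    "\<And>c v. v \<in> B \<Longrightarrow> T (\<lambda>n i. c * v n i) = smul c (T v)" "a > 0"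
    "\<And>v. v \<in> B \<Longrightarrow> a * N v \<le> norm (T v)" "\<And>v. v \<in> B \<Longrightarrow> norm (T v) \<le> b * N v"
    using assms(4) unfolding isomorphic_to_def by blast
  interpret bounded_linear P by (rule P)
  \<comment> \<open>Enlarging \<open>b\<close> gives the positivity that the locale asks for, and
    \<open>N_nonneg\<close> preserves the estimate.\<close>
  interpret conditional_embedding smul r p T P a "max 1 b" \<sigma> \<phi> q C c
  proof unfold_locales
    show "norm (T v) \<le> max 1 b * N v" if "v \<in> B" for v
      by (rule order_trans[OF T(6)[OF that]]) (intro mult_right_mono N_nonneg, simp)
  qed (use P T in auto)
  show ?thesis by (rule exists_quasi_greedy[OF assms(2)])
qed

theorem theorem3p8:
  fixes smul :: "'k::real_or_complex \<Rightarrow> 'a::banach \<Rightarrow> 'a"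
    and p :: real
  assumes "banach_space_over smul"
    and "\<exists>x. schauder_basis smul x"
    and "1 < p"
    and "(\<exists>Y. complemented_subspace smul Y \<and>
              isomorphic_to smul (B_space \<infinity> p) (B_norm \<infinity> p) Y) \<or>
         (\<exists>Y. complemented_subspace smul Y \<and>
              isomorphic_to smul (B_space 1 p) (B_norm 1 p) Y)"
  shows "\<exists>x. quasi_greedy smul x \<and>
             approx_on {2..} (\<lambda>m. w_cond_const smul x m) (\<lambda>m. ln (real m))"
proof -
  interpret banach_space_over smul by (rule assms)
  show ?thesis
    using assms(2,4) exists_quasi_greedy_of_complemented[OF conditional_system_infinity[OF assms(3)]]
      exists_quasi_greedy_of_complemented[OF conditional_system_1[OF assms(3)]] by blast
qed

end
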